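(* Let $\tau\in\mathbb{R}$ and let $\gamma:[0,\infty)\to\mathbb{R}^{\ge0}$ be a monotone increasing function with $\gamma(t)=O(t^2)$ as $t\to0$ such that $\gamma$ is a $\gamma$-augury. Let $f:\Pi\to\overline{\Pi}$ be an analytic function which has a nontangential limit $f(\tau)\in\mathbb{C}$ at $\tau$. Let $U$ be a neighborhood of $f(\tau)$. Let $g:\Pi\cup U\to\mathbb{C}$ be a nonconstant analytic function such that $g(\Pi)\subseteq\overline{\Pi}$ and $g|_{\mathbb{R}\cap U}$ is real-valued. Then $f$ is $\gamma$-regular at $\tau$ if and only if $g\circ f$ is $\gamma$-regular at $\tau$.
   Context: $\Pi=\{z\in\mathbb{C}:\operatorname{Im} z>0\}$ and $\overline\Pi$ is the closed upper half plane. The Nevanlinna measure $\mu_f$ of an analytic $f:\Pi\to\overline\Pi$ is the positive Borel measure on $\mathbb{R}$ that is the weak limit, as $y\to0^+$, of the measures $\operatorname{Im} f(x+iy)\,dx$. For $\gamma$ monotone increasing and $O(t^2)$ as $t\to0$ (with $\gamma(t)>0$ for $t>0$, and the convention $1/0=+\infty$), $f$ is $\gamma$-regular at $\tau$ if there is $C>0$ such that $t\mapsto\frac{1}{\gamma(C|t-\tau|)}$ is integrable on a neighborhood of $\tau$ with respect to $\mu_f$. A function $\lambda:[0,\infty)\to\mathbb{R}^{\ge0}$ with $\lambda(t)=o(t)$ as $t\to0$ is a $\gamma$-augury if there is $C>0$ such that $\frac{t\lambda(Ct)\,\mathrm{d}\gamma(t)}{\gamma(t)^2}$ is integrable on $[0,1)$,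 where $\mathrm{d}\gamma$ is the distributional derivative of $\gamma$ (a positive measure).
   Formalization: "Nonconstant" is taken to mean that g is not constant on Π; this agrees with nonconstancy on Π∪U when Π∪U is connected, and without it the claim fails for U with a component away from Π (for example g = 0 on Π and near f(τ), but not on that component). *)

theory Defs
  imports "HOL-Analysis.Analysis" "HOL-Library.Landau_Symbols"
begin

abbreviation upper_half_plane :: "complex set" where
  "upper_half_plane \<equiv> {z. Im z > 0}"

abbreviation closed_upper_half_plane :: "complex set" where
  "closed_upper_half_plane \<equiv> {z. Im z \<ge> 0}"

definition nontangential_limit :: "(complex \<Rightarrow> complex) \<Rightarrow> real \<Rightarrow> complex \<Rightarrow> bool" where
  "nontangential_limit f \<tau> w \<longleftrightarrow>
     (\<forall>c>0. (f \<longlongrightarrow> w) (at (of_real \<tau>) within {z. Im z > 0 \<and> cmod (z - of_real \<tau>) \<le> c * Im z}))"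

text \<open>
  The measures Im f(x + iy) dx may have infinite mass and may lose mass at infinity in the limit
  (f(z) = z), so their weak limit is tested against continuous functions of compact support.
\<close>

definition weak_limit :: "('a \<Rightarrow> real measure) \<Rightarrow> real measure \<Rightarrow> 'a filter \<Rightarrow> bool" where
  "weak_limit M \<mu> F \<longleftrightarrow>
     (\<forall>h::real \<Rightarrow> real. continuous_on UNIV h \<and> bounded {x. h x \<noteq> 0} \<longrightarrow>
        ((\<lambda>y. \<integral>x. h x \<partial>M y) \<longlongrightarrow> (\<integral>x. h x \<partial>\<mu>)) F)"

text \<open>
  Finiteness on compact sets is what makes the limit unique: otherwise the Bochner integral of a
  non-integrable test function would be 0 by convention.
\<close>

definition nevanlinna_measure :: "(complex \<Rightarrow> complex) \<Rightarrow> real measure" where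
  "nevanlinna_measure f =
     (THE \<mu>. sets \<mu> = sets borel \<and> (\<forall>K. compact K \<longrightarrow> emeasure \<mu> K < \<infinity>) \<and>
        weak_limit (\<lambda>y. density lborel (\<lambda>x. ennreal (Im (f (Complex x y))))) \<mu> (at_right 0))"

text \<open>In \<^typ>\<open>ennreal\<close>, 1 / 0 is infinite.\<close>

definition gamma_regular :: "(real \<Rightarrow> real) \<Rightarrow> (complex \<Rightarrow> complex) \<Rightarrow> real \<Rightarrow> bool" where
  "gamma_regular \<gamma> f \<tau> \<longleftrightarrow>
     (\<exists>C>0. \<exists>N. open N \<and> \<tau> \<in> N \<and>
        (\<integral>\<^sup>+ t\<in>N. 1 / ennreal (\<gamma> (C * \<bar>t - \<tau>\<bar>)) \<partial>nevanlinna_measure f) < \<infinity>)"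

text \<open>
  The distributional derivative of a monotone \<open>\<gamma>\<close> on the half-line, extended by 0 to the negative
  reals, is the Stieltjes measure of its right-continuous version \<open>\<gamma>(t+)\<close>; the values of \<open>\<gamma>\<close> itself
  at its jumps are irrelevant here. See \<open>distributional_derivative_test\<close> below.
\<close>

definition distributional_derivative :: "(real \<Rightarrow> real) \<Rightarrow> real measure" where
  "distributional_derivative \<gamma> = interval_measure (\<lambda>t. if t < 0 then 0 else INF s\<in>{t<..}. \<gamma> s)"

definition augury :: "(real \<Rightarrow> real) \<Rightarrow> (real \<Rightarrow> real) \<Rightarrow> bool" where
  "augury \<gamma> l \<longleftrightarrow> (\<forall>t\<ge>0. 0 \<le> l t) \<and> l \<in> o[at_right 0](\<lambda>t. t) \<and>
     (\<exists>C>0. set_integrable (distributional_derivative \<gamma>) {0..<1} (\<lambda>t. t * l (C * t) / (\<gamma> t)\<^sup>2))"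

lemma distributional_derivative_test:
  fixes \<gamma> \<phi> \<phi>' :: "real \<Rightarrow> real"
  assumes mono: "mono_on {0..} \<gamma>" and nonneg: "\<forall>t\<ge>0. 0 \<le> \<gamma> t"
    and deriv: "\<And>x. (\<phi> has_real_derivative \<phi>' x) (at x)"
    and cont: "continuous_on UNIV \<phi>'" and supp: "bounded {x. \<phi> x \<noteq> 0}"
  shows "(\<integral>t. \<phi> t \<partial>distributional_derivative \<gamma>) =
           - (\<integral>t. \<phi>' t * (if t < 0 then 0 else \<gamma> t) \<partial>lborel)"
proof -
  define F where "F = (\<lambda>t. if t < 0 then 0 else INF s\<in>{t<..}. \<gamma> s)"
  define M where "M = interval_measure F"
  define G where "G = (\<lambda>t. if t < 0 then 0 else \<gamma> t)"
  have bdd: "bdd_below (\<gamma> ` {t<..})" if "t \<ge> 0" for t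
    using nonneg that by (intro bdd_belowI2[of _ 0]) auto
  have G_le_F: "G t \<le> F t" for t
    using mono by (auto simp: F_def G_def mono_on_def intro!: cINF_greatest)
  have F_le: "F t \<le> G s" if "t < s" for t s
  proof (cases "t < 0")
    case True
    then show ?thesis using nonneg by (simp add: F_def G_def)
  next
    case False
    then have "(INF s\<in>{t<..}. \<gamma> s) \<le> \<gamma> s"
      using that bdd[of t] by (intro cINF_lower) auto
    then show ?thesis using False that by (simp add: F_def G_def)
  qed
  have monoF: "F x \<le> F y" if "x \<le> y" for x y
    using that F_le[of x y] G_le_F[of y] by (cases "x = y") simp_all
  have monoG: "mono G"
  proof (rule monoI)
    fix x y :: real assume "x \<le> y"
    then show "G x \<le> G y"
      using G_le_F[of x] F_le[of x y] by (cases "x = y") simp_all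
  qed
  have rcF: "continuous (at_right a) F" for a
    unfolding continuous_within
  proof (rule order_tendstoI)
    fix l assume "l < F a"
    then show "\<forall>\<^sub>F x in at_right a. l < F x"
      by (intro eventually_mono[OF eventually_at_right_less[of a]])
        (meson less_imp_le less_le_trans monoF)
  next
    fix u assume u: "F a < u"
    have "\<exists>b>a. G b < u"
    proof (cases "a < 0")
      case True
      then show ?thesis using u by (intro exI[of _ "a/2"]) (auto simp: F_def G_def)
    next
      case False
      have "(INF s\<in>{a<..}. \<gamma> s) < u" using False u by (simp add: F_def)
      have "\<exists>s\<in>{a<..}. \<gamma> s < u"
      proof (rule ccontr)
        assume *: "\<not> (\<exists>s\<in>{a<..}. \<gamma> s < u)"
        have "u \<le> (INF s\<in>{a<..}. \<gamma> s)"
          by (rule cINF_greatest) (use * in \<open>simp_all add: not_less\<close>)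
        with \<open>(INF s\<in>{a<..}. \<gamma> s) < u\<close> show False by linarith
      qed
      then obtain s where "s > a" "\<gamma> s < u" by (elim bexE) simp
      then show ?thesis using False by (intro exI[of _ s]) (simp add: G_def)
    qed
    then obtain b where "b > a" "G b < u" by blast
    then show "\<forall>\<^sub>F x in at_right a. F x < u"
      by (intro eventually_mono[OF eventually_at_right_real[of a b]])
        (auto dest: F_le)
  qed
  interpret M: sigma_finite_measure M
    unfolding M_def by (rule sigma_finite_interval_measure[OF monoF rcF])
  interpret P: pair_sigma_finite M lborel ..
  have setsM[measurable_cong]: "sets M = sets borel" by (simp add: M_def)
  have emM: "emeasure M {a<..b} = ennreal (F b - F a)" if "a \<le> b" for a b
    unfolding M_def by (rule emeasure_interval_measure_Ioc[OF that monoF rcF])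
  obtain R where R: "R > 0" "\<And>x. \<bar>x\<bar> > R \<Longrightarrow> \<phi> x = 0"
    using supp unfolding bounded_pos by (force simp: not_le[symmetric])
  define S where "S = R + 1"
  have S: "S > 0" "\<And>x. \<bar>x\<bar> \<ge> S \<Longrightarrow> \<phi> x = 0" using R by (auto simp: S_def)
  have \<phi>'0: "\<phi>' x = 0" if "\<bar>x\<bar> \<ge> S" for x
  proof -
    have "(\<phi> has_real_derivative 0) (at x)"
    proof (rule DERIV_cong_ev[THEN iffD1, OF refl _ refl DERIV_const[of 0]])
      have "\<forall>\<^sub>F y in nhds x. y \<in> - {-R..R}"
        using that R by (intro eventually_nhds_in_open) (auto simp: S_def)
      then show "\<forall>\<^sub>F y in nhds x. 0 = \<phi> y"
        by eventually_elim (use R in \<open>auto simp: abs_if\<close>)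
    qed
    then show ?thesis using deriv DERIV_unique by blast
  qed
  have [measurable]: "\<phi>' \<in> borel_measurable borel"
    using cont by (rule borel_measurable_continuous_onI)
  have ctG: "countable {x. \<not> isCont G x}" using monoG by (rule mono_ctble_discont)
  have FG: "F x = G x" if "isCont G x" for x
  proof (rule antisym)
    have "(G \<longlongrightarrow> G x) (at_right x)"
      using that by (auto simp: isCont_def filterlim_at_split)
    then show "F x \<le> G x"
      by (rule tendsto_lowerbound) (auto intro: F_le eventually_mono[OF eventually_at_right_less])
  qed (rule G_le_F)
  define K where "K = (\<lambda>t s. indicator {-S<..S} t * (indicator {-S..S} s * (if t \<le> s then \<phi>' s else 0)))"
  have bound: "\<exists>B. \<forall>s\<in>{-S..S}. \<bar>\<phi>' s\<bar> \<le> B"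
    using compact_continuous_image[OF continuous_on_subset[OF cont, of "{-S..S}"]]
    by (auto dest!: compact_imp_bounded simp: bounded_iff)
  then obtain B where B: "\<And>s. s \<in> {-S..S} \<Longrightarrow> \<bar>\<phi>' s\<bar> \<le> B" by blast
  have intK: "integrable (M \<Otimes>\<^sub>M lborel) (case_prod K)"
  proof -
    have "integrable (M \<Otimes>\<^sub>M lborel) (\<lambda>x. B * indicator ({-S<..S} \<times> {-S..S}) x)"
      using S emM[of "-S" S]
      by (intro integrable_mult_right integrable_real_indicator)
         (auto simp: lborel.emeasure_pair_measure_Times setsM ennreal_mult_less_top)
    then show ?thesis
      by (rule Bochner_Integration.integrable_bound)
         (auto simp: K_def indicator_def split: prod.splits
           intro!: AE_I2 order_trans[OF B] order_trans[OF _ abs_ge_self])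
  qed
  have inner1: "(\<integral>s. K t s \<partial>lborel) = - \<phi> t" for t
  proof (cases "t \<in> {-S<..S}")
    case True
    have "(\<integral>s. K t s \<partial>lborel) = (\<integral>s. \<phi>' s * indicator {t..S} s \<partial>lborel)"
      using True by (intro Bochner_Integration.integral_cong) (auto simp: K_def indicator_def)
    also have "\<dots> = \<phi> S - \<phi> t"
      using True cont deriv by (intro integral_FTC_Icc_real) (auto simp: continuous_on_eq_continuous_at)
    finally show ?thesis using S by simp
  next
    case False
    then show ?thesis using S(2)[of t] by (auto simp: K_def)
  qed
  have inner2: "(\<integral>t. K t s \<partial>M) = \<phi>' s * F s" for s
  proof (cases "s \<in> {-S..S}")
    case True
    have "(\<integral>t. K t s \<partial>M) = (\<integral>t. \<phi>' s * indicator {-S<..s} t \<partial>M)"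
      using True by (intro Bochner_Integration.integral_cong) (auto simp: K_def indicator_def)
    also have "\<dots> = \<phi>' s * measure M {-S<..s}" by (simp add: setsM)
    also have "measure M {-S<..s} = F s - F (-S)"
      using True emM[of "-S" s] monoF[of "-S" s] by (simp add: measure_def)
    also have "F (-S) = 0" using S by (simp add: F_def)
    finally show ?thesis by simp
  next
    case False
    then show ?thesis using \<phi>'0[of s] by (auto simp: K_def)
  qed
  have "(\<integral>t. \<phi> t \<partial>M) = - (\<integral>t. (\<integral>s. K t s \<partial>lborel) \<partial>M)"
    by (simp add: inner1)
  also have "\<dots> = - (\<integral>s. (\<integral>t. K t s \<partial>M) \<partial>lborel)"
    using P.Fubini_integral[OF intK] by simp
  also have "\<dots> = - (\<integral>s. \<phi>' s * F s \<partial>lborel)"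
    by (simp add: inner2)
  also have "(\<integral>s. \<phi>' s * F s \<partial>lborel) = (\<integral>s. \<phi>' s * G s \<partial>lborel)"
  proof (rule integral_cong_AE)
    have "AE s in lborel. s \<notin> {x. \<not> isCont G x}"
      using countable_imp_null_set_lborel[OF ctG] by (rule AE_not_in)
    then show "AE s in lborel. \<phi>' s * F s = \<phi>' s * G s"
      by eventually_elim (simp add: FG)
    have [measurable]: "F \<in> borel_measurable borel" "G \<in> borel_measurable borel"
      using monoF monoG by (auto intro!: borel_measurable_mono monoI)
    show "(\<lambda>s. \<phi>' s * F s) \<in> borel_measurable lborel"
      "(\<lambda>s. \<phi>' s * G s) \<in> borel_measurable lborel" by measurable
  qed
  finally show ?thesis
    by (simp add: distributional_derivative_def M_def F_def G_def)
qed

end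

theory Submission
  imports Defs "HOL-Complex_Analysis.Complex_Analysis" "HOL-Probability.Probability"
begin

text \<open>
  Write \<open>h = g \<circ> f\<close>, let \<open>\<mu>\<close> be the Nevanlinna measure of a Pick function \<open>F\<close>, and let
  \<open>r\<^sub>k = 2\<^sup>-\<^sup>k\<close>. Regularity says that \<open>1 / \<gamma>(C \<bar>t - \<tau>\<bar>)\<close> is integrable, so \<open>\<mu>\<close> gives the interval
  \<open>\<bar>t - \<tau>\<bar> \<le> 2 r\<^sub>k\<close> a mass \<open>o(y\<^sub>k)\<close>, where \<open>y\<^sub>k = \<gamma>(2 C r\<^sub>k)\<close>, and, as \<open>\<gamma>(t) = O(t\<^sup>2)\<close>, also
  \<open>(t - \<tau>)\<^sup>-\<^sup>2\<close> is integrable. The idea is to compare \<open>f\<close> and \<open>h\<close> not on the real line, where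
  nothing is known about the values of \<open>f\<close>, but at the height \<open>y\<^sub>k\<close> above the annulus
  \<open>r\<^sub>k / 2 < \<bar>t - \<tau>\<bar> \<le> r\<^sub>k\<close>.

  This height is large enough for \<open>F\<close> to be close to its nontangential limit there: by the
  Schwarz--Pick inequality \<open>\<bar>F'(z)\<bar> Im z \<le> Im F(z)\<close> (\<open>Schwarz_Pick_uhp\<close>), the oscillation of \<open>F\<close> on
  a vertical segment going up from height \<open>y\<^sub>k\<close> to height \<open>\<bar>x - \<tau>\<bar>\<close> is bounded by the integral of
  \<open>Im F / Im z\<close>, and the Poisson integral bounds this by \<open>O(r\<^sub>k)\<close> plus the quotient of the mass of
  \<open>\<bar>t - \<tau>\<bar> \<le> 2 r\<^sub>k\<close> by \<open>y\<^sub>k\<close>, which tends to 0 (\<open>vertical_oscillation\<close>). The height is also small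
  enough to recover the measure: the integral of \<open>\<pi> Im F(x + i y\<^sub>k)\<close> over the annulus is at least half
  the mass of the annulus, and at most \<open>\<pi>\<close> times the mass of a slightly larger annulus up to
  \<open>O(r\<^sub>k y\<^sub>k)\<close> (\<open>annulus_mass_le\<close>, \<open>annulus_upper_bounds\<close>). Hence if \<open>Im H \<le> K Im F\<close> at these
  heights, dividing by \<open>y\<^sub>k\<close> and summing over \<open>k\<close> carries regularity from \<open>F\<close> to \<open>H\<close>
  (\<open>gamma_regular_transfer\<close>).

  It remains to compare \<open>f\<close> and \<open>h\<close> where one of them is close to its limit. Near \<open>f(\<tau>)\<close> we have
  \<open>Im g(w) \<le> K Im w\<close> because \<open>g\<close> is real on the real line (\<open>Im_le_of_real_on_reals\<close>), and
  \<open>Im g(w) \<ge> c Im w\<close> because \<open>Im g(x + i y) / y\<close> decreases in \<open>y\<close> (\<open>Im_ge_of_pick\<close>). In the direction from \<open>h\<close> to \<open>f\<close>,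
  closeness of \<open>h\<close> to \<open>g(f(\<tau>))\<close> along a vertical segment implies closeness of \<open>f\<close> to \<open>f(\<tau>)\<close>
  by connectedness: \<open>f\<close> is close to \<open>f(\<tau>)\<close> at the top of the segment and cannot cross a small circle
  around \<open>f(\<tau>)\<close> on which \<open>g \<noteq> g(f(\<tau>))\<close>.

  The Poisson estimates come with the existence and uniqueness of the Nevanlinna measure
  (\<open>nevanlinna_measure_poisson\<close>). For the functions \<open>z \<mapsto> f(z + i e)\<close>, which are continuous up to the
  real line, the maximum principle compares \<open>\<pi> Im f(z + i e)\<close> with Poisson integrals of truncated
  boundary values, from below on the half plane and from above on half discs, with an error \<open>B Im z\<close>
  uniform in \<open>e\<close>. Helly's selection theorem then gives a limit measure along a subsequence, and the
  estimates, which pass to the limit, show that it is the weak limit along the full filter.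
\<close>

section \<open>Pick functions and the Schwarz--Pick inequality\<close>

text \<open>A Pick function is a holomorphic map from the open upper half plane to the closed one.\<close>

definition pick :: "(complex \<Rightarrow> complex) \<Rightarrow> bool" where
  "pick f \<longleftrightarrow> f holomorphic_on {z. Im z > 0} \<and> (\<forall>z. Im z > 0 \<longrightarrow> 0 \<le> Im (f z))"

lemma pick_holo: "pick f \<Longrightarrow> f holomorphic_on {z. Im z > 0}"
  and pick_Im_nonneg: "pick f \<Longrightarrow> Im z > 0 \<Longrightarrow> 0 \<le> Im (f z)"
  by (auto simp: pick_def)

lemma open_uhp: "open {z. Im z > 0}"
  and convex_uhp: "convex {z. Im z > 0}"
  and connected_uhp: "connected {z. Im z > 0}"
  by (auto simp: open_halfspace_Im_gt convex_halfspace_Im_gt convex_connected)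

lemma pick_has_derivative:
  assumes "pick f" "Im z > 0"
  shows "(f has_field_derivative deriv f z) (at z)"
  using pick_holo[OF assms(1)] open_uhp assms(2)
  by (intro holomorphic_derivI[where S="{z. Im z > 0}"]) auto

lemma pick_continuous:
  assumes "pick f" shows "continuous_on {z. Im z > 0} f"
  using pick_holo[OF assms] by (rule holomorphic_on_imp_continuous_on)

lemma pick_shift:
  assumes "pick f" "e \<ge> 0"
  shows "pick (\<lambda>z. f (z + \<i> * of_real e))"
proof -
  have "(f \<circ> (\<lambda>z. z + \<i> * of_real e)) holomorphic_on {z. Im z > 0}"
    using assms pick_holo[OF assms(1)]
    by (intro holomorphic_on_compose_gen[where t="{z. Im z > 0}"])
       (auto intro!: holomorphic_intros simp: pick_def)
  then show ?thesis
    using assms by (auto simp: pick_def o_def)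
qed

lemma pick_eq_zero_imp_constant:
  assumes f: "pick f" and z: "Im z > 0" "Im (f z) = 0"
  shows "f constant_on {z. Im z > 0}"
proof (rule ccontr)
  assume "\<not> f constant_on {z. Im z > 0}"
  then have "open (f ` {z. Im z > 0})"
    using open_mapping_thm[OF pick_holo[OF f] open_uhp connected_uhp open_uhp] by blast
  moreover have "f z \<in> f ` {z. Im z > 0}" using z by auto
  ultimately obtain e where e: "e > 0" "ball (f z) e \<subseteq> f ` {z. Im z > 0}"
    by (meson open_contains_ball)
  have "f z - \<i> * of_real (e/2) \<in> ball (f z) e"
    using e(1) by (simp add: dist_norm norm_mult)
  then obtain w where "Im w > 0" "f w = f z - \<i> * of_real (e/2)"
    using e(2) by (metis (no_types, lifting) image_iff mem_Collect_eq subsetD)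
  then show False
    using f z(2) e(1) pick_Im_nonneg[OF f, of w] by simp
qed

text \<open>The Schwarz lemma, transported to the half plane by Cayley transforms at both ends.\<close>

lemma Schwarz_Pick_uhp:
  assumes f: "pick f" and z0: "Im z0 > 0"
  shows "norm (deriv f z0) * Im z0 \<le> Im (f z0)"
proof (cases "f constant_on {z. Im z > 0}")
  case True
  then obtain c where c: "\<And>z. Im z > 0 \<Longrightarrow> f z = c" by (auto simp: constant_on_def)
  have "deriv f z0 = deriv (\<lambda>z. c) z0"
    by (rule deriv_cong_ev)
       (use c z0 open_uhp in \<open>auto simp: eventually_nhds intro!: exI[of _ "{z. Im z > 0}"]\<close>)
  then show ?thesis using pick_Im_nonneg[OF f z0] by simp
next
  case False
  have pos: "Im (f z) > 0" if "Im z > 0" for z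
    using pick_eq_zero_imp_constant[OF f that] False pick_Im_nonneg[OF f that]
    by fastforce
  \<comment> \<open>\<open>m\<close> maps the unit disc to the half plane and 0 to \<open>z0\<close>; \<open>c\<close> maps the half plane to the disc and \<open>w0\<close> to 0\<close>
  define m where "m = (\<lambda>\<zeta>. (z0 - cnj z0 * \<zeta>) / (1 - \<zeta>))"
  define w0 where "w0 = f z0"
  define c where "c = (\<lambda>w. (w - w0) / (w - cnj w0))"
  have w0: "Im w0 > 0" using pos[OF z0] by (simp add: w0_def)
  have m_uhp: "Im (m \<zeta>) > 0" if "norm \<zeta> < 1" for \<zeta>
  proof -
    have ne: "1 - \<zeta> \<noteq> 0" using that by auto
    have "Im (m \<zeta>) = Im ((z0 - cnj z0 * \<zeta>) * cnj (1 - \<zeta>)) / (norm (1 - \<zeta>))\<^sup>2"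
      unfolding m_def by (simp add: complex_div_cnj[of _ "1-\<zeta>"] Im_divide_of_real del: complex_cnj_diff flip: of_real_power)
    also have "Im ((z0 - cnj z0 * \<zeta>) * cnj (1 - \<zeta>)) = Im z0 * (1 - (norm \<zeta>)\<^sup>2)"
      unfolding cmod_power2 by (simp add: algebra_simps power2_eq_square)
    finally show ?thesis
      using z0 that ne by (simp add: abs_square_less_1)
  qed
  have c_disc: "norm (c w) < 1" if "Im w > 0" for w
  proof -
    have "(norm (w - w0))\<^sup>2 < (norm (w - cnj w0))\<^sup>2"
      unfolding cmod_power2 using that w0 mult_pos_pos[OF that w0] by (simp add: power2_eq_square algebra_simps)
    then have "norm (w - w0) < norm (w - cnj w0)"
      by (simp add: power2_less_imp_less)
    moreover from this have "0 < norm (w - cnj w0)"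
      using norm_ge_zero[of "w - w0"] by linarith
    ultimately show ?thesis unfolding c_def norm_divide by simp
  qed
  have dm: "(m has_field_derivative (2 * \<i> * of_real (Im z0))) (at 0)"
    unfolding m_def by (auto intro!: derivative_eq_intros simp: complex_eq_iff)
  have dc: "(c has_field_derivative (1 / (2 * \<i> * of_real (Im w0)))) (at w0)"
  proof -
    have ne: "w0 - cnj w0 \<noteq> 0" using w0 by (auto simp: complex_eq_iff)
    have "(c has_field_derivative (1 / (w0 - cnj w0))) (at w0)"
      unfolding c_def using ne by (auto intro!: derivative_eq_intros simp: divide_simps)
    also have "w0 - cnj w0 = 2 * \<i> * of_real (Im w0)" by (simp add: complex_eq_iff)
    finally show ?thesis .
  qed
  have m0: "m 0 = z0" by (simp add: m_def)
  have holo: "(c \<circ> f \<circ> m) holomorphic_on ball 0 1"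
  proof (intro holomorphic_on_compose_gen[where t="{z. Im z > 0}"])
    show "m holomorphic_on ball 0 1"
      unfolding m_def by (auto intro!: holomorphic_intros)
    show "f holomorphic_on {z. Im z > 0}" by (rule pick_holo[OF f])
    show "c holomorphic_on {z. Im z > 0}"
      unfolding c_def using w0 by (auto intro!: holomorphic_intros simp: complex_eq_iff)
  qed (use m_uhp pos in auto)
  have "(c \<circ> f \<circ> m has_field_derivative
      (1 / (2 * \<i> * of_real (Im w0)) * deriv f z0) * (2 * \<i> * of_real (Im z0))) (at 0)"
    using dm dc pick_has_derivative[OF f z0] m0
    by (intro DERIV_chain) (auto simp: w0_def)
  then have "deriv (c \<circ> f \<circ> m) 0 = (1 / (2 * \<i> * of_real (Im w0)) * deriv f z0) * (2 * \<i> * of_real (Im z0))"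
    by (rule DERIV_imp_deriv)
  moreover have "norm (deriv (c \<circ> f \<circ> m) 0) \<le> 1"
    by (rule Schwarz_Lemma(2)[OF holo, of 0]) (use m0 m_uhp pos c_disc in \<open>auto simp: c_def w0_def\<close>)
  ultimately have "norm (deriv f z0) * Im z0 / Im w0 \<le> 1"
    using w0 z0 by (simp add: norm_mult norm_divide mult_ac)
  then show ?thesis using w0 by (simp add: w0_def field_simps)
qed

lemma has_vector_derivative_vertical:
  assumes "pick f" "s > 0"
  shows "((\<lambda>s. f (Complex x s)) has_vector_derivative (\<i> * deriv f (Complex x s))) (at s)"
proof -
  have "((\<lambda>s. Complex x s) has_vector_derivative \<i>) (at s)"
    unfolding Complex_eq by (auto intro!: derivative_eq_intros)
  from field_vector_diff_chain_at[OF this pick_has_derivative[OF assms(1)]]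
  show ?thesis using assms(2) by (simp add: o_def)
qed

lemma has_derivative_Im_vertical:
  assumes "pick f" "s > 0"
  shows "((\<lambda>s. Im (f (Complex x s))) has_real_derivative Re (deriv f (Complex x s))) (at s)"
  using bounded_linear.has_vector_derivative[OF bounded_linear_Im has_vector_derivative_vertical[OF assms]]
  by (simp add: has_real_derivative_iff_has_vector_derivative)

lemma Schwarz_Pick_Re_bound:
  assumes "pick f" "s > 0"
  shows "\<bar>s * Re (deriv f (Complex x s))\<bar> \<le> Im (f (Complex x s))"
proof -
  have "\<bar>s * Re (deriv f (Complex x s))\<bar> = \<bar>Re (deriv f (Complex x s))\<bar> * s"
    using assms by (simp add: abs_mult)
  also have "\<dots> \<le> norm (deriv f (Complex x s)) * s"
    using assms abs_Re_le_cmod by (intro mult_right_mono) auto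
  also have "\<dots> \<le> Im (f (Complex x s))"
    using Schwarz_Pick_uhp[OF assms(1), of "Complex x s"] assms(2) by simp
  finally show ?thesis .
qed

text \<open>
  The Schwarz--Pick inequality gives \<open>\<bar>\<partial>u/\<partial>y\<bar> \<le> u / y\<close> for \<open>u = Im f\<close>. Hence \<open>y u(x + i y)\<close>
  increases and \<open>u(x + i y) / y\<close> decreases in \<open>y\<close>.
\<close>

lemma pick_mult_height_mono:
  assumes f: "pick f" and "0 < a" "a \<le> b"
  shows "a * Im (f (Complex x a)) \<le> b * Im (f (Complex x b))"
proof (rule DERIV_nonneg_imp_nondecreasing[OF \<open>a \<le> b\<close>])
  fix s assume s: "a \<le> s" "s \<le> b"
  then have s0: "s > 0" using assms by simp
  have "((\<lambda>s. s * Im (f (Complex x s))) has_real_derivative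
      (Im (f (Complex x s)) + s * Re (deriv f (Complex x s)))) (at s)"
    using DERIV_mult[OF DERIV_ident has_derivative_Im_vertical[OF f s0]] by (simp add: mult.commute)
  moreover have "Im (f (Complex x s)) + s * Re (deriv f (Complex x s)) \<ge> 0"
    using Schwarz_Pick_Re_bound[OF f s0, of x] by linarith
  ultimately show "\<exists>y. ((\<lambda>s. s * Im (f (Complex x s))) has_real_derivative y) (at s) \<and> y \<ge> 0"
    by blast
qed

lemma pick_divide_height_antimono:
  assumes f: "pick f" and "0 < a" "a \<le> b"
  shows "Im (f (Complex x b)) / b \<le> Im (f (Complex x a)) / a"
proof (rule DERIV_nonpos_imp_nonincreasing[OF \<open>a \<le> b\<close>])
  fix s assume s: "a \<le> s" "s \<le> b"
  then have s0: "s > 0" using assms by simp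
  have "((\<lambda>s. Im (f (Complex x s)) / s) has_real_derivative
      ((Re (deriv f (Complex x s)) * s - Im (f (Complex x s)) * 1) / (s * s))) (at s)"
    using DERIV_divide[OF has_derivative_Im_vertical[OF f s0] DERIV_ident] s0 by simp
  moreover have "(Re (deriv f (Complex x s)) * s - Im (f (Complex x s)) * 1) / (s * s) \<le> 0"
    using Schwarz_Pick_Re_bound[OF f s0, of x] by (intro divide_nonpos_nonneg) (auto simp: mult.commute)
  ultimately show "\<exists>y. ((\<lambda>s. Im (f (Complex x s)) / s) has_real_derivative y) (at s) \<and> y \<le> 0"
    by blast
qed

section \<open>A maximum principle with boundary limits\<close>

text \<open>
  The boundary behaviour is only assumed for upper limits of \<open>Im F\<close>. The principle therefore applies
  to Cauchy integrals whose imaginary parts are Poisson integrals, without any knowledge of the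
  boundary values of their real parts.
\<close>

lemma Im_max_principle:
  assumes F: "F holomorphic_on S" and S: "open S" "connected S"
    and bdd: "\<And>d. d > 0 \<Longrightarrow> bounded {z \<in> S. Im (F z) \<ge> d}"
    and fr: "\<And>p d. p \<in> frontier S \<Longrightarrow> d > 0 \<Longrightarrow> eventually (\<lambda>z. Im (F z) < d) (at p within S)"
    and nb: "S \<noteq> UNIV"
    and z: "z \<in> S"
  shows "Im (F z) \<le> 0"
proof (rule ccontr)
  assume "\<not> Im (F z) \<le> 0"
  define d where "d = Im (F z)"
  have d: "d > 0" using \<open>\<not> Im (F z) \<le> 0\<close> by (simp add: d_def)
  define K where "K = {z \<in> S. Im (F z) \<ge> d}"
  have contF: "continuous_on S F" by (rule holomorphic_on_imp_continuous_on[OF F])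
  have "closed K"
    unfolding closed_limpt
  proof (intro allI impI)
    fix p assume p: "p islimpt K"
    have "p \<in> closure S" using p unfolding K_def
      by (metis (no_types, lifting) closure_def UnI2 islimpt_subset mem_Collect_eq subsetI)
    moreover have "p \<notin> frontier S"
    proof
      assume "p \<in> frontier S"
      from fr[OF this d] have "eventually (\<lambda>z. z \<notin> K) (at p)"
        unfolding eventually_at_filter K_def by eventually_elim auto
      then show False using p islimpt_iff_eventually by blast
    qed
    ultimately have pS: "p \<in> S" using S(1) by (simp add: frontier_def interior_open)
    have "isCont (\<lambda>z. Im (F z)) p"
      using contF S(1) pS by (auto intro!: continuous_intros simp: continuous_on_eq_continuous_at)
    then have lim: "((\<lambda>z. Im (F z)) \<longlongrightarrow> Im (F p)) (at p)" by (simp add: isCont_def)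
    have "d \<le> Im (F p)"
    proof (rule ccontr)
      assume "\<not> d \<le> Im (F p)"
      then have "eventually (\<lambda>z. Im (F z) < d) (at p)"
        using order_tendstoD(2)[OF lim, of d] by simp
      then have "eventually (\<lambda>z. z \<notin> K) (at p)"
        by eventually_elim (auto simp: K_def)
      then show False using p islimpt_iff_eventually by blast
    qed
    then show "p \<in> K" using pS by (simp add: K_def)
  qed
  moreover have "bounded K" unfolding K_def by (rule bdd[OF d])
  ultimately have "compact K" by (simp add: compact_eq_bounded_closed)
  moreover have "z \<in> K" using z by (simp add: K_def d_def)
  moreover have "continuous_on K (\<lambda>z. Im (F z))"
    using continuous_on_subset[OF contF, of K] by (auto intro!: continuous_intros simp: K_def)
  ultimately obtain m where m: "m \<in> K" "\<And>w. w \<in> K \<Longrightarrow> Im (F w) \<le> Im (F m)"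
    using continuous_attains_sup[of K "\<lambda>z. Im (F z)"] by blast
  have max: "Im (F w) \<le> Im (F m)" if "w \<in> S" for w
    using m that by (cases "w \<in> K") (auto simp: K_def)
  \<comment> \<open>the modulus of this function is \<open>exp (Im F)\<close>\<close>
  have "(\<lambda>z. exp (- \<i> * F z)) constant_on S"
    by (rule maximum_modulus_principle[OF _ S(1,2) S(1) order_refl, of _ m])
       (use F m max in \<open>auto intro!: holomorphic_intros simp: K_def\<close>)
  then obtain c where c: "\<And>w. w \<in> S \<Longrightarrow> exp (- \<i> * F w) = c" by (auto simp: constant_on_def)
  have eq: "Im (F w) = Im (F m)" if "w \<in> S" for w
  proof -
    have "norm (exp (- \<i> * F w)) = norm (exp (- \<i> * F m))"
      using c[OF that] c[of m] m(1) by (auto simp: K_def)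
    then show ?thesis by simp
  qed
  have "d \<le> Im (F m)" using m(1) by (simp add: K_def)
  then have "w \<in> K" if "w \<in> S" for w using eq[OF that] that by (simp add: K_def)
  then have "K = S" by (auto simp: K_def)
  then have "closed S" using \<open>closed K\<close> by simp
  then have "S = {} \<or> S = UNIV" using S(1) clopen by blast
  then show False using nb z by auto
qed

section \<open>Poisson integrals of compactly supported functions\<close>

text \<open>The Poisson kernel of the upper half plane, without the factor \<open>1/\<pi>\<close>.\<close>

definition poisson :: "complex \<Rightarrow> real \<Rightarrow> real" where
  "poisson z t = Im z / ((Re z - t)\<^sup>2 + (Im z)\<^sup>2)"

text \<open>Continuous functions on the line supported in \<open>[-S, S]\<close>.\<close>

definition supported :: "real \<Rightarrow> (real \<Rightarrow> real) \<Rightarrow> bool" where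
  "supported S \<psi> \<longleftrightarrow> continuous_on UNIV \<psi> \<and> (\<forall>t. S < \<bar>t\<bar> \<longrightarrow> \<psi> t = 0)"

lemma poisson_nonneg: "Im z > 0 \<Longrightarrow> 0 \<le> poisson z t"
  by (simp add: poisson_def)

lemma poisson_denom_pos: "Im z \<noteq> 0 \<Longrightarrow> 0 < (Re z - t)\<^sup>2 + (Im z)\<^sup>2"
  by (simp add: sum_power2_gt_zero_iff)

lemma continuous_on_poisson:
  "Im z \<noteq> 0 \<Longrightarrow> continuous_on A (poisson z)"
  unfolding poisson_def
  using poisson_denom_pos[of z]
  by (intro continuous_intros) (auto simp: less_imp_neq[symmetric])

lemma measurable_poisson [measurable]: "poisson z \<in> borel_measurable borel"
  unfolding poisson_def by measurable

lemma poisson_le: "Im z > 0 \<Longrightarrow> poisson z t \<le> 1 / Im z"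
proof -
  assume z: "Im z > 0"
  have "poisson z t \<le> Im z / (Im z)\<^sup>2"
    unfolding poisson_def using z by (intro divide_left_mono) (auto simp: add_nonneg_pos)
  then show ?thesis using z by (simp add: power2_eq_square)
qed

lemma poisson_eq_Im:
  "poisson z t = Im (1 / (of_real t - z))"
  by (simp add: poisson_def Im_divide power2_commute)

lemma supportedD:
  assumes "supported S \<psi>"
  shows "continuous_on A \<psi>" "S < \<bar>t\<bar> \<Longrightarrow> \<psi> t = 0"
  using assms by (auto simp: supported_def intro: continuous_on_subset)

lemma supported_measurable:
  "supported S \<psi> \<Longrightarrow> \<psi> \<in> borel_measurable borel"
  unfolding supported_def using borel_measurable_continuous_onI by blast

lemma supported_bounded:
  assumes "supported S \<psi>"
  shows "\<exists>M>0. \<forall>t. \<bar>\<psi> t\<bar> \<le> M"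
proof -
  have "compact (\<psi> ` {-S..S})"
    using assms by (intro compact_continuous_image) (auto simp: supportedD)
  then obtain M where M: "M > 0" "\<And>y. y \<in> \<psi> ` {-S..S} \<Longrightarrow> norm y \<le> M"
    using compact_imp_bounded bounded_pos by metis
  have "\<bar>\<psi> t\<bar> \<le> M" for t
    using M supportedD(2)[OF assms, of t] by (cases "\<bar>t\<bar> \<le> S") (auto simp: abs_le_iff)
  with M(1) show ?thesis by blast
qed

lemma supported_mult:
  assumes "supported S \<psi>" "continuous_on UNIV h"
  shows "supported S (\<lambda>t. h t * \<psi> t)"
  using assms by (auto simp: supported_def intro!: continuous_intros)

lemma supported_integral:
  assumes "supported S \<psi>"
  shows "integrable lborel \<psi>" "(\<integral>t. \<psi> t \<partial>lborel) = integral {-S..S} \<psi>"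
proof -
  have *: "set_integrable lborel {-S..S} \<psi>"
    by (rule borel_integrable_atLeastAtMost') (rule supportedD(1)[OF assms])
  have eq: "(\<lambda>t. indicator {-S..S} t *\<^sub>R \<psi> t) = \<psi>"
  proof
    fix t show "indicator {-S..S} t *\<^sub>R \<psi> t = \<psi> t"
      using supportedD(2)[OF assms, of t] by (cases "\<bar>t\<bar> \<le> S") (auto simp: abs_le_iff)
  qed
  show "integrable lborel \<psi>" using * unfolding set_integrable_def eq .
  show "(\<integral>t. \<psi> t \<partial>lborel) = integral {-S..S} \<psi>"
    using set_borel_integral_eq_integral(2)[OF *] unfolding set_lebesgue_integral_def eq .
qed

text \<open>
  The Poisson integral is the imaginary part of a Cauchy integral, which is holomorphic in the upper
  half plane and decays at infinity.
\<close>

lemma poisson_integral_holomorphic: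
  assumes \<psi>: "supported S \<psi>" and S: "S \<ge> 0"
  obtains Q where "Q holomorphic_on {z. Im z > 0}"
    "\<And>z. Im z > 0 \<Longrightarrow> Im (Q z) = (\<integral>t. poisson z t * \<psi> t \<partial>lborel)"
    "\<And>d. d > 0 \<Longrightarrow> bounded {z. Im z > 0 \<and> d \<le> Im (Q z)}"
proof -
  define k where "k = (\<lambda>z t. complex_of_real (\<psi> t) / (of_real t - z))"
  define Q where "Q = (\<lambda>z. integral (cbox (-S) S) (k z))"
  have ne: "of_real t - z \<noteq> 0" if "Im z > 0" for z and t :: real
    using that by (auto simp: complex_eq_iff)
  have cont_k: "continuous_on A (k z)" if "Im z > 0" for z A
    unfolding k_def using ne[OF that] supportedD(1)[OF \<psi>]
    by (intro continuous_intros) auto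
  have int_k: "k z integrable_on cbox (-S) S" if "Im z > 0" for z
    using cont_k[OF that] by (rule integrable_continuous)
  have "Q holomorphic_on {z. Im z > 0}"
    unfolding Q_def
  proof (rule leibniz_rule_holomorphic[where fx="\<lambda>z t. of_real (\<psi> t) / (of_real t - z)\<^sup>2"])
    fix z and t :: real assume z: "z \<in> {z. Im z > 0}"
    show "((\<lambda>z. k z t) has_field_derivative of_real (\<psi> t) / (of_real t - z)\<^sup>2) (at z within {z. Im z > 0})"
      unfolding k_def using ne[of z t] z
      by (auto intro!: derivative_eq_intros simp: power2_eq_square)
  next
    have "continuous_on UNIV \<psi>" using \<psi> by (simp add: supported_def)
    then have "continuous_on UNIV (\<lambda>p::complex \<times> real. \<psi> (snd p))"
      by (rule continuous_on_compose2[OF _ continuous_on_snd[OF continuous_on_id]]) simp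
    then have "continuous_on ({z. Im z > 0} \<times> cbox (-S) S) (\<lambda>p. \<psi> (snd p))"
      using continuous_on_subset by blast
    then show "continuous_on ({z. Im z > 0} \<times> cbox (-S) S)
        (\<lambda>(z, t). of_real (\<psi> t) / (of_real t - z)\<^sup>2)"
      unfolding case_prod_beta using ne by (intro continuous_intros) auto
  qed (use int_k convex_uhp in auto)
  moreover have "Im (Q z) = (\<integral>t. poisson z t * \<psi> t \<partial>lborel)" if z: "Im z > 0" for z
  proof -
    have "Im (Q z) = integral {-S..S} (\<lambda>t. Im (k z t))"
      using integral_linear[OF int_k[OF z] bounded_linear_Im] unfolding Q_def by (simp add: o_def)
    also have "(\<lambda>t. Im (k z t)) = (\<lambda>t. poisson z t * \<psi> t)"
      by (rule ext) (simp add: k_def poisson_eq_Im Im_divide)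
    also have "integral {-S..S} \<dots> = (\<integral>t. poisson z t * \<psi> t \<partial>lborel)"
      using z by (intro supported_integral(2)[symmetric] supported_mult \<psi>
        continuous_on_poisson) auto
    finally show ?thesis .
  qed
  moreover have "bounded {z. Im z > 0 \<and> d \<le> Im (Q z)}" if d: "d > 0" for d
  proof -
    obtain M where M: "M > 0" "\<And>t. \<bar>\<psi> t\<bar> \<le> M"
      using supported_bounded[OF \<psi>] by blast
    define R where "R = S + 1 + M * (2 * S) / d"
    have "norm z \<le> R" if z: "Im z > 0" "d \<le> Im (Q z)" for z
    proof (rule ccontr)
      assume "\<not> norm z \<le> R"
      moreover have "M * (2 * S) / d \<ge> 0" using M d S by simp
      ultimately have big: "norm z > S + 1 + M * (2 * S) / d" "norm z - S > 0"
        by (auto simp: R_def)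
      have "norm (Q z) \<le> M / (norm z - S) * (S - (-S))"
        unfolding Q_def cbox_interval
      proof (rule integral_bound)
        fix t assume t: "t \<in> {-S..S}"
        have "norm z - S \<le> norm (of_real t - z)"
          using norm_triangle_ineq2[of z "of_real t"] t unfolding norm_minus_commute[of _ z]
          by (simp add: abs_le_iff) linarith
        then show "norm (k z t) \<le> M / (norm z - S)"
          unfolding k_def norm_divide using M(2)[of t] M(1) big by (intro frac_le) auto
      qed (use S cont_k[OF z(1)] in auto)
      also have "\<dots> < d"
      proof -
        have "M * (2 * S) < d * (norm z - S)"
          using big(1) d by (simp add: field_simps)
        then show ?thesis using big(2) by (simp add: field_simps)
      qed
      finally show False using abs_Im_le_cmod[of "Q z"] z(2) by linarith
    qed
    then show ?thesis by (auto simp: bounded_iff intro!: exI[of _ R])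
  qed
  ultimately show thesis using that by blast
qed

lemma integrable_inverse_1_plus_square_UNIV:
  "integrable lborel (\<lambda>x::real. 1 / (1 + x\<^sup>2))"
  "(\<integral>x. 1 / (1 + x\<^sup>2) \<partial>lborel) = pi"
proof -
  have eq: "einterval (-\<infinity>) \<infinity> = (UNIV :: real set)" by (auto simp: einterval_def)
  show "integrable lborel (\<lambda>x::real. 1 / (1 + x\<^sup>2))"
    using integrable_inverse_1_plus_square unfolding set_integrable_def eq by (simp add: inverse_eq_divide)
  show "(\<integral>x. 1 / (1 + x\<^sup>2) \<partial>lborel) = pi"
    using LBINT_inverse_1_plus_square
    unfolding interval_lebesgue_integral_def set_lebesgue_integral_def eq by (simp add: inverse_eq_divide)
qed

lemma poisson_integral_substitute:
  assumes z: "Im z > 0"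
  shows "(\<integral>t. poisson z t * \<psi> t \<partial>lborel) = (\<integral>s. \<psi> (Re z + Im z * s) * (1 / (1 + s\<^sup>2)) \<partial>lborel)"
proof -
  have "(\<integral>t. poisson z t * \<psi> t \<partial>lborel) =
      \<bar>Im z\<bar> * (\<integral>s. poisson z (Re z + Im z * s) * \<psi> (Re z + Im z * s) \<partial>lborel)"
    using lborel_integral_real_affine[of "Im z" "\<lambda>t. poisson z t * \<psi> t" "Re z"] z by simp
  also have "\<dots> = (\<integral>s. Im z * (poisson z (Re z + Im z * s) * \<psi> (Re z + Im z * s)) \<partial>lborel)"
    using z by simp
  also have "\<dots> = (\<integral>s. \<psi> (Re z + Im z * s) * (1 / (1 + s\<^sup>2)) \<partial>lborel)"
  proof (rule Bochner_Integration.integral_cong[OF refl])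
    fix s
    have "(Im z * s)\<^sup>2 + (Im z)\<^sup>2 = (Im z)\<^sup>2 * (1 + s\<^sup>2)" by (simp add: algebra_simps power2_eq_square)
    then show "Im z * (poisson z (Re z + Im z * s) * \<psi> (Re z + Im z * s)) =
        \<psi> (Re z + Im z * s) * (1 / (1 + s\<^sup>2))"
      using z by (simp add: poisson_def power2_eq_square)
  qed
  finally show ?thesis .
qed

text \<open>
  The substitution turns the Poisson integral into an integral over a fixed probability density
  (up to \<open>\<pi>\<close>), to which dominated convergence applies even as \<open>Im z\<close> tends to 0.
\<close>

lemma poisson_integral_boundary:
  assumes \<psi>: "supported S \<psi>"
  shows "((\<lambda>z. \<integral>t. poisson z t * \<psi> t \<partial>lborel) \<longlongrightarrow> pi * \<psi> x) (at (of_real x) within {z. Im z > 0})"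
proof -
  define G where "G = (\<lambda>z. \<integral>s. \<psi> (Re z + Im z * s) * (1 / (1 + s\<^sup>2)) \<partial>lborel)"
  have [measurable]: "\<psi> \<in> borel_measurable borel" using supported_measurable[OF \<psi>] .
  obtain M where M: "M > 0" "\<And>t. \<bar>\<psi> t\<bar> \<le> M"
    using supported_bounded[OF \<psi>] by blast
  have "isCont G (of_real x)"
    unfolding G_def
  proof (rule continuous_at_sequentiallyI)
    fix u :: "nat \<Rightarrow> complex" assume u: "u \<longlonglongrightarrow> of_real x"
    show "(\<lambda>n. \<integral>s. \<psi> (Re (u n) + Im (u n) * s) * (1 / (1 + s\<^sup>2)) \<partial>lborel) \<longlonglongrightarrow>
        (\<integral>s. \<psi> (Re (of_real x) + Im (of_real x) * s) * (1 / (1 + s\<^sup>2)) \<partial>lborel)"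
    proof (rule integral_dominated_convergence)
      show "integrable lborel (\<lambda>s::real. M * (1 / (1 + s\<^sup>2)))"
        by (intro integrable_mult_right integrable_inverse_1_plus_square_UNIV(1))
      show "AE s in lborel. (\<lambda>n. \<psi> (Re (u n) + Im (u n) * s) * (1 / (1 + s\<^sup>2))) \<longlonglongrightarrow>
          \<psi> (Re (of_real x) + Im (of_real x) * s) * (1 / (1 + s\<^sup>2))"
      proof (rule AE_I2)
        fix s :: real
        have "(\<lambda>n. Re (u n) + Im (u n) * s) \<longlonglongrightarrow> Re (of_real x) + Im (of_real x) * s"
          using u by (intro tendsto_intros)
        moreover have "isCont \<psi> y" for y
          using \<psi> by (simp add: supported_def continuous_on_eq_continuous_at)
        ultimately have "(\<lambda>n. \<psi> (Re (u n) + Im (u n) * s)) \<longlonglongrightarrow> \<psi> (Re (of_real x) + Im (of_real x) * s)"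
          by (rule isCont_tendsto_compose[rotated])
        then show "(\<lambda>n. \<psi> (Re (u n) + Im (u n) * s) * (1 / (1 + s\<^sup>2))) \<longlonglongrightarrow>
          \<psi> (Re (of_real x) + Im (of_real x) * s) * (1 / (1 + s\<^sup>2))"
          by (rule tendsto_mult) (rule tendsto_const)
      qed
      show "AE s in lborel. norm (\<psi> (Re (u n) + Im (u n) * s) * (1 / (1 + s\<^sup>2))) \<le> M * (1 / (1 + s\<^sup>2))" for n
        unfolding norm_mult by (intro AE_I2 mult_mono) (use M in \<open>auto intro: less_imp_le\<close>)
    qed measurable
  qed
  then have "(G \<longlongrightarrow> G (of_real x)) (at (of_real x) within {z. Im z > 0})"
    unfolding isCont_def by (rule tendsto_within_subset) simp
  moreover have "G (of_real x) = pi * \<psi> x"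
    unfolding G_def Re_complex_of_real Im_complex_of_real mult_zero_left add_0_right
      integral_mult_right_zero integrable_inverse_1_plus_square_UNIV(2) by simp
  ultimately have "(G \<longlongrightarrow> pi * \<psi> x) (at (of_real x) within {z. Im z > 0})" by simp
  moreover have "eventually (\<lambda>z. G z = (\<integral>t. poisson z t * \<psi> t \<partial>lborel)) (at (of_real x) within {z. Im z > 0})"
    unfolding eventually_at_filter
    by (intro always_eventually) (simp add: G_def poisson_integral_substitute)
  ultimately show ?thesis by (rule Lim_transform_eventually)
qed

lemma poisson_integral_abs_le:
  assumes \<psi>: "supported S \<psi>" and M: "\<And>t. \<bar>\<psi> t\<bar> \<le> M" and z: "Im z > 0"
  shows "\<bar>\<integral>t. poisson z t * \<psi> t \<partial>lborel\<bar> \<le> pi * M"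
proof -
  have [measurable]: "\<psi> \<in> borel_measurable borel" using supported_measurable[OF \<psi>] .
  have M0: "M \<ge> 0" using M[of 0] by simp
  have bd: "norm (\<psi> (Re z + Im z * s) * (1 / (1 + s\<^sup>2))) \<le> M * (1 / (1 + s\<^sup>2))" for s
    unfolding norm_mult by (intro mult_mono) (use M M0 in auto)
  have "\<bar>\<integral>s. \<psi> (Re z + Im z * s) * (1 / (1 + s\<^sup>2)) \<partial>lborel\<bar> \<le> (\<integral>s. M * (1 / (1 + s\<^sup>2)) \<partial>lborel)"
  proof -
    have "norm (\<integral>s. \<psi> (Re z + Im z * s) * (1 / (1 + s\<^sup>2)) \<partial>lborel) \<le>
        (\<integral>s. M * (1 / (1 + s\<^sup>2)) \<partial>lborel)"
    proof (rule Bochner_Integration.integral_norm_bound_integral)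
      show int: "integrable lborel (\<lambda>s::real. M * (1 / (1 + s\<^sup>2)))"
        by (intro integrable_mult_right integrable_inverse_1_plus_square_UNIV(1))
      show "integrable lborel (\<lambda>s. \<psi> (Re z + Im z * s) * (1 / (1 + s\<^sup>2)))"
        by (rule Bochner_Integration.integrable_bound[OF int])
           (use bd M0 in \<open>auto intro!: AE_I2 simp: abs_mult\<close>)
    qed (use bd in auto)
    then show ?thesis by simp
  qed
  also have "\<dots> = pi * M"
    unfolding integral_mult_right_zero integrable_inverse_1_plus_square_UNIV(2) by simp
  finally show ?thesis by (simp only: poisson_integral_substitute[OF z])
qed

section \<open>Two-sided Poisson estimates\<close>

text \<open>A continuous cutoff function: 1 on \<open>[-R, R]\<close>, 0 outside \<open>[-R - 1, R + 1]\<close>, linear in between.\<close>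

definition cutoff :: "real \<Rightarrow> real \<Rightarrow> real" where
  "cutoff R t = max 0 (min 1 (R + 1 - \<bar>t\<bar>))"

lemma cutoff_nonneg: "0 \<le> cutoff R t"
  and cutoff_le_1: "cutoff R t \<le> 1"
  and cutoff_eq_1: "\<bar>t\<bar> \<le> R \<Longrightarrow> cutoff R t = 1"
  and cutoff_eq_0: "R + 1 < \<bar>t\<bar> \<Longrightarrow> cutoff R t = 0"
  by (auto simp: cutoff_def)

lemma continuous_on_cutoff: "continuous_on A (cutoff R)"
  unfolding cutoff_def by (intro continuous_intros)

lemma supported_cutoff: "supported (R + 1) (cutoff R)"
  by (simp add: supported_def continuous_on_cutoff cutoff_eq_0)

lemma supported_cutoff_mult:
  "continuous_on UNIV h \<Longrightarrow> supported (R + 1) (\<lambda>t. cutoff R t * h t)"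
  using supported_mult[OF supported_cutoff, of h] by (simp add: mult.commute)

lemma Im_zero_of_frontier_uhp:
  assumes "p \<in> frontier {z. Im z > 0}" shows "Im p = 0"
proof -
  have "closure {z. Im z > 0} \<subseteq> {z. Im z \<ge> 0}"
    by (intro closure_minimal closed_halfspace_Im_ge) auto
  then show ?thesis using assms open_uhp by (auto simp: frontier_def interior_open)
qed

lemma continuous_on_Im_horizontal:
  assumes "pick f" "e > 0"
  shows "continuous_on UNIV (\<lambda>t. Im (f (Complex t e)))"
proof -
  have "continuous_on UNIV (\<lambda>t. Complex t e)"
    unfolding Complex_eq by (intro continuous_intros)
  from continuous_on_compose2[OF pick_continuous[OF assms(1)] this]
  have "continuous_on UNIV (\<lambda>t. f (Complex t e))" using assms(2) by (simp add: image_subset_iff)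
  then show ?thesis by (intro continuous_intros)
qed

lemma tendsto_Im_shift:
  assumes "pick f" "e > 0" "Im p \<ge> 0"
  shows "((\<lambda>z. Im (f (z + \<i> * of_real e))) \<longlongrightarrow> Im (f (p + \<i> * of_real e))) (at p within A)"
proof -
  have "isCont f (p + \<i> * of_real e)"
    using pick_has_derivative[OF assms(1), of "p + \<i> * of_real e"] assms DERIV_isCont by auto
  then have "((\<lambda>z. f (z + \<i> * of_real e)) \<longlongrightarrow> f (p + \<i> * of_real e)) (at p within A)"
    by (rule isCont_tendsto_compose) (intro tendsto_intros)
  then show ?thesis by (rule tendsto_Im)
qed

text \<open>
  Boundary values are only available for \<open>z \<mapsto> f(z + i e)\<close> with \<open>e > 0\<close>. A compactly supported \<open>\<psi>\<close>
  below them has its Poisson integral below \<open>\<pi> Im f(z + i e)\<close>, by the maximum principle on the half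
  plane.
\<close>

lemma poisson_minorant_shift:
  assumes f: "pick f" and e: "e > 0" and \<psi>: "supported S \<psi>" "S \<ge> 0"
    and le: "\<And>t. \<psi> t \<le> Im (f (Complex t e))" and z: "Im z > 0"
  shows "(\<integral>t. poisson z t * \<psi> t \<partial>lborel) \<le> pi * Im (f (z + \<i> * of_real e))"
proof -
  obtain Q where Q: "Q holomorphic_on {z. Im z > 0}"
    "\<And>z. Im z > 0 \<Longrightarrow> Im (Q z) = (\<integral>t. poisson z t * \<psi> t \<partial>lborel)"
    "\<And>d. d > 0 \<Longrightarrow> bounded {z. Im z > 0 \<and> d \<le> Im (Q z)}"
    by (rule poisson_integral_holomorphic[OF \<psi>]) blast
  define fe where "fe = (\<lambda>z. f (z + \<i> * of_real e))"
  have fe: "pick fe" unfolding fe_def by (rule pick_shift[OF f]) (use e in simp)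
  define F where "F = (\<lambda>z. Q z - of_real pi * fe z)"
  have "Im (F z) \<le> 0"
  proof (rule Im_max_principle[of F "{z. Im z > 0}"])
    show "F holomorphic_on {z. Im z > 0}"
      unfolding F_def using Q(1) pick_holo[OF fe] by (intro holomorphic_intros)
    show "bounded {z \<in> {z. Im z > 0}. d \<le> Im (F z)}" if "d > 0" for d
    proof (rule bounded_subset[OF Q(3)[OF that]], rule subsetI)
      fix w assume w: "w \<in> {z \<in> {z. Im z > 0}. d \<le> Im (F z)}"
      then have "0 \<le> pi * Im (fe w)" using pick_Im_nonneg[OF fe, of w] by simp
      then show "w \<in> {z. Im z > 0 \<and> d \<le> Im (Q z)}" using w by (simp add: F_def)
    qed
    show "eventually (\<lambda>z. Im (F z) < d) (at p within {z. Im z > 0})"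
      if p: "p \<in> frontier {z. Im z > 0}" and d: "d > 0" for p d
    proof -
      obtain x where x: "p = of_real x"
        using Im_zero_of_frontier_uhp[OF p] complex_is_Real_iff by (metis Reals_cases)
      have "((\<lambda>z. (\<integral>t. poisson z t * \<psi> t \<partial>lborel) - pi * Im (fe z))
          \<longlongrightarrow> pi * \<psi> x - pi * Im (fe p)) (at p within {z. Im z > 0})"
        unfolding x fe_def
        by (intro tendsto_intros poisson_integral_boundary[OF \<psi>(1)] tendsto_Im_shift f e) simp
      moreover have "pi * \<psi> x - pi * Im (fe p) < d"
      proof -
        have "\<psi> x \<le> Im (fe p)" using le[of x] by (simp add: fe_def x Complex_eq)
        then have "pi * \<psi> x \<le> pi * Im (fe p)" by (intro mult_left_mono) auto
        then show ?thesis using d by linarith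
      qed
      ultimately have "eventually (\<lambda>z. (\<integral>t. poisson z t * \<psi> t \<partial>lborel) - pi * Im (fe z) < d)
          (at p within {z. Im z > 0})"
        by (rule order_tendstoD(2))
      then show ?thesis
        unfolding eventually_at_filter by eventually_elim (simp add: F_def Q(2))
    qed
    have "- \<i> \<notin> {z. Im z > 0}" by simp
    then show "{z. Im z > 0} \<noteq> UNIV" by blast
  qed (use open_uhp connected_uhp z in auto)
  then show ?thesis using Q(2)[OF z] by (simp add: F_def fe_def)
qed

text \<open>
  The majorant uses the explicit positive harmonic function
  \<open>y / \<bar>z - R\<bar>\<^sup>2 + y / \<bar>z + R\<bar>\<^sup>2\<close>, whose value on the circle \<open>\<bar>z\<bar> = R\<close> is exactly \<open>1 / y\<close>.
\<close>

lemma circle_comparison: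
  assumes z: "norm z = R" "Im z > 0"
  shows "Im (- (1 / (z - of_real R)) - 1 / (z + of_real R)) = 1 / Im z"
proof -
  have R: "R\<^sup>2 = (Re z)\<^sup>2 + (Im z)\<^sup>2" using z(1) cmod_power2[of z] by simp
  have ne: "z - of_real R \<noteq> 0" "z + of_real R \<noteq> 0" "z\<^sup>2 - (of_real R)\<^sup>2 \<noteq> 0"
  proof -
    show 1: "z - of_real R \<noteq> 0" "z + of_real R \<noteq> 0" using z(2) by (auto simp: complex_eq_iff)
    have "z\<^sup>2 - (of_real R)\<^sup>2 = (z - of_real R) * (z + of_real R)" by (simp add: power2_eq_square algebra_simps)
    then show "z\<^sup>2 - (of_real R)\<^sup>2 \<noteq> 0" using 1 by simp
  qed
  have "- (1 / (z - of_real R)) - 1 / (z + of_real R) = - (2 * z) / (z\<^sup>2 - (of_real R)\<^sup>2)"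
    using ne by (simp add: divide_simps) (simp add: power2_eq_square algebra_simps)
  also have "z\<^sup>2 - (of_real R)\<^sup>2 = 2 * \<i> * of_real (Im z) * z"
  proof -
    have "(of_real R)\<^sup>2 = complex_of_real ((Re z)\<^sup>2 + (Im z)\<^sup>2)" by (simp flip: R)
    then show ?thesis by (simp add: complex_eq_iff power2_eq_square)
  qed
  also have "- (2 * z) / (2 * \<i> * of_real (Im z) * z) = \<i> / of_real (Im z)"
    using z by (auto simp: field_simps)
  finally show ?thesis by (simp add: Im_divide_of_real)
qed

lemma Im_comparison_nonneg:
  "Im z > 0 \<Longrightarrow> 0 \<le> Im (- (1 / (z - of_real R)) - 1 / (z + of_real R))"
  by (simp add: Im_divide add_nonneg_nonneg)

lemma Im_comparison_le:
  assumes z: "Im z > 0" "norm z \<le> R / 2" and R: "R > 0"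
  shows "Im (- (1 / (z - of_real R)) - 1 / (z + of_real R)) \<le> 8 / R\<^sup>2 * Im z"
proof -
  have *: "Im (- (1 / w)) \<le> 4 / R\<^sup>2 * Im z" if w: "norm w \<ge> R / 2" "Im w = Im z" for w
  proof -
    have "Im (- (1 / w)) = Im z / (norm w)\<^sup>2"
      using w(2) by (simp add: Im_divide cmod_power2)
    also have "\<dots> \<le> Im z / (R / 2)\<^sup>2"
      using z R w by (intro divide_left_mono power_mono mult_pos_pos zero_less_power) auto
    finally show ?thesis by (simp add: power_divide mult.commute)
  qed
  have "R / 2 \<le> norm (z - of_real R)"
    using norm_triangle_ineq2[of "of_real R" z] z R by (simp add: norm_minus_commute)
  moreover have "R / 2 \<le> norm (z + of_real R)"
    using norm_triangle_ineq2[of "of_real R" "- z"] z R by (simp add: add.commute)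
  ultimately have "Im (- (1 / (z - of_real R))) + Im (- (1 / (z + of_real R)))
      \<le> 4 / R\<^sup>2 * Im z + 4 / R\<^sup>2 * Im z"
    by (intro add_mono *) auto
  then show ?thesis by simp
qed

lemma poisson_majorant_shift:
  assumes f: "pick f" and e: "e > 0" and \<psi>: "supported S \<psi>" "S \<ge> 0"
    and nonneg: "\<And>t. 0 \<le> \<psi> t"
    and eq: "\<And>t. \<bar>t\<bar> \<le> R \<Longrightarrow> \<psi> t = Im (f (Complex t e))" and R: "R > 0"
    and B: "B \<ge> 0" "\<And>\<zeta>. norm \<zeta> = R \<Longrightarrow> Im \<zeta> > 0 \<Longrightarrow> Im \<zeta> * Im (f (\<zeta> + \<i> * of_real e)) \<le> B"
    and z: "Im z > 0" "norm z < R"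
  shows "pi * Im (f (z + \<i> * of_real e)) \<le> (\<integral>t. poisson z t * \<psi> t \<partial>lborel)
      + pi * B * Im (- (1 / (z - of_real R)) - 1 / (z + of_real R))"
proof -
  obtain Q where Q: "Q holomorphic_on {z. Im z > 0}"
    "\<And>z. Im z > 0 \<Longrightarrow> Im (Q z) = (\<integral>t. poisson z t * \<psi> t \<partial>lborel)"
    by (rule poisson_integral_holomorphic[OF \<psi>]) blast
  define fe where "fe = (\<lambda>z. f (z + \<i> * of_real e))"
  have fe: "pick fe" unfolding fe_def by (rule pick_shift[OF f]) (use e in simp)
  define q where "q = (\<lambda>z. - (1 / (z - of_real R)) - 1 / (z + complex_of_real R))"
  define F where "F = (\<lambda>z. of_real pi * fe z - Q z - of_real (pi * B) * q z)"
  define D where "D = {z. Im z > 0} \<inter> ball 0 R"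
  have q_holo: "q holomorphic_on {z. Im z > 0}"
    unfolding q_def by (auto intro!: holomorphic_intros simp: complex_eq_iff)
  have F_holo: "F holomorphic_on {z. Im z > 0}"
    unfolding F_def using Q(1) pick_holo[OF fe] q_holo by (intro holomorphic_intros)
  have q_nonneg: "0 \<le> Im (q w)" if "Im w > 0" for w
    unfolding q_def by (rule Im_comparison_nonneg[OF that])
  have Im_F: "Im (F w) = pi * Im (fe w) - Im (Q w) - pi * B * Im (q w)" for w
    by (simp add: F_def)
  have "Im (F z) \<le> 0"
  proof (rule Im_max_principle[of F D])
    show "F holomorphic_on D" using F_holo by (rule holomorphic_on_subset) (simp add: D_def)
    show "open D" unfolding D_def by (intro open_Int open_uhp open_ball)
    show "connected D" unfolding D_def by (intro convex_connected convex_Int convex_uhp convex_ball)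
    show "bounded {z \<in> D. d \<le> Im (F z)}" for d
      by (rule bounded_subset[of "ball 0 R"]) (auto simp: D_def)
    have "- \<i> \<notin> D" by (simp add: D_def)
    then show "D \<noteq> UNIV" by blast
    show "z \<in> D" using z by (simp add: D_def)
    show "eventually (\<lambda>z. Im (F z) < d) (at p within D)"
      if p: "p \<in> frontier D" and d: "d > 0" for p d
    proof -
      have "closure D \<subseteq> {z. Im z \<ge> 0} \<inter> cball 0 R"
        by (intro closure_minimal closed_Int closed_halfspace_Im_ge closed_cball) (auto simp: D_def)
      then have p': "Im p \<ge> 0" "norm p \<le> R" using p by (auto simp: frontier_def)
      have pD: "p \<notin> D" using p \<open>open D\<close> by (simp add: frontier_def interior_open)
      show ?thesis
      proof (cases "Im p = 0")
        case True
        then obtain x where x: "p = of_real x"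
          using complex_is_Real_iff by (metis Reals_cases)
        have xR: "\<bar>x\<bar> \<le> R" using p'(2) x by simp
        have "((\<lambda>z. pi * Im (fe z) - (\<integral>t. poisson z t * \<psi> t \<partial>lborel))
            \<longlongrightarrow> pi * Im (fe p) - pi * \<psi> x) (at p within {z. Im z > 0})"
          unfolding x fe_def
          by (intro tendsto_intros poisson_integral_boundary[OF \<psi>(1)] tendsto_Im_shift f e) simp
        moreover have "pi * Im (fe p) - pi * \<psi> x < d"
          using eq[OF xR] d by (simp add: fe_def x Complex_eq)
        ultimately have "eventually (\<lambda>z. pi * Im (fe z) - (\<integral>t. poisson z t * \<psi> t \<partial>lborel) < d)
            (at p within {z. Im z > 0})"
          by (rule order_tendstoD(2))
        then have "eventually (\<lambda>z. Im z > 0 \<longrightarrow> Im (F z) < d) (at p within {z. Im z > 0})"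
        proof eventually_elim
          case (elim w)
          show ?case
          proof
            assume w: "Im w > 0"
            have "0 \<le> pi * B * Im (q w)" using q_nonneg[OF w] B(1) by simp
            then show "Im (F w) < d" using elim Q(2)[OF w] unfolding Im_F by linarith
          qed
        qed
        then show ?thesis
          unfolding eventually_at_filter by eventually_elim (auto simp: D_def)
      next
        case False
        then have Imp: "Im p > 0" using p' by simp
        then have np: "norm p = R" using pD p' by (simp add: D_def)
        have "isCont (\<lambda>z. Im (F z)) p"
          using holomorphic_on_imp_continuous_on[OF F_holo] open_uhp Imp
          by (auto intro!: continuous_intros simp: continuous_on_eq_continuous_at)
        then have "((\<lambda>z. Im (F z)) \<longlongrightarrow> Im (F p)) (at p within D)"
          unfolding isCont_def by (rule tendsto_within_subset) simp
        moreover have "Im (F p) < d"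
        proof -
          have "Im (fe p) \<le> B * (1 / Im p)" using B(2)[OF np Imp] Imp by (simp add: fe_def field_simps)
          also have "1 / Im p = Im (q p)" using circle_comparison[OF np Imp] by (simp add: q_def)
          finally have "pi * Im (fe p) \<le> pi * B * Im (q p)" by simp
          moreover have "0 \<le> Im (Q p)"
            unfolding Q(2)[OF Imp] by (intro Bochner_Integration.integral_nonneg mult_nonneg_nonneg poisson_nonneg nonneg Imp)
          ultimately show ?thesis unfolding Im_F using d by linarith
        qed
        ultimately show ?thesis by (rule order_tendstoD(2))
      qed
    qed
  qed
  then show ?thesis unfolding Im_F Q(2)[OF z(1)] by (simp add: fe_def q_def)
qed

text \<open>
  The upper estimate on a half disc, with a remainder \<open>B Im z\<close> in which \<open>B\<close> does not depend on the
  height \<open>e\<close>: the product \<open>Im \<zeta> Im f(\<zeta> + i e)\<close> is bounded on the circle \<open>\<bar>\<zeta>\<bar> = R\<close> because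
  \<open>s Im f(x + i s)\<close> increases in \<open>s\<close>.
\<close>

lemma poisson_estimates_shift:
  assumes f: "pick f" and R: "R > 0"
  shows "\<exists>B\<ge>0. \<forall>e z. 0 < e \<and> e \<le> 1 \<and> Im z > 0 \<and> norm z \<le> R / 2 \<longrightarrow>
    pi * Im (f (z + \<i> * of_real e)) \<le>
      (\<integral>t. poisson z t * (cutoff R t * Im (f (Complex t e))) \<partial>lborel) + B * Im z"
proof -
  have "compact ((\<lambda>t. Im (f (Complex t (R + 1)))) ` {-R..R})"
    using R by (intro compact_continuous_image continuous_on_subset[OF continuous_on_Im_horizontal[OF f]]) auto
  then have "bounded ((\<lambda>t. Im (f (Complex t (R + 1)))) ` {-R..R})"
    by (rule compact_imp_bounded)
  then obtain M where M: "M > 0" "\<And>t. t \<in> {-R..R} \<Longrightarrow> \<bar>Im (f (Complex t (R + 1)))\<bar> \<le> M"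
    unfolding bounded_pos by auto
  define B where "B = (R + 1) * M"
  have B: "Im \<zeta> * Im (f (\<zeta> + \<i> * of_real e)) \<le> B"
    if "0 < e" "e \<le> 1" "norm \<zeta> = R" "Im \<zeta> > 0" for e :: real and \<zeta>
  proof -
    have bd: "\<bar>Re \<zeta>\<bar> \<le> R" "\<bar>Im \<zeta>\<bar> \<le> R"
      using that abs_Re_le_cmod[of \<zeta>] abs_Im_le_cmod[of \<zeta>] by auto
    have eq: "\<zeta> + \<i> * of_real e = Complex (Re \<zeta>) (Im \<zeta> + e)"
      by (simp add: complex_eq_iff)
    have "Im \<zeta> * Im (f (\<zeta> + \<i> * of_real e)) \<le> (Im \<zeta> + e) * Im (f (\<zeta> + \<i> * of_real e))"
      using that pick_Im_nonneg[OF f, of "\<zeta> + \<i> * of_real e"] by (intro mult_right_mono) auto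
    also have "\<dots> \<le> (R + 1) * Im (f (Complex (Re \<zeta>) (R + 1)))"
      unfolding eq using that bd by (intro pick_mult_height_mono[OF f]) auto
    also have "\<dots> \<le> B"
      unfolding B_def using M(2)[of "Re \<zeta>"] bd R by (intro mult_left_mono) (auto simp: abs_le_iff)
    finally show ?thesis .
  qed
  have B0: "B \<ge> 0" using M(1) R by (simp add: B_def)
  show ?thesis
  proof (intro exI[of _ "pi * B * (8 / R\<^sup>2)"] conjI allI impI)
    show "pi * B * (8 / R\<^sup>2) \<ge> 0" using B0 by simp
    fix e :: real and z assume ez: "0 < e \<and> e \<le> 1 \<and> Im z > 0 \<and> norm z \<le> R / 2"
    have "pi * Im (f (z + \<i> * of_real e)) \<le>
        (\<integral>t. poisson z t * (cutoff R t * Im (f (Complex t e))) \<partial>lborel)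
        + pi * B * Im (- (1 / (z - of_real R)) - 1 / (z + of_real R))"
    proof (rule poisson_majorant_shift[OF f, of e "R + 1"])
      show "supported (R + 1) (\<lambda>t. cutoff R t * Im (f (Complex t e)))"
        using continuous_on_Im_horizontal[OF f] ez by (intro supported_cutoff_mult) auto
      show "0 \<le> cutoff R t * Im (f (Complex t e))" for t
        using ez by (intro mult_nonneg_nonneg cutoff_nonneg pick_Im_nonneg[OF f]) simp
    qed (use ez R B0 B in \<open>auto simp: cutoff_eq_1\<close>)
    also have "pi * B * Im (- (1 / (z - of_real R)) - 1 / (z + of_real R)) \<le> pi * B * (8 / R\<^sup>2 * Im z)"
      using Im_comparison_le[of z R] ez R B0 by (intro mult_left_mono) auto
    finally show "pi * Im (f (z + \<i> * of_real e)) \<le>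
        (\<integral>t. poisson z t * (cutoff R t * Im (f (Complex t e))) \<partial>lborel) + pi * B * (8 / R\<^sup>2) * Im z"
      by (simp add: mult.assoc)
  qed
qed

section \<open>Existence and uniqueness of the Nevanlinna measure\<close>

text \<open>Borel measures on the line that are finite on compact sets.\<close>

definition locally_finite :: "real measure \<Rightarrow> bool" where
  "locally_finite \<mu> \<longleftrightarrow> sets \<mu> = sets borel \<and> (\<forall>K. compact K \<longrightarrow> emeasure \<mu> K < \<infinity>)"

lemma UN_symmetric_intervals: "(\<Union>n. {- real n..real n}) = UNIV"
proof -
  have "x \<in> (\<Union>n. {- real n..real n})" for x
  proof -
    obtain n :: nat where "\<bar>x\<bar> \<le> real n" using real_arch_simple by blast
    then show ?thesis by (intro UN_I[of n]) (auto simp: abs_le_iff)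
  qed
  then show ?thesis by auto
qed

lemma locally_finite_sets: "locally_finite \<mu> \<Longrightarrow> sets \<mu> = sets borel"
  by (simp add: locally_finite_def)

lemma locally_finite_bounded:
  assumes "locally_finite \<mu>" "A \<subseteq> {-S..S}"
  shows "emeasure \<mu> A < \<infinity>"
proof -
  have "emeasure \<mu> A \<le> emeasure \<mu> {-S..S}"
    using assms by (intro emeasure_mono) (auto simp: locally_finite_def)
  also have "\<dots> < \<infinity>" using assms by (auto simp: locally_finite_def)
  finally show ?thesis .
qed

lemma locally_finite_emeasure_eq:
  "locally_finite \<mu> \<Longrightarrow> A \<subseteq> {-S..S} \<Longrightarrow> emeasure \<mu> A = ennreal (measure \<mu> A)"
  using locally_finite_bounded[of \<mu> A S] by (simp add: emeasure_eq_ennreal_measure)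

lemma AE_not_atom:
  assumes "locally_finite \<mu>" "emeasure \<mu> {\<tau>} = 0" shows "AE t in \<mu>. t \<noteq> \<tau>"
  using AE_not_in[of "{\<tau>}" \<mu>] assms by (simp add: null_sets_def locally_finite_sets)

lemma integrable_supported:
  assumes \<mu>: "locally_finite \<mu>" and \<psi>: "supported S \<psi>"
  shows "integrable \<mu> \<psi>"
proof -
  have sets_mu [measurable_cong]: "sets \<mu> = sets borel" using \<mu> by (rule locally_finite_sets)
  have [measurable]: "\<psi> \<in> borel_measurable borel" using \<psi> by (rule supported_measurable)
  obtain M where M: "M > 0" "\<And>t. \<bar>\<psi> t\<bar> \<le> M"
    using supported_bounded[OF \<psi>] by blast
  have "integrable \<mu> (\<lambda>t. M * indicator {-S..S} t)"
    using locally_finite_bounded[OF \<mu>, of "{-S..S}" S]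
    by (intro integrable_mult_right integrable_real_indicator) (auto simp: sets_mu)
  then show ?thesis
  proof (rule Bochner_Integration.integrable_bound)
    show "AE t in \<mu>. norm (\<psi> t) \<le> norm (M * indicator {-S..S} t)"
    proof (rule AE_I2)
      fix t show "norm (\<psi> t) \<le> norm (M * indicator {-S..S} t)"
        using M(1) M(2)[of t] supportedD(2)[OF \<psi>, of t]
        by (cases "\<bar>t\<bar> \<le> S") (auto simp: abs_le_iff)
    qed
  qed measurable
qed

text \<open>
  Riemann--Stieltjes sums on an equidistant partition approximate integrals; \<open>F\<close> is a distribution
  function of \<open>N\<close>, and \<open>\<eta>\<close> bounds the oscillation of \<open>\<phi>\<close> on intervals of length \<open>h\<close>.
\<close>

lemma stieltjes_sum_approx:
  fixes F :: "real \<Rightarrow> real"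
  assumes sets_N: "sets N = sets borel"
    and em: "\<And>a b. a \<le> b \<Longrightarrow> emeasure N {a<..b} = ennreal (F b - F a)"
    and F: "mono F"
    and \<phi>: "supported S \<phi>"
    and h: "h > 0" and osc: "\<And>s t. \<bar>s - t\<bar> \<le> h \<Longrightarrow> \<bar>\<phi> s - \<phi> t\<bar> \<le> \<eta>"
    and c: "c < - S" "S \<le> c + real m * h"
  shows "\<bar>(\<integral>t. \<phi> t \<partial>N) - (\<Sum>k<m. \<phi> (c + real k * h) * (F (c + real (Suc k) * h) - F (c + real k * h)))\<bar>
      \<le> \<eta> * (F (c + real m * h) - F c)"
proof -
  let ?S = "\<lambda>m. \<Sum>k<m. \<phi> (c + real k * h) * (F (c + real (Suc k) * h) - F (c + real k * h))"
  note sets_N [measurable_cong]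
  have [measurable]: "\<phi> \<in> borel_measurable borel" using \<phi> by (rule supported_measurable)
  obtain M where M: "M > 0" "\<And>t. \<bar>\<phi> t\<bar> \<le> M"
    using supported_bounded[OF \<phi>] by blast
  have fin: "emeasure N {a<..b} < \<infinity>" for a b
    by (cases "a \<le> b") (auto simp: em)
  have int: "integrable N (\<lambda>t. indicator {a<..b} t * g t)"
    if "g \<in> borel_measurable borel" "\<And>t. \<bar>g t\<bar> \<le> K" for a b g and K :: real
  proof -
    have K: "0 \<le> K" using that(2)[of 0] by simp
    have bd: "norm (indicator {a<..b} t * g t) \<le> norm (K * indicator {a<..b} t)" for t
      using that(2)[of t] K by (simp add: indicator_def)
    have "integrable N (\<lambda>t. K * indicator {a<..b} t)"
      using fin by (intro integrable_mult_right integrable_real_indicator) (auto simp: sets_N)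
    then show ?thesis
      by (rule Bochner_Integration.integrable_bound) (use that(1) bd in auto)
  qed
  have meas: "measure N {a<..b} = F b - F a" if "a \<le> b" for a b
    using em[OF that] monoD[OF F that] by (simp add: measure_def)
  have piece: "\<bar>(\<integral>t. indicator {a<..b} t * \<phi> t \<partial>N) - \<phi> a * (F b - F a)\<bar> \<le> \<eta> * (F b - F a)"
    if ab: "a \<le> b" "b \<le> a + h" for a b
  proof -
    have eq: "(\<integral>t. indicator {a<..b} t * \<phi> t \<partial>N) - \<phi> a * (F b - F a) =
        (\<integral>t. indicator {a<..b} t * (\<phi> t - \<phi> a) \<partial>N)"
    proof -
      have "(\<integral>t. indicator {a<..b} t * (\<phi> t - \<phi> a) \<partial>N) =
          (\<integral>t. indicator {a<..b} t * \<phi> t - indicator {a<..b} t * \<phi> a \<partial>N)"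
        by (simp add: algebra_simps)
      also have "\<dots> = (\<integral>t. indicator {a<..b} t * \<phi> t \<partial>N) - (\<integral>t. indicator {a<..b} t * \<phi> a \<partial>N)"
        by (rule Bochner_Integration.integral_diff; rule int[where K=M]) (use M(2) in auto)
      also have "(\<integral>t. indicator {a<..b} t * \<phi> a \<partial>N) = \<phi> a * (F b - F a)"
        using meas[OF ab(1)] by (simp add: sets_N sets_eq_imp_space_eq[OF sets_N] mult.commute)
      finally show ?thesis by simp
    qed
    have "\<bar>\<integral>t. indicator {a<..b} t * (\<phi> t - \<phi> a) \<partial>N\<bar> \<le> (\<integral>t. \<eta> * indicator {a<..b} t \<partial>N)"
    proof -
      have "norm (\<integral>t. indicator {a<..b} t * (\<phi> t - \<phi> a) \<partial>N) \<le> (\<integral>t. \<eta> * indicator {a<..b} t \<partial>N)"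
      proof (rule Bochner_Integration.integral_norm_bound_integral)
        show "integrable N (\<lambda>t. indicator {a<..b} t * (\<phi> t - \<phi> a))"
        proof (rule int[where K="2 * M"])
          show "\<bar>\<phi> t - \<phi> a\<bar> \<le> 2 * M" for t
            using abs_triangle_ineq4[of "\<phi> t" "\<phi> a"] M(2)[of t] M(2)[of a] by linarith
        qed measurable
        show "integrable N (\<lambda>t. \<eta> * indicator {a<..b} t)"
          using fin by (intro integrable_mult_right integrable_real_indicator) (auto simp: sets_N)
        show "norm (indicator {a<..b} t * (\<phi> t - \<phi> a)) \<le> \<eta> * indicator {a<..b} t" for t
          using osc[of t a] ab by (auto simp: indicator_def)
      qed
      then show ?thesis by simp
    qed
    also have "\<dots> = \<eta> * (F b - F a)"
      using meas[OF ab(1)] by (simp add: sets_N sets_eq_imp_space_eq[OF sets_N])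
    finally show ?thesis unfolding eq .
  qed
  have partial: "\<bar>(\<integral>t. indicator {c<..c + real m * h} t * \<phi> t \<partial>N) -
      ?S m\<bar>
      \<le> \<eta> * (F (c + real m * h) - F c)" for m
  proof (induction m)
    case 0
    show ?case by simp
  next
    case (Suc m)
    define p q where "p = c + real m * h" and "q = c + real (Suc m) * h"
    have pq: "c \<le> p" "p \<le> q" "q \<le> p + h" using h by (auto simp: p_def q_def algebra_simps)
    have "(\<integral>t. indicator {c<..q} t * \<phi> t \<partial>N) =
        (\<integral>t. indicator {c<..p} t * \<phi> t + indicator {p<..q} t * \<phi> t \<partial>N)"
      using pq by (intro Bochner_Integration.integral_cong refl) (auto simp: indicator_def)
    also have "\<dots> = (\<integral>t. indicator {c<..p} t * \<phi> t \<partial>N) + (\<integral>t. indicator {p<..q} t * \<phi> t \<partial>N)"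
      by (rule Bochner_Integration.integral_add) (use M in \<open>auto intro!: int\<close>)
    finally have split: "(\<integral>t. indicator {c<..q} t * \<phi> t \<partial>N) =
        (\<integral>t. indicator {c<..p} t * \<phi> t \<partial>N) + (\<integral>t. indicator {p<..q} t * \<phi> t \<partial>N)" .
    have "\<bar>(\<integral>t. indicator {c<..p} t * \<phi> t \<partial>N) -
        ?S m\<bar>
        \<le> \<eta> * (F p - F c)"
      using Suc.IH by (simp add: p_def)
    moreover have "\<bar>(\<integral>t. indicator {p<..q} t * \<phi> t \<partial>N) - \<phi> p * (F q - F p)\<bar> \<le> \<eta> * (F q - F p)"
      by (rule piece[OF pq(2,3)])
    moreover have "?S (Suc m) =
        ?S m + \<phi> p * (F q - F p)"
      by (simp add: p_def q_def)
    moreover have "\<eta> * (F q - F c) = \<eta> * (F p - F c) + \<eta> * (F q - F p)" by (simp add: algebra_simps)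
    ultimately show ?case unfolding q_def[symmetric] split by linarith
  qed
  have "(\<lambda>t. indicator {c<..c + real m * h} t * \<phi> t) = \<phi>"
  proof
    fix t show "indicator {c<..c + real m * h} t * \<phi> t = \<phi> t"
      using supportedD(2)[OF \<phi>, of t] c by (cases "\<bar>t\<bar> \<le> S") (auto simp: abs_le_iff)
  qed
  then show ?thesis using partial[of m] by simp
qed

lemma supported_uniform:
  assumes \<phi>: "supported S \<phi>" and "\<eta> > 0"
  shows "\<exists>h>0. \<forall>s t. \<bar>s - t\<bar> \<le> h \<longrightarrow> \<bar>\<phi> s - \<phi> t\<bar> \<le> \<eta>"
proof -
  have "uniformly_continuous_on {-\<bar>S\<bar>-1..\<bar>S\<bar>+1} \<phi>"
    by (rule compact_uniformly_continuous) (auto simp: supportedD[OF \<phi>])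
  then obtain d where d: "d > 0"
    "\<And>s t. s \<in> {-\<bar>S\<bar>-1..\<bar>S\<bar>+1} \<Longrightarrow> t \<in> {-\<bar>S\<bar>-1..\<bar>S\<bar>+1} \<Longrightarrow> dist t s < d \<Longrightarrow> dist (\<phi> t) (\<phi> s) < \<eta>"
    using \<open>\<eta> > 0\<close> unfolding uniformly_continuous_on_def by metis
  define h where "h = min (d / 2) 1"
  have "\<bar>\<phi> s - \<phi> t\<bar> \<le> \<eta>" if st: "\<bar>s - t\<bar> \<le> h" for s t
  proof (cases "s \<in> {-\<bar>S\<bar>-1..\<bar>S\<bar>+1} \<and> t \<in> {-\<bar>S\<bar>-1..\<bar>S\<bar>+1}")
    case True
    have "dist s t < d" using st d(1) by (auto simp: h_def dist_real_def)
    then show ?thesis using d(2)[of t s] True by (simp add: dist_real_def)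
  next
    case False
    have "\<bar>s - t\<bar> \<le> 1" using st by (simp add: h_def)
    then have "S < \<bar>s\<bar>" "S < \<bar>t\<bar>" using False by auto
    then show ?thesis using supportedD(2)[OF \<phi>] \<open>\<eta> > 0\<close> by simp
  qed
  moreover have "h > 0" using d(1) by (simp add: h_def)
  ultimately show ?thesis by blast
qed

text \<open>
  Convergence of distribution functions at continuity points of the limit implies vague
  convergence. The partition is shifted so that it avoids the countably many jumps.
\<close>

lemma vague_convergence_of_distribution_functions:
  fixes F :: "real \<Rightarrow> real" and H :: "nat \<Rightarrow> real \<Rightarrow> real"
  assumes sets_N: "sets N = sets borel" "\<And>n. sets (L n) = sets borel"
    and em: "\<And>a b. a \<le> b \<Longrightarrow> emeasure N {a<..b} = ennreal (F b - F a)"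
      "\<And>n a b. a \<le> b \<Longrightarrow> emeasure (L n) {a<..b} = ennreal (H n b - H n a)"
    and mono: "mono F" "\<And>n. mono (H n)"
    and bdd: "\<And>x. \<bar>F x\<bar> \<le> K" "\<And>n x. \<bar>H n x\<bar> \<le> K"
    and lim: "\<And>x. isCont F x \<Longrightarrow> (\<lambda>n. H n x) \<longlonglongrightarrow> F x"
    and \<phi>: "supported S \<phi>"
  shows "(\<lambda>n. \<integral>t. \<phi> t \<partial>L n) \<longlonglongrightarrow> (\<integral>t. \<phi> t \<partial>N)"
proof (rule LIMSEQ_I)
  fix r :: real assume r: "r > 0"
  have K0: "K \<ge> 0" using bdd(1)[of 0] by simp
  \<comment> \<open>each of the two Riemann--Stieltjes approximations will cost \<open>\<eta> * (2 * K)\<close>\<close>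
  define \<eta> where "\<eta> = r / (4 * K + 4)"
  have \<eta>: "\<eta> > 0" "\<eta> * (4 * K) < r"
    using r K0 by (auto simp: \<eta>_def field_simps)
  obtain h where h: "h > 0" "\<And>s t. \<bar>s - t\<bar> \<le> h \<Longrightarrow> \<bar>\<phi> s - \<phi> t\<bar> \<le> \<eta>"
    using supported_uniform[OF \<phi> \<eta>(1)] by blast
  define D where "D = {x. \<not> isCont F x}"
  have ctD: "countable D" unfolding D_def by (rule mono_ctble_discont[OF mono(1)])
  define E where "E = (\<Union>k::nat. (\<lambda>x. x - real k * h) ` D)"
  have "countable E" unfolding E_def using ctD by (intro countable_UN countable_image) auto
  moreover have "uncountable {- \<bar>S\<bar> - 2<..< - \<bar>S\<bar> - 1}" by (simp add: uncountable_open_interval)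
  ultimately have "\<not> {- \<bar>S\<bar> - 2<..< - \<bar>S\<bar> - 1} \<subseteq> E" using countable_subset by blast
  then obtain c where c: "c \<in> {- \<bar>S\<bar> - 2<..< - \<bar>S\<bar> - 1}" "c \<notin> E" by blast
  have cont: "isCont F (c + real k * h)" for k
  proof (rule ccontr)
    assume "\<not> isCont F (c + real k * h)"
    then have "c + real k * h \<in> D" by (simp add: D_def)
    then have "(c + real k * h) - real k * h \<in> E" unfolding E_def by blast
    then show False using c(2) by simp
  qed
  obtain m :: nat where "(S - c) / h \<le> real m" using real_arch_simple by blast
  then have m: "S \<le> c + real m * h" using h(1) by (simp add: field_simps)
  have cS: "c < - S" using c(1) by auto
  define T where "T = (\<lambda>G :: real \<Rightarrow> real. \<Sum>k<m. \<phi> (c + real k * h) * (G (c + real (Suc k) * h) - G (c + real k * h)))"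
  have "(\<lambda>n. T (H n)) \<longlonglongrightarrow> T F"
    unfolding T_def by (intro tendsto_intros lim cont)
  moreover have "r - \<eta> * (4 * K) > 0" using \<eta> by simp
  ultimately obtain n0 where n0: "\<And>n. n \<ge> n0 \<Longrightarrow> norm (T (H n) - T F) < r - \<eta> * (4 * K)"
    using LIMSEQ_D by blast
  have approx: "\<bar>(\<integral>t. \<phi> t \<partial>N') - T G\<bar> \<le> \<eta> * (2 * K)"
    if "sets N' = sets borel" "\<And>a b. a \<le> b \<Longrightarrow> emeasure N' {a<..b} = ennreal (G b - G a)"
      "mono G" "\<And>x. \<bar>G x\<bar> \<le> K" for N' G
  proof -
    have "\<bar>(\<integral>t. \<phi> t \<partial>N') - T G\<bar> \<le> \<eta> * (G (c + real m * h) - G c)"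
      unfolding T_def by (rule stieltjes_sum_approx[OF that(1,2,3) \<phi> h cS m])
    also have "\<dots> \<le> \<eta> * (2 * K)"
      using that(4)[of c] that(4)[of "c + real m * h"] \<eta>(1) by (intro mult_left_mono) (auto simp: abs_le_iff)
    finally show ?thesis .
  qed
  show "\<exists>no. \<forall>n\<ge>no. norm ((\<integral>t. \<phi> t \<partial>L n) - (\<integral>t. \<phi> t \<partial>N)) < r"
  proof (intro exI[of _ n0] allI impI)
    fix n assume n: "n \<ge> n0"
    have "\<bar>(\<integral>t. \<phi> t \<partial>N) - T F\<bar> \<le> \<eta> * (2 * K)"
      by (rule approx) (use sets_N em mono bdd in auto)
    moreover have "\<bar>(\<integral>t. \<phi> t \<partial>L n) - T (H n)\<bar> \<le> \<eta> * (2 * K)"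
      by (rule approx) (use sets_N em mono bdd in auto)
    moreover have "\<bar>T (H n) - T F\<bar> < r - \<eta> * (4 * K)" using n0[OF n] by simp
    ultimately show "norm ((\<integral>t. \<phi> t \<partial>L n) - (\<integral>t. \<phi> t \<partial>N)) < r"
      unfolding real_norm_def by linarith
  qed
qed

text \<open>
  The masses of \<open>Im f(t + i e) dt / (1 + t\<^sup>2)\<close> are bounded by \<open>\<pi> Im f(i + i e)\<close>, so Helly's selection
  theorem gives a vague limit along a subsequence.
\<close>

lemma vague_limit_subsequence:
  assumes f: "pick f"
  obtains s :: "nat \<Rightarrow> nat" and \<mu> where "strict_mono s" "locally_finite \<mu>"
    "\<And>S \<phi>. supported S \<phi> \<Longrightarrow>
      (\<lambda>n. \<integral>t. \<phi> t * Im (f (Complex t (1 / (1 + real (s n))))) \<partial>lborel) \<longlonglongrightarrow> (\<integral>t. \<phi> t \<partial>\<mu>)"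
proof -
  define e where "e = (\<lambda>n. 1 / (1 + real n))"
  have e: "e n > 0" "e n \<le> 1" for n by (auto simp: e_def)
  define u where "u = (\<lambda>n t. Im (f (Complex t (e n))))"
  have u0: "u n t \<ge> 0" for n t unfolding u_def using e by (intro pick_Im_nonneg[OF f]) simp
  have contu: "continuous_on UNIV (u n)" for n
    unfolding u_def by (rule continuous_on_Im_horizontal[OF f e(1)])
  have [measurable]: "u n \<in> borel_measurable borel" for n
    by (rule borel_measurable_continuous_onI[OF contu])
  \<comment> \<open>\<open>1 / (1 + t\<^sup>2)\<close> is the Poisson kernel at the point \<open>\<i>\<close>\<close>
  define L where "L = (\<lambda>n. density lborel (\<lambda>t. ennreal (u n t / (1 + t\<^sup>2))))"
  define M where "M = pi * (2 * Im (f (Complex 0 2)))"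
  have M0: "M \<ge> 0" unfolding M_def by (intro mult_nonneg_nonneg pick_Im_nonneg[OF f]) auto
  have setsL: "sets (L n) = sets borel" for n by (simp add: L_def)
  have interval_mass: "emeasure (L n) {- real N..real N} \<le> ennreal M" for n N
  proof -
    define \<psi> where "\<psi> = (\<lambda>t. cutoff (real N) t * u n t)"
    have \<psi>: "supported (real N + 1) \<psi>"
      unfolding \<psi>_def by (rule supported_cutoff_mult[OF contu])
    have pk: "supported (real N + 1) (\<lambda>t. poisson \<i> t * \<psi> t)"
      by (intro supported_mult \<psi> continuous_on_poisson) simp
    have "(\<integral>t. poisson \<i> t * \<psi> t \<partial>lborel) \<le> pi * Im (f (\<i> + \<i> * of_real (e n)))"
    proof (rule poisson_minorant_shift[OF f e(1) \<psi>])
      show "\<psi> t \<le> Im (f (Complex t (e n)))" for t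
        using mult_right_mono[OF cutoff_le_1 u0, of "real N" t n t] by (simp add: \<psi>_def u_def)
    qed auto
    also have "\<dots> \<le> M"
    proof -
      have eq: "\<i> + \<i> * of_real (e n) = Complex 0 (1 + e n)" by (simp add: complex_eq_iff)
      have "0 \<le> e n * Im (f (Complex 0 (1 + e n)))"
        using e[of n] by (intro mult_nonneg_nonneg pick_Im_nonneg[OF f]) auto
      then have "Im (f (Complex 0 (1 + e n))) \<le> (1 + e n) * Im (f (Complex 0 (1 + e n)))"
        by (simp add: algebra_simps)
      also have "\<dots> \<le> 2 * Im (f (Complex 0 2))"
        using e[of n] by (intro pick_mult_height_mono[OF f]) auto
      finally show ?thesis unfolding eq M_def by simp
    qed
    finally have le: "(\<integral>t. poisson \<i> t * \<psi> t \<partial>lborel) \<le> M" .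
    have "emeasure (L n) {- real N..real N} =
        (\<integral>\<^sup>+t. ennreal (u n t / (1 + t\<^sup>2)) * indicator {- real N..real N} t \<partial>lborel)"
      unfolding L_def by (rule emeasure_density) auto
    also have "\<dots> \<le> (\<integral>\<^sup>+t. ennreal (poisson \<i> t * \<psi> t) \<partial>lborel)"
    proof (rule nn_integral_mono)
      fix t
      show "ennreal (u n t / (1 + t\<^sup>2)) * indicator {- real N..real N} t \<le> ennreal (poisson \<i> t * \<psi> t)"
        by (cases "t \<in> {- real N..real N}")
           (auto simp: \<psi>_def cutoff_eq_1 poisson_def add.commute)
    qed
    also have "\<dots> = ennreal (\<integral>t. poisson \<i> t * \<psi> t \<partial>lborel)"
      by (intro nn_integral_eq_integral supported_integral(1)[OF pk] AE_I2 mult_nonneg_nonneg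
        poisson_nonneg) (auto simp: \<psi>_def cutoff_nonneg u0)
    also have "\<dots> \<le> ennreal M" using le by (rule ennreal_leI)
    finally show ?thesis .
  qed
  have mass: "emeasure (L n) UNIV \<le> ennreal M" for n
  proof -
    note UN_symmetric_intervals
    moreover have "(SUP N. emeasure (L n) {- real N..real N}) = emeasure (L n) (\<Union>N. {- real N..real N})"
      by (rule SUP_emeasure_incseq) (auto simp: setsL incseq_def)
    moreover have "(SUP N. emeasure (L n) {- real N..real N}) \<le> ennreal M"
      by (rule SUP_least) (rule interval_mass)
    ultimately show ?thesis by simp
  qed
  have finL: "finite_borel_measure (L n)" for n
  proof -
    have "finite_measure (L n)"
      using mass[of n] by (intro finite_measureI) (auto simp: L_def top_unique)
    then show ?thesis
      using setsL by (simp add: finite_borel_measure_def finite_borel_measure_axioms_def)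
  qed
  define H where "H = (\<lambda>n. cdf (L n))"
  have monoH: "mono (H n)" for n
    unfolding H_def using finite_borel_measure.cdf_nondecreasing[OF finL] by (auto intro: monoI)
  have rcH: "continuous (at_right x) (H n)" for x n
    unfolding H_def by (rule finite_borel_measure.cdf_is_right_cont[OF finL])
  have bddH: "\<bar>H n x\<bar> \<le> M" for n x
  proof -
    have "emeasure (L n) {..x} \<le> emeasure (L n) UNIV" by (intro emeasure_mono) (auto simp: setsL)
    then have "emeasure (L n) {..x} \<le> ennreal M" using mass[of n] by simp
    then have "measure (L n) {..x} \<le> M"
      using M0 unfolding measure_def by (simp add: enn2real_leI)
    then show ?thesis by (simp add: H_def cdf_def)
  qed
  obtain s F where s: "strict_mono (s :: nat \<Rightarrow> nat)" and F: "\<And>x. continuous (at_right x) F" "mono F"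
    "\<And>x. \<bar>F x\<bar> \<le> M" and lim: "\<And>x. isCont F x \<Longrightarrow> (\<lambda>n. H (s n) x) \<longlonglongrightarrow> F x"
    using Helly_selection[of H M, OF rcH monoH bddH] by blast
  define N where "N = interval_measure F"
  have setsN: "sets N = sets borel" by (simp add: N_def)
  have emN: "emeasure N {a<..b} = ennreal (F b - F a)" if "a \<le> b" for a b
    unfolding N_def using F(1,2) that by (intro emeasure_interval_measure_Ioc) (auto dest: monoD)
  have emL: "emeasure (L n) {a<..b} = ennreal (H n b - H n a)" if "a \<le> b" for a b n
  proof -
    interpret finite_borel_measure "L n" by (rule finL)
    show ?thesis
    proof (cases "a = b")
      case False
      then have "H n b - H n a = measure (L n) {a<..b}"
        unfolding H_def using that by (intro cdf_diff_eq) auto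
      then show ?thesis by (simp add: emeasure_eq_measure)
    qed simp
  qed
  define \<mu> where "\<mu> = density N (\<lambda>t. ennreal (1 + t\<^sup>2))"
  have sets_mu: "sets \<mu> = sets borel" by (simp add: \<mu>_def setsN)
  note setsN [measurable_cong]
  have "locally_finite \<mu>"
    unfolding locally_finite_def
  proof (intro conjI allI impI sets_mu)
    fix C :: "real set" assume C: "compact C"
    then have [measurable]: "C \<in> sets borel" by (simp add: borel_compact)
    obtain R where R: "R > 0" "\<And>x. x \<in> C \<Longrightarrow> \<bar>x\<bar> \<le> R"
      using compact_imp_bounded[OF C] unfolding bounded_pos by auto
    have "emeasure \<mu> C = (\<integral>\<^sup>+t. ennreal (1 + t\<^sup>2) * indicator C t \<partial>N)"
      unfolding \<mu>_def by (rule emeasure_density) (auto simp: setsN)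
    also have "\<dots> \<le> (\<integral>\<^sup>+t. ennreal (1 + R\<^sup>2) * indicator {-R-1<..R} t \<partial>N)"
    proof (rule nn_integral_mono)
      fix t
      show "ennreal (1 + t\<^sup>2) * indicator C t \<le> ennreal (1 + R\<^sup>2) * indicator {-R-1<..R} t"
      proof (cases "t \<in> C")
        case True
        then have "\<bar>t\<bar> \<le> R" using R by simp
        moreover from this have "t\<^sup>2 \<le> R\<^sup>2" using R(1) by (simp add: abs_le_square_iff[symmetric])
        ultimately show ?thesis using True by (auto simp: indicator_def abs_le_iff intro!: ennreal_leI)
      qed simp
    qed
    also have "\<dots> = ennreal (1 + R\<^sup>2) * emeasure N {-R-1<..R}"
      by (rule nn_integral_cmult_indicator) (simp add: setsN)
    also have "\<dots> < \<infinity>" using R(1) by (simp add: emN ennreal_mult_less_top)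
    finally show "emeasure \<mu> C < \<infinity>" .
  qed
  moreover have "(\<lambda>n. \<integral>t. \<phi> t * Im (f (Complex t (1 / (1 + real (s n))))) \<partial>lborel) \<longlonglongrightarrow> (\<integral>t. \<phi> t \<partial>\<mu>)"
    if \<phi>: "supported S \<phi>" for S \<phi>
  proof -
    have [measurable]: "\<phi> \<in> borel_measurable borel" using \<phi> by (rule supported_measurable)
    define \<phi>' where "\<phi>' = (\<lambda>t. (1 + t\<^sup>2) * \<phi> t)"
    have \<phi>': "supported S \<phi>'"
      unfolding \<phi>'_def by (rule supported_mult[OF \<phi>]) (intro continuous_intros)
    have [measurable]: "\<phi>' \<in> borel_measurable borel" using \<phi>' by (rule supported_measurable)
    have "(\<lambda>n. \<integral>t. \<phi>' t \<partial>L (s n)) \<longlonglongrightarrow> (\<integral>t. \<phi>' t \<partial>N)"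
      by (rule vague_convergence_of_distribution_functions[where F=F and H="\<lambda>n. H (s n)" and K=M])
         (use setsN setsL emN emL F monoH bddH lim \<phi>' in auto)
    moreover have "(\<integral>t. \<phi>' t \<partial>L n) = (\<integral>t. \<phi> t * Im (f (Complex t (e n))) \<partial>lborel)" for n
    proof -
      have "(\<integral>t. \<phi>' t \<partial>L n) = (\<integral>t. (u n t / (1 + t\<^sup>2)) * \<phi>' t \<partial>lborel)"
        unfolding L_def by (intro integral_real_density AE_I2) (auto simp: u0)
      also have "(\<lambda>t. (u n t / (1 + t\<^sup>2)) * \<phi>' t) = (\<lambda>t. \<phi> t * Im (f (Complex t (e n))))"
      proof
        fix t :: real
        have "1 + t\<^sup>2 \<noteq> 0" using zero_le_power2[of t] by linarith
        then show "(u n t / (1 + t\<^sup>2)) * \<phi>' t = \<phi> t * Im (f (Complex t (e n)))"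
          by (simp add: \<phi>'_def u_def)
      qed
      finally show ?thesis .
    qed
    moreover have "(\<integral>t. \<phi>' t \<partial>N) = (\<integral>t. \<phi> t \<partial>\<mu>)"
      unfolding \<mu>_def \<phi>'_def by (rule integral_real_density[symmetric]) auto
    ultimately show ?thesis by (simp add: e_def)
  qed
  ultimately show thesis using that s by blast
qed

text \<open>
  A locally finite measure is determined by its integrals of compactly supported continuous
  functions, because indicators of compact intervals are decreasing limits of such functions.
\<close>

lemma locally_finite_eqI:
  assumes M: "locally_finite M" and N: "locally_finite N"
    and eq: "\<And>S \<phi>. supported S \<phi> \<Longrightarrow> (\<integral>t. \<phi> t \<partial>M) = (\<integral>t. \<phi> t \<partial>N)"
  shows "M = N"
proof -
  have setsM: "sets M = sets borel" and setsN: "sets N = sets borel"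
    using M N by (auto simp: locally_finite_def)
  have supp: "supported (\<bar>a\<bar> + \<bar>b\<bar> + 1) (\<lambda>t. max 0 (1 - real (Suc n) * (max 0 (a - t) + max 0 (t - b))))"
    for a b :: real and n
    unfolding supported_def
  proof (intro conjI allI impI)
    fix t assume t: "\<bar>a\<bar> + \<bar>b\<bar> + 1 < \<bar>t\<bar>"
    then have "1 * 1 \<le> real (Suc n) * (max 0 (a - t) + max 0 (t - b))"
      by (intro mult_mono) (auto simp: max_def)
    then show "max 0 (1 - real (Suc n) * (max 0 (a - t) + max 0 (t - b))) = 0" by simp
  qed (intro continuous_intros)
  have int: "(\<lambda>n. \<integral>t. max 0 (1 - real (Suc n) * (max 0 (a - t) + max 0 (t - b))) \<partial>L) \<longlonglongrightarrow> measure L {a..b}"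
    if L: "locally_finite L" and ab: "a \<le> b" for L :: "real measure" and a b
  proof -
    define g where "g = (\<lambda>n t. max 0 (1 - real (Suc n) * (max 0 (a - t) + max 0 (t - b))))"
    have setsL [measurable_cong]: "sets L = sets borel" using L by (simp add: locally_finite_def)
    have g0: "supported (\<bar>a\<bar> + \<bar>b\<bar> + 1) (g 0)"
      unfolding g_def by (rule supp)
    have "(\<lambda>n. \<integral>t. g n t \<partial>L) \<longlonglongrightarrow> (\<integral>t. indicator {a..b} t \<partial>L)"
    proof (rule integral_dominated_convergence)
      show "integrable L (g 0)" by (rule integrable_supported[OF L g0])
      show "g n \<in> borel_measurable L" for n unfolding g_def by measurable
      show "(\<lambda>t. indicator {a..b} t) \<in> borel_measurable L" by measurable
      show "AE t in L. norm (g n t) \<le> g 0 t" for n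
      proof (rule AE_I2)
        fix t
        have "1 * (max 0 (a - t) + max 0 (t - b)) \<le> real (Suc n) * (max 0 (a - t) + max 0 (t - b))"
          by (intro mult_right_mono) auto
        then show "norm (g n t) \<le> g 0 t" by (simp add: g_def)
      qed
      show "AE t in L. (\<lambda>n. g n t) \<longlonglongrightarrow> indicator {a..b} t"
      proof (rule AE_I2)
        fix t
        define d where "d = max 0 (a - t) + max 0 (t - b)"
        show "(\<lambda>n. g n t) \<longlonglongrightarrow> indicator {a..b} t"
        proof (cases "t \<in> {a..b}")
          case True
          then have "g n t = 1" for n by (simp add: g_def)
          then show ?thesis using True by simp
        next
          case False
          then have d: "d > 0" by (auto simp: d_def max_def)
          obtain n0 :: nat where n0: "1 / d \<le> real n0" using real_arch_simple by blast
          have "g n t = 0" if "n \<ge> n0" for n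
          proof -
            have "1 / d \<le> real (Suc n)" using n0 that by simp
            then have "1 \<le> real (Suc n) * d" using d by (simp add: field_simps)
            then show ?thesis by (simp add: g_def d_def)
          qed
          then have "eventually (\<lambda>n. g n t = 0) sequentially"
            by (auto simp: eventually_sequentially)
          then show ?thesis using False by (simp add: tendsto_eventually)
        qed
      qed
    qed
    then show ?thesis by (simp add: g_def sets_eq_imp_space_eq[OF setsL])
  qed
  have meas: "measure M {a..b} = measure N {a..b}" if ab: "a \<le> b" for a b
  proof (rule LIMSEQ_unique[OF int[OF M ab]])
    from eq[OF supp[of a b]] show "(\<lambda>n. \<integral>t. max 0 (1 - real (Suc n) * (max 0 (a - t) + max 0 (t - b))) \<partial>M) \<longlonglongrightarrow> measure N {a..b}"
      using int[OF N ab] by simp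
  qed
  have finM: "emeasure M {a..b} \<noteq> \<infinity>" and finN: "emeasure N {a..b} \<noteq> \<infinity>" for a b
    using M N unfolding locally_finite_def by (auto simp: less_top[symmetric])
  have em: "emeasure M {a..b} = emeasure N {a..b}" for a b
    using meas[of a b] finM[of a b] finN[of a b]
    by (cases "a \<le> b") (simp_all add: emeasure_eq_ennreal_measure)
  show ?thesis
  proof (rule measure_eqI_generator_eq[where E="range (\<lambda>(a, b). {a..b})" and \<Omega>=UNIV and A="\<lambda>n. {- real n..real n}"])
    show "Int_stable (range (\<lambda>(a, b). {a..b::real}))"
    proof (rule Int_stableI)
      fix A B :: "real set" assume "A \<in> range (\<lambda>(a, b). {a..b})" "B \<in> range (\<lambda>(a, b). {a..b})"
      then obtain a b c d where "A = {a..b}" "B = {c..d}" by auto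
      then show "A \<inter> B \<in> range (\<lambda>(a, b). {a..b})" by (auto intro!: image_eqI[of _ _ "(max a c, min b d)"])
    qed
    show "sets M = sigma_sets UNIV (range (\<lambda>(a, b). {a..b}))"
      "sets N = sigma_sets UNIV (range (\<lambda>(a, b). {a..b}))"
      unfolding setsM setsN by (simp_all add: borel_eq_atLeastAtMost)
    show "(\<Union>n. {- real n..real n}) = UNIV" by (rule UN_symmetric_intervals)
  qed (use em finM in auto)
qed

text \<open>
  Two-sided Poisson estimates of \<open>Im f\<close> by a measure: the Poisson integrals of its truncations stay
  below \<open>\<pi> Im f\<close> on the whole half plane, and locally they bound \<open>\<pi> Im f\<close> from above up to a
  multiple of \<open>Im z\<close>.
\<close>

definition poisson_estimates :: "(complex \<Rightarrow> complex) \<Rightarrow> real measure \<Rightarrow> bool" where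
  "poisson_estimates f \<mu> \<longleftrightarrow>
    (\<forall>R>0. \<forall>z. Im z > 0 \<longrightarrow> (\<integral>t. poisson z t * cutoff R t \<partial>\<mu>) \<le> pi * Im (f z)) \<and>
    (\<forall>R>0. \<exists>B\<ge>0. \<forall>z. Im z > 0 \<and> norm z \<le> R / 2 \<longrightarrow>
        pi * Im (f z) \<le> (\<integral>t. poisson z t * cutoff R t \<partial>\<mu>) + B * Im z)"

text \<open>The estimates for \<open>f(z + i e)\<close> pass to the limit along the subsequence.\<close>

lemma poisson_estimates_vague_limit:
  assumes f: "pick f"
  obtains \<mu> where "locally_finite \<mu>"
    "poisson_estimates f \<mu>"
proof -
  obtain s :: "nat \<Rightarrow> nat" and \<mu> where s: "strict_mono s" and \<mu>: "locally_finite \<mu>"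
    and lim: "\<And>S \<phi>. supported S \<phi> \<Longrightarrow>
      (\<lambda>n. \<integral>t. \<phi> t * Im (f (Complex t (1 / (1 + real (s n))))) \<partial>lborel) \<longlonglongrightarrow> (\<integral>t. \<phi> t \<partial>\<mu>)"
    by (rule vague_limit_subsequence[OF f]) blast
  define e where "e = (\<lambda>n. 1 / (1 + real (s n)))"
  have e: "e n > 0" "e n \<le> 1" for n by (auto simp: e_def)
  have e_lim: "e \<longlonglongrightarrow> 0"
  proof -
    have "(\<lambda>n. 1 / (1 + real n)) \<longlonglongrightarrow> 0"
      using LIMSEQ_inverse_real_of_nat by (simp add: inverse_eq_divide)
    from LIMSEQ_subseq_LIMSEQ[OF this s] show ?thesis by (simp add: e_def o_def)
  qed
  have lim_P: "(\<lambda>n. \<integral>t. poisson z t * (cutoff R t * Im (f (Complex t (e n)))) \<partial>lborel)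
      \<longlonglongrightarrow> (\<integral>t. poisson z t * cutoff R t \<partial>\<mu>)" if z: "Im z > 0" for R z
    using lim[OF supported_mult[OF supported_cutoff[of R] continuous_on_poisson[of z]]] z
    by (simp add: e_def mult.assoc)
  have lim_f: "(\<lambda>n. pi * Im (f (z + \<i> * of_real (e n)))) \<longlonglongrightarrow> pi * Im (f z)" if z: "Im z > 0" for z
  proof -
    have "(\<lambda>n. z + \<i> * of_real (e n)) \<longlonglongrightarrow> z + \<i> * of_real 0"
      by (intro tendsto_intros e_lim)
    then have "(\<lambda>n. z + \<i> * of_real (e n)) \<longlonglongrightarrow> z" by simp
    moreover have "isCont f z" using pick_has_derivative[OF f z] DERIV_isCont by blast
    ultimately have "(\<lambda>n. f (z + \<i> * of_real (e n))) \<longlonglongrightarrow> f z"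
      by (rule isCont_tendsto_compose[rotated])
    then show ?thesis by (intro tendsto_intros)
  qed
  have lower: "(\<integral>t. poisson z t * cutoff R t \<partial>\<mu>) \<le> pi * Im (f z)" if R: "R > 0" and z: "Im z > 0" for R z
  proof (rule LIMSEQ_le[OF lim_P[OF z] lim_f[OF z]], intro exI[of _ 0] allI impI)
    fix n
    show "(\<integral>t. poisson z t * (cutoff R t * Im (f (Complex t (e n)))) \<partial>lborel) \<le> pi * Im (f (z + \<i> * of_real (e n)))"
    proof (rule poisson_minorant_shift[OF f e(1) _ _ _ z])
      show "supported (R + 1) (\<lambda>t. cutoff R t * Im (f (Complex t (e n))))"
        by (rule supported_cutoff_mult[OF continuous_on_Im_horizontal[OF f e(1)]])
      show "cutoff R t * Im (f (Complex t (e n))) \<le> Im (f (Complex t (e n)))" for t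
        using mult_right_mono[OF cutoff_le_1, of "Im (f (Complex t (e n)))" R t]
          pick_Im_nonneg[OF f, of "Complex t (e n)"] e[of n] by simp
    qed (use R in simp)
  qed
  have upper: "\<exists>B\<ge>0. \<forall>z. Im z > 0 \<and> norm z \<le> R / 2 \<longrightarrow>
        pi * Im (f z) \<le> (\<integral>t. poisson z t * cutoff R t \<partial>\<mu>) + B * Im z" if R: "R > 0" for R
  proof -
    obtain B where B: "B \<ge> 0" "\<And>e z. 0 < e \<Longrightarrow> e \<le> 1 \<Longrightarrow> Im z > 0 \<Longrightarrow> norm z \<le> R / 2 \<Longrightarrow>
        pi * Im (f (z + \<i> * of_real e)) \<le>
      (\<integral>t. poisson z t * (cutoff R t * Im (f (Complex t e))) \<partial>lborel) + B * Im z"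
      using poisson_estimates_shift[OF f R] by blast
    show ?thesis
    proof (intro exI[of _ B] conjI allI impI B(1))
      fix z assume z: "Im z > 0 \<and> norm z \<le> R / 2"
      then have z0: "Im z > 0" by simp
      show "pi * Im (f z) \<le> (\<integral>t. poisson z t * cutoff R t \<partial>\<mu>) + B * Im z"
        by (rule LIMSEQ_le[OF lim_f[OF z0] tendsto_add[OF lim_P[OF z0] tendsto_const]])
           (use B(2) e z in blast)
    qed
  qed
  show thesis by (rule that[OF \<mu>]) (use lower upper in \<open>simp add: poisson_estimates_def\<close>)
qed

lemma poisson_commute: "poisson (Complex x y) t = poisson (Complex t y) x"
  by (simp add: poisson_def power2_commute)

text \<open>
  The Poisson kernel is symmetric in \<open>x\<close> and \<open>t\<close>, so by Fubini's theorem testing a Poisson integral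
  of a measure against \<open>h\<close> amounts to integrating the Poisson integral of \<open>h\<close>.
\<close>

lemma poisson_integral_duality:
  assumes \<mu>: "locally_finite \<mu>" and h: "supported S h" and y: "y > 0"
  shows "(\<integral>x. h x * (\<integral>t. poisson (Complex x y) t * cutoff R t \<partial>\<mu>) \<partial>lborel) =
    (\<integral>t. cutoff R t * (\<integral>x. poisson (Complex t y) x * h x \<partial>lborel) \<partial>\<mu>)"
    "integrable lborel (\<lambda>x. h x * (\<integral>t. poisson (Complex x y) t * cutoff R t \<partial>\<mu>))"
proof -
  have sets_mu [measurable_cong]: "sets \<mu> = sets borel" using \<mu> by (rule locally_finite_sets)
  have [measurable]: "h \<in> borel_measurable borel" using h by (rule supported_measurable)
  have [measurable]: "cutoff R \<in> borel_measurable borel"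
    by (rule supported_measurable[OF supported_cutoff])
  define \<kappa> where "\<kappa> = density \<mu> (\<lambda>t. ennreal (cutoff R t))"
  have sets_k [measurable_cong]: "sets \<kappa> = sets borel" by (simp add: \<kappa>_def sets_mu)
  have int_k: "(\<integral>t. g t \<partial>\<kappa>) = (\<integral>t. cutoff R t * g t \<partial>\<mu>)" if "g \<in> borel_measurable borel" for g
    unfolding \<kappa>_def using that cutoff_nonneg by (intro integral_real_density) auto
  have fin: "finite_measure \<kappa>"
  proof (rule finite_measureI)
    have "emeasure \<kappa> (space \<kappa>) = (\<integral>\<^sup>+t. ennreal (cutoff R t) \<partial>\<mu>)"
      unfolding \<kappa>_def by (subst emeasure_density) (auto intro!: nn_integral_cong)
    also have "\<dots> = ennreal (\<integral>t. cutoff R t \<partial>\<mu>)"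
      by (intro nn_integral_eq_integral integrable_supported[OF \<mu> supported_cutoff] AE_I2 cutoff_nonneg)
    finally show "emeasure \<kappa> (space \<kappa>) \<noteq> \<infinity>" by simp
  qed
  interpret K: finite_measure \<kappa> by (rule fin)
  interpret P: pair_sigma_finite lborel \<kappa> ..
  obtain M where M: "M > 0" "\<And>t. \<bar>h t\<bar> \<le> M"
    using supported_bounded[OF h] by blast
  define G where "G = (\<lambda>x t. h x * poisson (Complex x y) t)"
  have "integrable (lborel \<Otimes>\<^sub>M \<kappa>) (\<lambda>p. (M / y) * indicator ({-S..S} \<times> UNIV) p)"
  proof (intro integrable_mult_right integrable_real_indicator)
    have "space \<kappa> = UNIV" using sets_eq_imp_space_eq[OF sets_k] by simp
    then have UN: "UNIV \<in> sets \<kappa>" using sets.top[of \<kappa>] by simp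
    show "{-S..S} \<times> UNIV \<in> sets (lborel \<Otimes>\<^sub>M \<kappa>)" using UN by (intro pair_measureI) auto
    have "emeasure (lborel \<Otimes>\<^sub>M \<kappa>) ({-S..S} \<times> UNIV) = emeasure lborel {-S..S} * emeasure \<kappa> UNIV"
      using UN by (intro K.emeasure_pair_measure_Times) auto
    also have "\<dots> < \<infinity>"
      using K.emeasure_finite[of UNIV] by (auto simp: ennreal_mult_less_top emeasure_lborel_Icc_eq less_top[symmetric] ennreal_mult_eq_top_iff)
    finally show "emeasure (lborel \<Otimes>\<^sub>M \<kappa>) ({-S..S} \<times> UNIV) < \<infinity>" .
  qed
  then have int: "integrable (lborel \<Otimes>\<^sub>M \<kappa>) (case_prod G)"
  proof (rule Bochner_Integration.integrable_bound)
    show "case_prod G \<in> borel_measurable (lborel \<Otimes>\<^sub>M \<kappa>)"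
      unfolding G_def poisson_def by simp measurable
    show "AE p in lborel \<Otimes>\<^sub>M \<kappa>. norm (case_prod G p) \<le> norm ((M / y) * indicator ({-S..S} \<times> UNIV) p)"
    proof (rule AE_I2)
      fix p :: "real \<times> real"
      obtain x t where p: "p = (x, t)" by (cases p)
      have "\<bar>h x\<bar> * \<bar>poisson (Complex x y) t\<bar> \<le> M * (1 / y)"
        using M y poisson_le[of "Complex x y" t] poisson_nonneg[of "Complex x y" t]
        by (intro mult_mono) auto
      then show "norm (case_prod G p) \<le> norm ((M / y) * indicator ({-S..S} \<times> UNIV) p)"
        using supportedD(2)[OF h, of x] y M(1) unfolding p
        by (cases "\<bar>x\<bar> \<le> S") (auto simp: abs_le_iff G_def abs_mult)
    qed
  qed
  have inner: "(\<integral>t. poisson (Complex x y) t * cutoff R t \<partial>\<mu>) = (\<integral>t. poisson (Complex x y) t \<partial>\<kappa>)" for x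
    using int_k[of "poisson (Complex x y)"] by (simp add: mult.commute)
  show "(\<integral>x. h x * (\<integral>t. poisson (Complex x y) t * cutoff R t \<partial>\<mu>) \<partial>lborel) =
    (\<integral>t. cutoff R t * (\<integral>x. poisson (Complex t y) x * h x \<partial>lborel) \<partial>\<mu>)"
  proof -
    have meas: "(\<lambda>t. \<integral>x. poisson (Complex t y) x * h x \<partial>lborel) \<in> borel_measurable borel"
      unfolding poisson_def by simp
    have "(\<integral>x. h x * (\<integral>t. poisson (Complex x y) t * cutoff R t \<partial>\<mu>) \<partial>lborel) =
        (\<integral>x. (\<integral>t. G x t \<partial>\<kappa>) \<partial>lborel)"
      by (simp add: inner G_def)
    also have "\<dots> = (\<integral>t. (\<integral>x. G x t \<partial>lborel) \<partial>\<kappa>)"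
      by (rule P.Fubini_integral[OF int, symmetric])
    also have "\<dots> = (\<integral>t. (\<integral>x. poisson (Complex t y) x * h x \<partial>lborel) \<partial>\<kappa>)"
      by (simp add: G_def poisson_commute mult.commute)
    also have "\<dots> = (\<integral>t. cutoff R t * (\<integral>x. poisson (Complex t y) x * h x \<partial>lborel) \<partial>\<mu>)"
      by (rule int_k[OF meas])
    finally show ?thesis .
  qed
  have "integrable lborel (\<lambda>x. \<integral>t. G x t \<partial>\<kappa>)"
    using P.integrable_fst[OF int] .
  then show "integrable lborel (\<lambda>x. h x * (\<integral>t. poisson (Complex x y) t * cutoff R t \<partial>\<mu>))"
    by (simp add: inner G_def)
qed

text \<open>The measure \<open>Im f(x + i y) dx\<close> on the line, whose weak limit is the Nevanlinna measure.\<close>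

abbreviation slice_measure :: "(complex \<Rightarrow> complex) \<Rightarrow> real \<Rightarrow> real measure" where
  "slice_measure f y \<equiv> density lborel (\<lambda>x. ennreal (Im (f (Complex x y))))"

text \<open>
  The two-sided Poisson estimate alone forces the full weak convergence: up to \<open>O(y)\<close>, the function
  \<open>\<pi> Im f(x + i y)\<close> is locally the Poisson integral of \<open>\<mu>\<close>.
\<close>

lemma weak_limit_of_poisson_estimates:
  assumes f: "pick f" and \<mu>: "locally_finite \<mu>"
    and est: "poisson_estimates f \<mu>"
  shows "weak_limit (slice_measure f) \<mu> (at_right 0)"
  unfolding weak_limit_def
proof (intro allI impI)
  fix h :: "real \<Rightarrow> real" assume h: "continuous_on UNIV h \<and> bounded {x. h x \<noteq> 0}"
  then obtain S where S: "S > 0" "\<And>x. h x \<noteq> 0 \<Longrightarrow> \<bar>x\<bar> \<le> S"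
    unfolding bounded_pos by auto
  then have hS: "supported S h"
    using h unfolding supported_def by fastforce
  have [measurable]: "h \<in> borel_measurable borel" using hS by (rule supported_measurable)
  have sets_mu [measurable_cong]: "sets \<mu> = sets borel" using \<mu> by (rule locally_finite_sets)
  obtain M where M: "M > 0" "\<And>t. \<bar>h t\<bar> \<le> M"
    using supported_bounded[OF hS] by blast
  define R where "R = 2 * (S + 1)"
  have R: "R > 0" using S by (simp add: R_def)
  obtain B where B: "B \<ge> 0" "\<And>z. Im z > 0 \<Longrightarrow> norm z \<le> R / 2 \<Longrightarrow>
        pi * Im (f z) \<le> (\<integral>t. poisson z t * cutoff R t \<partial>\<mu>) + B * Im z"
    using est R unfolding poisson_estimates_def by blast
  define P where "P = (\<lambda>y x. \<integral>t. poisson (Complex x y) t * cutoff R t \<partial>\<mu>)"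
  have int_h: "integrable lborel (\<lambda>x. \<bar>h x\<bar>)"
    using supported_integral(1)[OF hS] by simp
  have diff: "\<bar>pi * (\<integral>x. h x \<partial>slice_measure f y) -
      (\<integral>x. h x * P y x \<partial>lborel)\<bar> \<le> B * y * (\<integral>x. \<bar>h x\<bar> \<partial>lborel)"
    if y: "0 < y" "y < 1" for y
  proof -
    define u where "u = (\<lambda>x. Im (f (Complex x y)))"
    have contu: "continuous_on UNIV u" unfolding u_def by (rule continuous_on_Im_horizontal[OF f y(1)])
    have [measurable]: "u \<in> borel_measurable borel" by (rule borel_measurable_continuous_onI[OF contu])
    have u0: "u x \<ge> 0" for x unfolding u_def using y by (intro pick_Im_nonneg[OF f]) simp
    have int1: "integrable lborel (\<lambda>x. pi * (u x * h x))"
      by (intro integrable_mult_right supported_integral(1)[OF supported_mult[OF hS contu]])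
    have int2: "integrable lborel (\<lambda>x. h x * P y x)"
      unfolding P_def by (rule poisson_integral_duality(2)[OF \<mu> hS y(1)])
    have "pi * (\<integral>x. h x \<partial>density lborel (\<lambda>x. ennreal (u x))) = (\<integral>x. pi * (u x * h x) \<partial>lborel)"
    proof -
      have "(\<integral>x. h x \<partial>density lborel (\<lambda>x. ennreal (u x))) = (\<integral>x. u x * h x \<partial>lborel)"
        by (intro integral_real_density AE_I2) (auto simp: u0)
      then show ?thesis by simp
    qed
    then have "pi * (\<integral>x. h x \<partial>density lborel (\<lambda>x. ennreal (u x))) - (\<integral>x. h x * P y x \<partial>lborel) =
        (\<integral>x. pi * (u x * h x) - h x * P y x \<partial>lborel)"
      using int1 int2 by simp
    also have "norm \<dots> \<le> (\<integral>x. (B * y) * \<bar>h x\<bar> \<partial>lborel)"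
    proof (rule Bochner_Integration.integral_norm_bound_integral)
      show "integrable lborel (\<lambda>x. pi * (u x * h x) - h x * P y x)" using int1 int2 by simp
      show "integrable lborel (\<lambda>x. (B * y) * \<bar>h x\<bar>)" using int_h by simp
      show "norm (pi * (u x * h x) - h x * P y x) \<le> (B * y) * \<bar>h x\<bar>" for x
      proof (cases "\<bar>x\<bar> \<le> S")
        case True
        have "norm (Complex x y) \<le> \<bar>x\<bar> + \<bar>y\<bar>" using cmod_le[of "Complex x y"] by simp
        then have "norm (Complex x y) \<le> R / 2" using True y by (simp add: R_def)
        then have "pi * u x \<le> P y x + B * y" "P y x \<le> pi * u x"
          using B(2)[of "Complex x y"] est R y by (auto simp: P_def u_def poisson_estimates_def)
        then have "\<bar>pi * u x - P y x\<bar> \<le> B * y" by simp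
        then have "\<bar>h x\<bar> * \<bar>pi * u x - P y x\<bar> \<le> \<bar>h x\<bar> * (B * y)" by (intro mult_left_mono) auto
        moreover have "pi * (u x * h x) - h x * P y x = h x * (pi * u x - P y x)" by (simp add: algebra_simps)
        ultimately show ?thesis by (simp add: abs_mult mult_ac)
      next
        case False
        then have "h x = 0" using S(2)[of x] by auto
        then show ?thesis by simp
      qed
    qed
    finally show ?thesis by (simp add: u_def)
  qed
  have dual: "(\<integral>x. h x * P y x \<partial>lborel) = (\<integral>t. cutoff R t * (\<integral>x. poisson (Complex t y) x * h x \<partial>lborel) \<partial>\<mu>)"
    if "y > 0" for y
    unfolding P_def by (rule poisson_integral_duality(1)[OF \<mu> hS that])
  have lim_P: "((\<lambda>y. \<integral>x. h x * P y x \<partial>lborel) \<longlongrightarrow> pi * (\<integral>x. h x \<partial>\<mu>)) (at_right 0)"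
    unfolding tendsto_at_iff_sequentially
  proof (intro allI impI)
    fix Y :: "nat \<Rightarrow> real" assume Y: "\<forall>i. Y i \<in> {0<..} - {0}" "Y \<longlonglongrightarrow> 0"
    then have Ypos: "Y n > 0" for n by auto
    have meas: "(\<lambda>t. \<integral>x. poisson (Complex t y) x * h x \<partial>lborel) \<in> borel_measurable borel" for y
      unfolding poisson_def by simp
    have [measurable]: "cutoff R \<in> borel_measurable borel"
      by (rule supported_measurable[OF supported_cutoff])
    have "(\<lambda>n. \<integral>t. cutoff R t * (\<integral>x. poisson (Complex t (Y n)) x * h x \<partial>lborel) \<partial>\<mu>)
        \<longlonglongrightarrow> (\<integral>t. cutoff R t * (pi * h t) \<partial>\<mu>)"
    proof (rule integral_dominated_convergence)
      show "integrable \<mu> (\<lambda>t. (pi * M) * cutoff R t)"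
        by (intro integrable_mult_right integrable_supported[OF \<mu> supported_cutoff])
      show "(\<lambda>t. cutoff R t * (pi * h t)) \<in> borel_measurable \<mu>" by measurable
      show "(\<lambda>t. cutoff R t * (\<integral>x. poisson (Complex t (Y n)) x * h x \<partial>lborel)) \<in> borel_measurable \<mu>" for n
        using meas[of "Y n"] by measurable
      show "AE t in \<mu>. norm (cutoff R t * (\<integral>x. poisson (Complex t (Y n)) x * h x \<partial>lborel)) \<le> (pi * M) * cutoff R t" for n
      proof (rule AE_I2)
        fix t
        have "\<bar>\<integral>x. poisson (Complex t (Y n)) x * h x \<partial>lborel\<bar> \<le> pi * M"
          using Ypos by (intro poisson_integral_abs_le[OF hS M(2)]) simp
        then have "cutoff R t * \<bar>\<integral>x. poisson (Complex t (Y n)) x * h x \<partial>lborel\<bar> \<le> cutoff R t * (pi * M)"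
          by (intro mult_left_mono cutoff_nonneg)
        then show "norm (cutoff R t * (\<integral>x. poisson (Complex t (Y n)) x * h x \<partial>lborel)) \<le> (pi * M) * cutoff R t"
          by (simp add: abs_mult cutoff_nonneg mult.commute)
      qed
      show "AE t in \<mu>. (\<lambda>n. cutoff R t * (\<integral>x. poisson (Complex t (Y n)) x * h x \<partial>lborel))
          \<longlonglongrightarrow> cutoff R t * (pi * h t)"
      proof (intro AE_I2 tendsto_mult tendsto_const)
        fix t
        have "filterlim (\<lambda>n. Complex t (Y n)) (at (of_real t) within {z. Im z > 0}) sequentially"
          unfolding filterlim_at
        proof (intro conjI)
          have "(\<lambda>n. Complex t (Y n)) \<longlonglongrightarrow> Complex t 0"
            using Y(2) by (intro tendsto_intros)
          then show "(\<lambda>n. Complex t (Y n)) \<longlonglongrightarrow> of_real t" by (simp add: complex_of_real_def)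
          show "\<forall>\<^sub>F n in sequentially. Complex t (Y n) \<in> {z. Im z > 0} \<and> Complex t (Y n) \<noteq> of_real t"
            using Ypos by (intro always_eventually) (auto simp: complex_eq_iff less_imp_neq[symmetric])
        qed
        from filterlim_compose[OF poisson_integral_boundary[OF hS, of t] this]
        show "(\<lambda>n. \<integral>x. poisson (Complex t (Y n)) x * h x \<partial>lborel) \<longlonglongrightarrow> pi * h t" .
      qed
    qed
    also have "(\<lambda>t. cutoff R t * (pi * h t)) = (\<lambda>t. pi * h t)"
    proof
      fix t show "cutoff R t * (pi * h t) = pi * h t"
        using S(1) S(2)[of t] cutoff_eq_1[of t R] by (cases "h t = 0") (auto simp: R_def)
    qed
    finally show "((\<lambda>y. \<integral>x. h x * P y x \<partial>lborel) \<circ> Y) \<longlonglongrightarrow> pi * (\<integral>x. h x \<partial>\<mu>)"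
      by (simp add: o_def dual[OF Ypos])
  qed
  have small: "((\<lambda>y. B * y * (\<integral>x. \<bar>h x\<bar> \<partial>lborel)) \<longlongrightarrow> 0) (at_right 0)"
    by (auto intro!: tendsto_eq_intros)
  have "((\<lambda>y. pi * (\<integral>x. h x \<partial>slice_measure f y) -
      (\<integral>x. h x * P y x \<partial>lborel)) \<longlongrightarrow> 0) (at_right 0)"
  proof (rule Lim_null_comparison[OF _ small])
    show "\<forall>\<^sub>F y in at_right 0. norm (pi * (\<integral>x. h x \<partial>slice_measure f y) -
        (\<integral>x. h x * P y x \<partial>lborel)) \<le> B * y * (\<integral>x. \<bar>h x\<bar> \<partial>lborel)"
      using eventually_at_right_real[of 0 1] by (rule eventually_mono) (use diff in auto)
  qed
  from tendsto_add[OF this lim_P]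
  have "((\<lambda>y. pi * (\<integral>x. h x \<partial>slice_measure f y)) \<longlongrightarrow> pi * (\<integral>x. h x \<partial>\<mu>)) (at_right 0)"
    by simp
  from tendsto_mult[OF tendsto_const[of "1 / pi"] this]
  show "((\<lambda>y. \<integral>x. h x \<partial>slice_measure f y) \<longlongrightarrow> (\<integral>x. h x \<partial>\<mu>)) (at_right 0)"
    by simp
qed

text \<open>
  The definite description in the definition of the Nevanlinna measure denotes the limit measure
  found above: weak limits are unique among locally finite measures.
\<close>

lemma nevanlinna_measure_poisson:
  assumes f: "pick f"
  shows "locally_finite (nevanlinna_measure f)" "poisson_estimates f (nevanlinna_measure f)"
proof -
  obtain \<mu> where \<mu>: "locally_finite \<mu>" "poisson_estimates f \<mu>"
    by (rule poisson_estimates_vague_limit[OF f])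
  have wl: "weak_limit (slice_measure f) \<mu> (at_right 0)"
    by (rule weak_limit_of_poisson_estimates[OF f \<mu>])
  have "nevanlinna_measure f = \<mu>"
    unfolding nevanlinna_measure_def
  proof (rule the_equality)
    show "sets \<mu> = sets borel \<and> (\<forall>K. compact K \<longrightarrow> emeasure \<mu> K < \<infinity>) \<and>
        weak_limit (slice_measure f) \<mu> (at_right 0)"
      using \<mu>(1) wl by (simp add: locally_finite_def)
    fix \<nu> assume \<nu>: "sets \<nu> = sets borel \<and> (\<forall>K. compact K \<longrightarrow> emeasure \<nu> K < \<infinity>) \<and>
        weak_limit (slice_measure f) \<nu> (at_right 0)"
    show "\<nu> = \<mu>"
    proof (rule locally_finite_eqI)
      show "locally_finite \<nu>" using \<nu> by (simp add: locally_finite_def)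
      fix S \<phi> assume \<phi>: "supported S \<phi>"
      have "bounded {x. \<phi> x \<noteq> 0}"
        using supportedD(2)[OF \<phi>] by (intro boundedI[of _ S]) (auto simp: not_less[symmetric])
      then have "continuous_on UNIV \<phi> \<and> bounded {x. \<phi> x \<noteq> 0}"
        using \<phi> by (simp add: supported_def)
      then have "((\<lambda>y. \<integral>x. \<phi> x \<partial>slice_measure f y) \<longlongrightarrow> (\<integral>x. \<phi> x \<partial>\<nu>)) (at_right 0)"
        "((\<lambda>y. \<integral>x. \<phi> x \<partial>slice_measure f y) \<longlongrightarrow> (\<integral>x. \<phi> x \<partial>\<mu>)) (at_right 0)"
        using \<nu> wl unfolding weak_limit_def by blast+
      then show "(\<integral>x. \<phi> x \<partial>\<nu>) = (\<integral>x. \<phi> x \<partial>\<mu>)"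
        by (rule tendsto_unique[rotated]) simp
    qed (rule \<mu>(1))
  qed
  with \<mu> show "locally_finite (nevanlinna_measure f)" "poisson_estimates f (nevanlinna_measure f)"
    by simp_all
qed

text \<open>The same estimates as inequalities between extended nonnegative integrals.\<close>

lemma nn_integral_poisson_cutoff:
  assumes \<mu>: "locally_finite \<mu>" and z: "Im z > 0"
  shows "(\<integral>\<^sup>+t. ennreal (poisson z t * cutoff R t) \<partial>\<mu>) = ennreal (\<integral>t. poisson z t * cutoff R t \<partial>\<mu>)"
proof -
  have "supported (R + 1) (\<lambda>t. poisson z t * cutoff R t)"
    using z by (intro supported_mult supported_cutoff continuous_on_poisson) simp
  then show ?thesis
    using z by (intro nn_integral_eq_integral integrable_supported[OF \<mu>] AE_I2 mult_nonneg_nonneg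
      poisson_nonneg cutoff_nonneg)
qed

lemma nevanlinna_measure_lower_bound:
  assumes f: "pick f" and R: "R > 0" and z: "Im z > 0"
  shows "(\<integral>\<^sup>+t\<in>{-R..R}. ennreal (poisson z t) \<partial>nevanlinna_measure f) \<le> ennreal (pi * Im (f z))"
proof -
  have "(\<integral>\<^sup>+t\<in>{-R..R}. ennreal (poisson z t) \<partial>nevanlinna_measure f) \<le>
      (\<integral>\<^sup>+t. ennreal (poisson z t * cutoff R t) \<partial>nevanlinna_measure f)"
  proof (rule nn_integral_mono)
    fix t show "ennreal (poisson z t) * indicator {-R..R} t \<le> ennreal (poisson z t * cutoff R t)"
      by (cases "t \<in> {-R..R}") (auto simp: cutoff_eq_1)
  qed
  also have "\<dots> \<le> ennreal (pi * Im (f z))"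
    unfolding nn_integral_poisson_cutoff[OF nevanlinna_measure_poisson(1)[OF f] z]
    using nevanlinna_measure_poisson(2)[OF f] R z by (intro ennreal_leI) (simp add: poisson_estimates_def)
  finally show ?thesis .
qed

lemma nevanlinna_measure_upper_bound:
  assumes f: "pick f" and R: "R > 0"
  shows "\<exists>B\<ge>0. \<forall>z. Im z > 0 \<and> norm z \<le> R / 2 \<longrightarrow> ennreal (pi * Im (f z)) \<le>
    (\<integral>\<^sup>+t\<in>{-R-1..R+1}. ennreal (poisson z t) \<partial>nevanlinna_measure f) + ennreal (B * Im z)"
proof -
  obtain B where B: "B \<ge> 0" "\<And>z. Im z > 0 \<Longrightarrow> norm z \<le> R / 2 \<Longrightarrow>
        pi * Im (f z) \<le> (\<integral>t. poisson z t * cutoff R t \<partial>nevanlinna_measure f) + B * Im z"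
    using nevanlinna_measure_poisson(2)[OF f] R unfolding poisson_estimates_def by blast
  show ?thesis
  proof (intro exI[of _ B] conjI allI impI B(1))
    fix z assume z: "Im z > 0 \<and> norm z \<le> R / 2"
    have "ennreal (pi * Im (f z)) \<le>
        ennreal ((\<integral>t. poisson z t * cutoff R t \<partial>nevanlinna_measure f) + B * Im z)"
      using B(2) z by (intro ennreal_leI) auto
    also have "\<dots> = (\<integral>\<^sup>+t. ennreal (poisson z t * cutoff R t) \<partial>nevanlinna_measure f) + ennreal (B * Im z)"
      using z B(1) unfolding nn_integral_poisson_cutoff[OF nevanlinna_measure_poisson(1)[OF f] conjunct1[OF z]]
      by (intro ennreal_plus Bochner_Integration.integral_nonneg mult_nonneg_nonneg poisson_nonneg cutoff_nonneg) auto
    also have "(\<integral>\<^sup>+t. ennreal (poisson z t * cutoff R t) \<partial>nevanlinna_measure f) \<le>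
        (\<integral>\<^sup>+t\<in>{-R-1..R+1}. ennreal (poisson z t) \<partial>nevanlinna_measure f)"
    proof (rule nn_integral_mono)
      fix t show "ennreal (poisson z t * cutoff R t) \<le> ennreal (poisson z t) * indicator {-R-1..R+1} t"
      proof (cases "\<bar>t\<bar> \<le> R + 1")
        case True
        have "poisson z t * cutoff R t \<le> poisson z t * 1"
          using z by (intro mult_left_mono cutoff_le_1 poisson_nonneg) auto
        then show ?thesis using True by (auto simp: indicator_def abs_le_iff intro!: ennreal_leI)
      qed (simp add: cutoff_eq_0)
    qed
    finally show "ennreal (pi * Im (f z)) \<le>
        (\<integral>\<^sup>+t\<in>{-R-1..R+1}. ennreal (poisson z t) \<partial>nevanlinna_measure f) + ennreal (B * Im z)"
      by (simp add: add_right_mono)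
  qed
qed

section \<open>Mass on dyadic annuli\<close>

text \<open>The dyadic annulus \<open>2\<^sup>-\<^sup>k / 2 < \<bar>t - \<tau>\<bar> \<le> 2\<^sup>-\<^sup>k\<close> around \<open>\<tau>\<close> on the line.\<close>

definition annulus :: "real \<Rightarrow> nat \<Rightarrow> real set" where
  "annulus \<tau> k = {t. (1/2)^k / 2 < \<bar>t - \<tau>\<bar> \<and> \<bar>t - \<tau>\<bar> \<le> (1/2)^k}"

lemma annulus_measurable [measurable]: "annulus \<tau> k \<in> sets borel"
  unfolding annulus_def by measurable

lemma disjoint_family_annulus: "disjoint_family (annulus \<tau>)"
proof -
  have "annulus \<tau> i \<inter> annulus \<tau> j = {}" if "i < j" for i j
  proof -
    have "(1/2::real)^j \<le> (1/2)^(Suc i)" using that by (intro power_decreasing) auto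
    then show ?thesis by (auto simp: annulus_def)
  qed
  then show ?thesis unfolding disjoint_family_on_def
    by (metis Int_commute linorder_neqE_nat)
qed

lemma disjoint_family_annulus_offset: "disjoint_family (\<lambda>k. annulus \<tau> (k + j))"
  using disjoint_family_annulus[of \<tau>] unfolding disjoint_family_on_def by auto

lemma annulus_covers:
  assumes "t \<noteq> \<tau>" "\<bar>t - \<tau>\<bar> \<le> (1/2)^j"
  obtains k where "t \<in> annulus \<tau> (k + j)"
proof -
  obtain n where n: "(1/2::real)^n < \<bar>t - \<tau>\<bar>"
    using real_arch_pow_inv[of "\<bar>t - \<tau>\<bar>" "1/2"] assms(1) by auto
  define m where "m = (LEAST n. (1/2::real)^n < \<bar>t - \<tau>\<bar>)"
  have m: "(1/2::real)^m < \<bar>t - \<tau>\<bar>" unfolding m_def by (rule LeastI[of _ n]) (rule n)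
  have jm: "j < m"
  proof (rule ccontr)
    assume "\<not> j < m"
    then have "(1/2::real)^j \<le> (1/2)^m" by (intro power_decreasing) auto
    then show False using m assms(2) by linarith
  qed
  then have "\<not> (1/2::real)^(m - 1) < \<bar>t - \<tau>\<bar>"
    unfolding m_def by (intro not_less_Least) (use jm m_def in auto)
  moreover have "m = Suc (m - 1)" using jm by simp
  moreover from this have "(1/2::real)^m = (1/2)^(m - 1) / 2" by (metis power_Suc mult.commute times_divide_eq_right mult.right_neutral)
  ultimately have "t \<in> annulus \<tau> (m - 1)" using m by (simp add: annulus_def)
  moreover have "m - 1 = (m - 1 - j) + j" using jm by simp
  ultimately show thesis using that by metis
qed

lemma annulus_subset: "annulus \<tau> k \<subseteq> {\<tau> - (1/2)^k .. \<tau> + (1/2)^k}"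
  by (auto simp: annulus_def abs_le_iff)

lemma emeasure_annulus_le: "emeasure lborel (annulus \<tau> k) \<le> ennreal (2 * (1/2)^k)"
proof -
  have "emeasure lborel (annulus \<tau> k) \<le> emeasure lborel {\<tau> - (1/2)^k .. \<tau> + (1/2)^k}"
    by (intro emeasure_mono annulus_subset) simp
  then show ?thesis by simp
qed

lemma half_power_le_1: "(1/2::real)^k \<le> 1"
  by (rule power_le_one) auto

lemma nn_integral_poisson:
  assumes y: "y > 0"
  shows "(\<integral>\<^sup>+x. ennreal (poisson (Complex x y) t) \<partial>lborel) = ennreal pi"
proof -
  have eq: "(\<integral>x. poisson (Complex x y) t \<partial>lborel) = pi"
    using poisson_integral_substitute[of "Complex t y" "\<lambda>_. 1"] y integrable_inverse_1_plus_square_UNIV(2)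
    by (simp add: poisson_commute[of _ y t])
  have "integrable lborel (\<lambda>x. poisson (Complex x y) t)"
    using not_integrable_integral_eq[of lborel "\<lambda>x. poisson (Complex x y) t"] eq by fastforce
  then show ?thesis
    using y eq by (subst nn_integral_eq_integral) (auto intro!: poisson_nonneg)
qed

lemma poisson_far:
  assumes "\<bar>t - \<tau>\<bar> / 2 \<le> \<bar>x - t\<bar>" "t \<noteq> \<tau>" "y > 0"
  shows "poisson (Complex x y) t \<le> 4 * y * (1 / (t - \<tau>)\<^sup>2)"
proof -
  have "(\<bar>t - \<tau>\<bar> / 2)\<^sup>2 \<le> (\<bar>x - t\<bar>)\<^sup>2" using assms(1) by (intro power_mono) auto
  then have le: "(t - \<tau>)\<^sup>2 / 4 \<le> (x - t)\<^sup>2 + y\<^sup>2" by (simp add: power_divide) (smt (verit) zero_le_power2)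
  have "poisson (Complex x y) t \<le> y / ((t - \<tau>)\<^sup>2 / 4)"
    unfolding poisson_def complex.sel
    by (rule divide_left_mono) (use le assms in \<open>auto intro!: mult_pos_pos add_nonneg_pos\<close>)
  then show ?thesis by (simp add: mult.commute)
qed

lemma annulus_far:
  assumes x: "x \<in> annulus \<tau> k" and t: "\<bar>t - \<tau>\<bar> \<le> (1/2)^k / 4 \<or> 2 * (1/2)^k < \<bar>t - \<tau>\<bar>"
  shows "\<bar>t - \<tau>\<bar> / 2 \<le> \<bar>x - t\<bar>"
proof -
  define a b c r where "a = \<bar>x - \<tau>\<bar>" and "b = \<bar>t - \<tau>\<bar>" and "c = \<bar>x - t\<bar>" and "r = (1/2::real)^k"
  have "r / 2 < a" "a \<le> r" using x by (auto simp: annulus_def a_def r_def)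
  moreover have "b \<le> r / 4 \<or> 2 * r < b" using t by (simp add: b_def r_def)
  moreover have "a \<le> c + b" unfolding a_def b_def c_def by linarith
  moreover have "b \<le> c + a" unfolding a_def b_def c_def by linarith
  ultimately have "b / 2 \<le> c" by linarith
  then show ?thesis by (simp add: b_def c_def)
qed

text \<open>
  On one side of \<open>t\<close> there is an interval of length \<open>y\<close> inside the annulus, and the kernel is at least
  \<open>1 / (2 y)\<close> on it.
\<close>

lemma poisson_annulus_mass:
  assumes y: "0 < y" "y \<le> (1/2)^k / 4" and t: "t \<in> annulus \<tau> k"
  shows "ennreal (1/2) \<le> (\<integral>\<^sup>+x\<in>annulus \<tau> k. ennreal (poisson (Complex x y) t) \<partial>lborel)"
proof -
  define r :: real where "r = (1/2)^k"
  have t': "r / 2 < \<bar>t - \<tau>\<bar>" "\<bar>t - \<tau>\<bar> \<le> r" using t by (auto simp: annulus_def r_def)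
  have yr: "y \<le> r / 4" using y by (simp add: r_def)
  have "\<exists>a. {a..a + y} \<subseteq> annulus \<tau> k \<and> {a..a + y} \<subseteq> {t - y..t + y}"
  proof (cases "r / 2 < t - \<tau> \<and> t - \<tau> \<le> 3 * r / 4 \<or> t - \<tau> < - 3 * r / 4")
    case True
    then show ?thesis using t' yr y(1) unfolding annulus_def r_def[symmetric]
      by (intro exI[of _ t]) (auto simp: abs_if split: if_splits)
  next
    case False
    then show ?thesis using t' yr y(1) unfolding annulus_def r_def[symmetric]
      by (intro exI[of _ "t - y"]) (auto simp: abs_if split: if_splits)
  qed
  then obtain a where a: "{a..a + y} \<subseteq> annulus \<tau> k" "{a..a + y} \<subseteq> {t - y..t + y}" by blast
  have "ennreal (1/2) = ennreal (1 / (2 * y)) * ennreal y"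
    using y(1) by (simp add: ennreal_mult[symmetric])
  also have "\<dots> = ennreal (1 / (2 * y)) * emeasure lborel {a..a + y}" using y(1) by simp
  also have "\<dots> = (\<integral>\<^sup>+x. ennreal (1 / (2 * y)) * indicator {a..a + y} x \<partial>lborel)"
    by (rule nn_integral_cmult_indicator[symmetric]) simp
  also have "\<dots> \<le> (\<integral>\<^sup>+x\<in>annulus \<tau> k. ennreal (poisson (Complex x y) t) \<partial>lborel)"
  proof (rule nn_integral_mono)
    fix x
    show "ennreal (1 / (2 * y)) * indicator {a..a + y} x \<le>
        ennreal (poisson (Complex x y) t) * indicator (annulus \<tau> k) x"
    proof (cases "x \<in> {a..a + y}")
      case True
      then have x: "x \<in> annulus \<tau> k" "\<bar>x - t\<bar> \<le> y" using a by (auto simp: abs_le_iff)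
      have "(x - t)\<^sup>2 \<le> y\<^sup>2" using x(2) y(1) by (simp add: abs_le_square_iff[symmetric])
      then have "y / (2 * y\<^sup>2) \<le> poisson (Complex x y) t"
        unfolding poisson_def using y(1)
        by (auto intro!: divide_left_mono mult_pos_pos simp: add_nonneg_pos)
      then have "1 / (2 * y) \<le> poisson (Complex x y) t"
        using y(1) by (simp add: power2_eq_square)
      then show ?thesis using True x(1) by (simp add: ennreal_leI)
    qed simp
  qed
  finally show ?thesis .
qed

lemma locally_finite_sigma_finite:
  assumes "locally_finite \<mu>" shows "sigma_finite_measure \<mu>"
proof
  have sets_mu: "sets \<mu> = sets borel" using assms by (rule locally_finite_sets)
  show "\<exists>A. countable A \<and> A \<subseteq> sets \<mu> \<and> \<Union> A = space \<mu> \<and> (\<forall>a\<in>A. emeasure \<mu> a \<noteq> \<infinity>)"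
  proof (intro exI[of _ "range (\<lambda>n::nat. {- real n..real n})"] conjI ballI)
    show "\<Union> (range (\<lambda>n::nat. {- real n..real n})) = space \<mu>"
      using UN_symmetric_intervals sets_eq_imp_space_eq[OF sets_mu] by simp
    fix a assume "a \<in> range (\<lambda>n::nat. {- real n..real n})"
    then obtain n :: nat where "a = {- real n..real n}" by blast
    then show "emeasure \<mu> a \<noteq> \<infinity>"
      using locally_finite_bounded[OF assms, of a "real n"] by simp
  qed (auto simp: sets_mu)
qed

lemma poisson_Fubini:
  assumes \<mu>: "locally_finite \<mu>" and [measurable]: "A \<in> sets borel" "I \<in> sets borel"
  shows "(\<integral>\<^sup>+x\<in>A. (\<integral>\<^sup>+t\<in>I. ennreal (poisson (Complex x y) t) \<partial>\<mu>) \<partial>lborel) =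
    (\<integral>\<^sup>+t\<in>I. (\<integral>\<^sup>+x\<in>A. ennreal (poisson (Complex x y) t) \<partial>lborel) \<partial>\<mu>)"
proof -
  have sets_mu [measurable_cong]: "sets \<mu> = sets borel" using \<mu> by (rule locally_finite_sets)
  interpret M: sigma_finite_measure \<mu> by (rule locally_finite_sigma_finite[OF \<mu>])
  interpret P: pair_sigma_finite \<mu> lborel ..
  define G where "G = (\<lambda>t x. ennreal (poisson (Complex x y) t) * indicator I t * indicator A x)"
  have G: "case_prod G \<in> borel_measurable (\<mu> \<Otimes>\<^sub>M lborel)"
    unfolding G_def poisson_def by simp measurable
  have meas [measurable]: "(\<lambda>t. poisson (Complex x y) t) \<in> borel_measurable borel"
    "(\<lambda>x. poisson (Complex x y) t) \<in> borel_measurable borel" for x t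
    unfolding poisson_def by simp_all
  have "(\<integral>\<^sup>+x\<in>A. (\<integral>\<^sup>+t\<in>I. ennreal (poisson (Complex x y) t) \<partial>\<mu>) \<partial>lborel) =
      (\<integral>\<^sup>+x. (\<integral>\<^sup>+t. G t x \<partial>\<mu>) \<partial>lborel)"
    unfolding G_def by (intro nn_integral_cong nn_integral_multc[symmetric]) measurable
  also have "\<dots> = (\<integral>\<^sup>+t. (\<integral>\<^sup>+x. G t x \<partial>lborel) \<partial>\<mu>)"
    by (rule P.Fubini'[OF G])
  also have "\<dots> = (\<integral>\<^sup>+t\<in>I. (\<integral>\<^sup>+x\<in>A. ennreal (poisson (Complex x y) t) \<partial>lborel) \<partial>\<mu>)"
  proof (intro nn_integral_cong)
    fix t
    have "(\<integral>\<^sup>+x. G t x \<partial>lborel) =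
        (\<integral>\<^sup>+x. ennreal (poisson (Complex x y) t) * indicator A x * indicator I t \<partial>lborel)"
      by (simp add: G_def mult_ac)
    also have "\<dots> = (\<integral>\<^sup>+x. ennreal (poisson (Complex x y) t) * indicator A x \<partial>lborel) * indicator I t"
      by (rule nn_integral_multc) measurable
    finally show "(\<integral>\<^sup>+x. G t x \<partial>lborel) =
        (\<integral>\<^sup>+x. ennreal (poisson (Complex x y) t) * indicator A x \<partial>lborel) * indicator I t" .
  qed
  finally show ?thesis .
qed

text \<open>The mass of an annulus is controlled by \<open>Im f\<close> at any sufficiently small height above it.\<close>

lemma annulus_mass_le:
  assumes f: "pick f" and y: "0 < y" "y \<le> (1/2)^k / 4"
  shows "emeasure (nevanlinna_measure f) (annulus \<tau> k) \<le>
    2 * (\<integral>\<^sup>+x\<in>annulus \<tau> k. ennreal (pi * Im (f (Complex x y))) \<partial>lborel)"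
proof -
  define \<mu> where "\<mu> = nevanlinna_measure f"
  have \<mu>: "locally_finite \<mu>" unfolding \<mu>_def by (rule nevanlinna_measure_poisson(1)[OF f])
  have sets_mu [measurable_cong]: "sets \<mu> = sets borel" using \<mu> by (rule locally_finite_sets)
  define R where "R = \<bar>\<tau>\<bar> + 1"
  have sub: "annulus \<tau> k \<subseteq> {-R..R}"
    using annulus_subset[of \<tau> k] half_power_le_1[of k] by (force simp: R_def)
  have "ennreal (1/2) * emeasure \<mu> (annulus \<tau> k) = (\<integral>\<^sup>+t. ennreal (1/2) * indicator (annulus \<tau> k) t \<partial>\<mu>)"
    by (rule nn_integral_cmult_indicator[symmetric]) (simp add: sets_mu)
  also have "\<dots> \<le> (\<integral>\<^sup>+t\<in>annulus \<tau> k. (\<integral>\<^sup>+x\<in>annulus \<tau> k. ennreal (poisson (Complex x y) t) \<partial>lborel) \<partial>\<mu>)"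
    using poisson_annulus_mass[OF y] by (intro nn_integral_mono) (auto simp: indicator_def)
  also have "\<dots> = (\<integral>\<^sup>+x\<in>annulus \<tau> k. (\<integral>\<^sup>+t\<in>annulus \<tau> k. ennreal (poisson (Complex x y) t) \<partial>\<mu>) \<partial>lborel)"
    by (rule poisson_Fubini[OF \<mu>, symmetric]) measurable
  also have "\<dots> \<le> (\<integral>\<^sup>+x\<in>annulus \<tau> k. ennreal (pi * Im (f (Complex x y))) \<partial>lborel)"
  proof (intro nn_integral_mono mult_right_mono)
    fix x
    have "(\<integral>\<^sup>+t\<in>annulus \<tau> k. ennreal (poisson (Complex x y) t) \<partial>\<mu>) \<le>
        (\<integral>\<^sup>+t\<in>{-R..R}. ennreal (poisson (Complex x y) t) \<partial>\<mu>)"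
      using sub by (intro nn_integral_mono mult_left_mono) (auto simp: indicator_def)
    also have "\<dots> \<le> ennreal (pi * Im (f (Complex x y)))"
      unfolding \<mu>_def using y by (intro nevanlinna_measure_lower_bound[OF f]) (auto simp: R_def)
    finally show "(\<integral>\<^sup>+t\<in>annulus \<tau> k. ennreal (poisson (Complex x y) t) \<partial>\<mu>) \<le> ennreal (pi * Im (f (Complex x y)))" .
  qed simp
  finally have "2 * (ennreal (1/2) * emeasure \<mu> (annulus \<tau> k)) \<le>
      2 * (\<integral>\<^sup>+x\<in>annulus \<tau> k. ennreal (pi * Im (f (Complex x y))) \<partial>lborel)"
    by (rule mult_left_mono) simp
  moreover have "2 * (ennreal (1/2) * emeasure \<mu> (annulus \<tau> k)) = emeasure \<mu> (annulus \<tau> k)"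
  proof -
    have "2 * ennreal (1/2) = 1" using ennreal_mult[of 2 "1/2"] by simp
    then show ?thesis by (simp add: mult.assoc[symmetric])
  qed
  ultimately show ?thesis by (simp add: \<mu>_def)
qed

text \<open>
  Conversely, if \<open>(t - \<tau>)\<^sup>-\<^sup>2\<close> is integrable near \<open>\<tau>\<close>, then above an annulus \<open>Im f\<close> is controlled
  pointwise by the mass of \<open>\<bar>t - \<tau>\<bar> \<le> 2\<^sup>1\<^sup>-\<^sup>k\<close>, and on average by the mass of an enlarged annulus. The
  error terms collect the contribution of points \<open>t\<close> with \<open>\<bar>x - t\<bar> \<ge> \<bar>t - \<tau>\<bar> / 2\<close>, where the kernel
  is at most \<open>4 y / (t - \<tau>)\<^sup>2\<close>. At \<open>t = \<tau>\<close> this quotient is 0 by convention, so the absence of an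
  atom at \<open>\<tau>\<close> is a separate hypothesis.
\<close>

lemma annulus_upper_bounds:
  assumes f: "pick f"
    and fin: "(\<integral>\<^sup>+t\<in>{-2*\<bar>\<tau>\<bar>-5..2*\<bar>\<tau>\<bar>+5}. ennreal (1 / (t - \<tau>)\<^sup>2) \<partial>nevanlinna_measure f) < \<infinity>"
    and atom: "emeasure (nevanlinna_measure f) {\<tau>} = 0"
  obtains D where "D \<ge> 0"
    "\<And>k x s. x \<in> annulus \<tau> k \<Longrightarrow> 0 < s \<Longrightarrow> s \<le> 1 \<Longrightarrow>
      pi * Im (f (Complex x s)) \<le> measure (nevanlinna_measure f) {t. \<bar>t - \<tau>\<bar> \<le> 2 * (1/2)^k} / s + D * s"
    "\<And>k y. 0 < y \<Longrightarrow> y \<le> 1 \<Longrightarrow>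
      (\<integral>\<^sup>+x\<in>annulus \<tau> k. ennreal (pi * Im (f (Complex x y))) \<partial>lborel) \<le>
      ennreal pi * emeasure (nevanlinna_measure f) {t. (1/2)^k / 4 < \<bar>t - \<tau>\<bar> \<and> \<bar>t - \<tau>\<bar> \<le> 2 * (1/2)^k}
      + ennreal (D * (1/2)^k * y)"
proof -
  define \<mu> where "\<mu> = nevanlinna_measure f"
  have \<mu>: "locally_finite \<mu>" unfolding \<mu>_def by (rule nevanlinna_measure_poisson(1)[OF f])
  have sets_mu [measurable_cong]: "sets \<mu> = sets borel" using \<mu> by (rule locally_finite_sets)
  \<comment> \<open>the disc of radius \<open>R / 2\<close> contains every \<open>x + i y\<close> with \<open>\<bar>x - \<tau>\<bar> \<le> 1\<close> and \<open>0 < y \<le> 1\<close>\<close>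
  define R where "R = 2 * (\<bar>\<tau>\<bar> + 2)"
  define I where "I = {-R-1..R+1}"
  have I_eq: "I = {-2*\<bar>\<tau>\<bar>-5..2*\<bar>\<tau>\<bar>+5}" by (simp add: I_def R_def)
  have [measurable]: "I \<in> sets borel" by (simp add: I_def)
  have R0: "R > 0" by (simp add: R_def)
  obtain B where B: "B \<ge> 0" "\<And>z. Im z > 0 \<Longrightarrow> norm z \<le> R / 2 \<Longrightarrow> ennreal (pi * Im (f z)) \<le>
    (\<integral>\<^sup>+t\<in>I. ennreal (poisson z t) \<partial>\<mu>) + ennreal (B * Im z)"
    using nevanlinna_measure_upper_bound[OF f R0] unfolding \<mu>_def I_def by blast
  obtain J where J: "J \<ge> 0" "(\<integral>\<^sup>+t\<in>I. ennreal (1 / (t - \<tau>)\<^sup>2) \<partial>\<mu>) = ennreal J"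
    using fin unfolding \<mu>_def I_eq by (cases "(\<integral>\<^sup>+t\<in>{-2*\<bar>\<tau>\<bar>-5..2*\<bar>\<tau>\<bar>+5}. ennreal (1 / (t - \<tau>)\<^sup>2) \<partial>nevanlinna_measure f)") auto
  have AE_ne: "AE t in \<mu>. t \<noteq> \<tau>" using atom unfolding \<mu>_def[symmetric] by (rule AE_not_atom[OF \<mu>])
  have bd: "ennreal (pi * Im (f (Complex x y))) \<le> (\<integral>\<^sup>+t\<in>I. ennreal (poisson (Complex x y) t) \<partial>\<mu>) + ennreal (B * y)"
    if x: "x \<in> annulus \<tau> k" and y: "0 < y" "y \<le> 1" for x y k
  proof -
    have "\<bar>x - \<tau>\<bar> \<le> 1" using x half_power_le_1[of k] by (simp add: annulus_def)
    then have "norm (Complex x y) \<le> R / 2"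
      using cmod_le[of "Complex x y"] y by (simp add: R_def)
    then show ?thesis using B(2)[of "Complex x y"] y by simp
  qed
  define D where "D = 8 * J + 2 * B"
  have D0: "D \<ge> 0" using J B by (simp add: D_def)
  have far_int: "(\<integral>\<^sup>+t\<in>I. ennreal (c * (1 / (t - \<tau>)\<^sup>2)) \<partial>\<mu>) = ennreal (c * J)" if "c \<ge> 0" for c
  proof -
    have "(\<integral>\<^sup>+t\<in>I. ennreal (c * (1 / (t - \<tau>)\<^sup>2)) \<partial>\<mu>) =
        (\<integral>\<^sup>+t. ennreal c * (ennreal (1 / (t - \<tau>)\<^sup>2) * indicator I t) \<partial>\<mu>)"
      using that by (simp only: ennreal_mult'[OF that] mult.assoc)
    also have "\<dots> = ennreal c * (\<integral>\<^sup>+t\<in>I. ennreal (1 / (t - \<tau>)\<^sup>2) \<partial>\<mu>)"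
      by (rule nn_integral_cmult) measurable
    finally show ?thesis using J that by (simp add: ennreal_mult)
  qed
  have pointwise: "pi * Im (f (Complex x s)) \<le> measure \<mu> {t. \<bar>t - \<tau>\<bar> \<le> 2 * (1/2)^k} / s + D * s"
    if x: "x \<in> annulus \<tau> k" and s: "0 < s" "s \<le> 1" for x s k
  proof -
    define Bk where "Bk = {t. \<bar>t - \<tau>\<bar> \<le> 2 * (1/2)^k}"
    have Bk_meas [measurable]: "Bk \<in> sets borel" unfolding Bk_def by measurable
    have "Bk \<subseteq> {-(\<bar>\<tau>\<bar> + 2)..\<bar>\<tau>\<bar> + 2}"
      using half_power_le_1[of k] by (auto simp: Bk_def abs_le_iff)
    note Bk_fin = locally_finite_emeasure_eq[OF \<mu> this]
    have "(\<integral>\<^sup>+t\<in>I. ennreal (poisson (Complex x s) t) \<partial>\<mu>) \<le>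
        (\<integral>\<^sup>+t. ennreal (1 / s) * indicator Bk t + ennreal (4 * s * (1 / (t - \<tau>)\<^sup>2)) * indicator I t \<partial>\<mu>)"
    proof (rule nn_integral_mono_AE)
      show "AE t in \<mu>. ennreal (poisson (Complex x s) t) * indicator I t \<le>
          ennreal (1 / s) * indicator Bk t + ennreal (4 * s * (1 / (t - \<tau>)\<^sup>2)) * indicator I t"
        using AE_ne
      proof eventually_elim
        case (elim t)
        show ?case
        proof (cases "t \<in> Bk")
          case True
          have "ennreal (poisson (Complex x s) t) \<le> ennreal (1 / s)"
            using poisson_le[of "Complex x s" t] s by (intro ennreal_leI) simp
          then have "ennreal (poisson (Complex x s) t) * indicator I t \<le> ennreal (1 / s) * 1"
            by (intro mult_mono) (auto simp: indicator_def)
          also have "\<dots> \<le> ennreal (1 / s) * indicator Bk t + ennreal (4 * s * (1 / (t - \<tau>)\<^sup>2)) * indicator I t"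
            using True by (simp add: add_increasing2)
          finally show ?thesis .
        next
          case False
          have "poisson (Complex x s) t \<le> 4 * s * (1 / (t - \<tau>)\<^sup>2)"
            by (rule poisson_far[OF annulus_far[OF x] elim s(1)]) (use False in \<open>auto simp: Bk_def\<close>)
          then show ?thesis using False by (auto simp: indicator_def intro: ennreal_leI)
        qed
      qed
    qed
    also have "\<dots> = (\<integral>\<^sup>+t. ennreal (1 / s) * indicator Bk t \<partial>\<mu>) + (\<integral>\<^sup>+t\<in>I. ennreal (4 * s * (1 / (t - \<tau>)\<^sup>2)) \<partial>\<mu>)"
      by (rule nn_integral_add; measurable)
    also have "(\<integral>\<^sup>+t. ennreal (1 / s) * indicator Bk t \<partial>\<mu>) = ennreal (measure \<mu> Bk / s)"
      using s by (subst nn_integral_cmult_indicator) (auto simp: Bk_fin ennreal_mult[symmetric] sets_mu)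
    also have "(\<integral>\<^sup>+t\<in>I. ennreal (4 * s * (1 / (t - \<tau>)\<^sup>2)) \<partial>\<mu>) = ennreal (4 * s * J)"
      using s by (intro far_int) simp
    finally have "ennreal (pi * Im (f (Complex x s))) \<le> ennreal (measure \<mu> Bk / s) + ennreal (4 * s * J) + ennreal (B * s)"
      using bd[OF x s] by (meson add_right_mono order_trans)
    also have "\<dots> = ennreal (measure \<mu> Bk / s + 4 * s * J + B * s)"
      using s J B by (simp add: ennreal_plus)
    finally have "pi * Im (f (Complex x s)) \<le> measure \<mu> Bk / s + 4 * s * J + B * s"
      using s J B by (subst (asm) ennreal_le_iff) (auto intro!: add_nonneg_nonneg)
    also have "\<dots> \<le> measure \<mu> Bk / s + D * s"
      using s J B by (simp add: D_def algebra_simps mult_nonneg_nonneg)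
    finally show ?thesis by (simp add: Bk_def)
  qed
  have average: "(\<integral>\<^sup>+x\<in>annulus \<tau> k. ennreal (pi * Im (f (Complex x y))) \<partial>lborel) \<le>
      ennreal pi * emeasure \<mu> {t. (1/2)^k / 4 < \<bar>t - \<tau>\<bar> \<and> \<bar>t - \<tau>\<bar> \<le> 2 * (1/2)^k}
      + ennreal (D * (1/2)^k * y)"
    if y: "0 < y" "y \<le> 1" for k y
  proof -
    define r :: real where "r = (1/2)^k"
    have r: "r > 0" by (simp add: r_def)
    define E where "E = {t. r / 4 < \<bar>t - \<tau>\<bar> \<and> \<bar>t - \<tau>\<bar> \<le> 2 * r}"
    have [measurable]: "E \<in> sets borel" unfolding E_def by measurable
    have inner: "(\<integral>\<^sup>+x\<in>annulus \<tau> k. ennreal (poisson (Complex x y) t) \<partial>lborel) \<le>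
        ennreal pi * indicator E t + ennreal (8 * r * y * (1 / (t - \<tau>)\<^sup>2))" if t: "t \<noteq> \<tau>" for t
    proof (cases "t \<in> E")
      case True
      have "(\<integral>\<^sup>+x\<in>annulus \<tau> k. ennreal (poisson (Complex x y) t) \<partial>lborel) \<le>
          (\<integral>\<^sup>+x. ennreal (poisson (Complex x y) t) \<partial>lborel)"
        by (intro nn_integral_mono) (auto simp: indicator_def)
      also have "\<dots> = ennreal pi" by (rule nn_integral_poisson[OF y(1)])
      also have "\<dots> \<le> ennreal pi * indicator E t + ennreal (8 * r * y * (1 / (t - \<tau>)\<^sup>2))"
        using True by (simp add: add_increasing2)
      finally show ?thesis .
    next
      case False
      have "(\<integral>\<^sup>+x\<in>annulus \<tau> k. ennreal (poisson (Complex x y) t) \<partial>lborel) \<le>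
          (\<integral>\<^sup>+x. ennreal (4 * y * (1 / (t - \<tau>)\<^sup>2)) * indicator (annulus \<tau> k) x \<partial>lborel)"
      proof (rule nn_integral_mono)
        fix x
        show "ennreal (poisson (Complex x y) t) * indicator (annulus \<tau> k) x \<le>
            ennreal (4 * y * (1 / (t - \<tau>)\<^sup>2)) * indicator (annulus \<tau> k) x"
        proof (cases "x \<in> annulus \<tau> k")
          case True
          have "poisson (Complex x y) t \<le> 4 * y * (1 / (t - \<tau>)\<^sup>2)"
            by (rule poisson_far[OF annulus_far[OF True] t y(1)])
               (use False in \<open>auto simp: E_def r_def\<close>)
          then show ?thesis by (intro mult_right_mono ennreal_leI) auto
        qed simp
      qed
      also have "\<dots> = ennreal (4 * y * (1 / (t - \<tau>)\<^sup>2)) * emeasure lborel (annulus \<tau> k)"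
        by (rule nn_integral_cmult_indicator) simp
      also have "\<dots> \<le> ennreal (4 * y * (1 / (t - \<tau>)\<^sup>2)) * ennreal (2 * r)"
        unfolding r_def by (intro mult_left_mono emeasure_annulus_le) simp
      also have "\<dots> = ennreal (8 * r * y * (1 / (t - \<tau>)\<^sup>2))"
        using y r by (simp add: ennreal_mult[symmetric] mult_ac)
      finally show ?thesis using False by simp
    qed
    have measI [measurable]: "(\<lambda>x. Im (f (Complex x y))) \<in> borel_measurable borel"
      by (rule borel_measurable_continuous_onI[OF continuous_on_Im_horizontal[OF f y(1)]])
    have meas_k [measurable]: "(\<lambda>x. \<integral>\<^sup>+t\<in>I. ennreal (poisson (Complex x y) t) \<partial>\<mu>) \<in> borel_measurable borel"
    proof -
      interpret M: sigma_finite_measure \<mu> by (rule locally_finite_sigma_finite[OF \<mu>])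
      show ?thesis unfolding poisson_def by simp measurable
    qed
    have "(\<integral>\<^sup>+x\<in>annulus \<tau> k. ennreal (pi * Im (f (Complex x y))) \<partial>lborel) \<le>
        (\<integral>\<^sup>+x. (\<integral>\<^sup>+t\<in>I. ennreal (poisson (Complex x y) t) \<partial>\<mu>) * indicator (annulus \<tau> k) x
          + ennreal (B * y) * indicator (annulus \<tau> k) x \<partial>lborel)"
    proof (rule nn_integral_mono)
      fix x show "ennreal (pi * Im (f (Complex x y))) * indicator (annulus \<tau> k) x \<le>
          (\<integral>\<^sup>+t\<in>I. ennreal (poisson (Complex x y) t) \<partial>\<mu>) * indicator (annulus \<tau> k) x
          + ennreal (B * y) * indicator (annulus \<tau> k) x"
        using bd[of x k y] y by (cases "x \<in> annulus \<tau> k") auto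
    qed
    also have "\<dots> = (\<integral>\<^sup>+x\<in>annulus \<tau> k. (\<integral>\<^sup>+t\<in>I. ennreal (poisson (Complex x y) t) \<partial>\<mu>) \<partial>lborel)
        + (\<integral>\<^sup>+x. ennreal (B * y) * indicator (annulus \<tau> k) x \<partial>lborel)"
      by (rule nn_integral_add; measurable)
    also have "(\<integral>\<^sup>+x. ennreal (B * y) * indicator (annulus \<tau> k) x \<partial>lborel) \<le> ennreal (2 * B * r * y)"
    proof -
      have "(\<integral>\<^sup>+x. ennreal (B * y) * indicator (annulus \<tau> k) x \<partial>lborel) = ennreal (B * y) * emeasure lborel (annulus \<tau> k)"
        by (rule nn_integral_cmult_indicator) simp
      also have "\<dots> \<le> ennreal (B * y) * ennreal (2 * r)"
        unfolding r_def by (intro mult_left_mono emeasure_annulus_le) simp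
      also have "\<dots> = ennreal (2 * B * r * y)"
        using y r B by (simp add: ennreal_mult[symmetric] mult_ac)
      finally show ?thesis .
    qed
    also have "(\<integral>\<^sup>+x\<in>annulus \<tau> k. (\<integral>\<^sup>+t\<in>I. ennreal (poisson (Complex x y) t) \<partial>\<mu>) \<partial>lborel) =
        (\<integral>\<^sup>+t\<in>I. (\<integral>\<^sup>+x\<in>annulus \<tau> k. ennreal (poisson (Complex x y) t) \<partial>lborel) \<partial>\<mu>)"
      by (rule poisson_Fubini[OF \<mu>]) measurable
    also have "\<dots> \<le> (\<integral>\<^sup>+t. ennreal pi * indicator E t + ennreal (8 * r * y * (1 / (t - \<tau>)\<^sup>2)) * indicator I t \<partial>\<mu>)"
    proof (rule nn_integral_mono_AE)
      show "AE t in \<mu>. (\<integral>\<^sup>+x\<in>annulus \<tau> k. ennreal (poisson (Complex x y) t) \<partial>lborel) * indicator I t \<le>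
          ennreal pi * indicator E t + ennreal (8 * r * y * (1 / (t - \<tau>)\<^sup>2)) * indicator I t"
        using AE_ne by eventually_elim (use inner in \<open>auto simp: indicator_def split: if_splits\<close>)
    qed
    also have "\<dots> = (\<integral>\<^sup>+t. ennreal pi * indicator E t \<partial>\<mu>) + (\<integral>\<^sup>+t\<in>I. ennreal (8 * r * y * (1 / (t - \<tau>)\<^sup>2)) \<partial>\<mu>)"
      by (rule nn_integral_add; measurable)
    also have "(\<integral>\<^sup>+t. ennreal pi * indicator E t \<partial>\<mu>) = ennreal pi * emeasure \<mu> E"
      by (rule nn_integral_cmult_indicator) (simp add: sets_mu)
    also have "(\<integral>\<^sup>+t\<in>I. ennreal (8 * r * y * (1 / (t - \<tau>)\<^sup>2)) \<partial>\<mu>) = ennreal (8 * r * y * J)"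
      using y r by (intro far_int) simp
    finally have "(\<integral>\<^sup>+x\<in>annulus \<tau> k. ennreal (pi * Im (f (Complex x y))) \<partial>lborel) \<le>
        ennreal pi * emeasure \<mu> E + ennreal (8 * r * y * J) + ennreal (2 * B * r * y)"
      by (simp add: add_mono)
    also have "\<dots> = ennreal pi * emeasure \<mu> E + ennreal (D * r * y)"
    proof -
      have "ennreal (8 * r * y * J) + ennreal (2 * B * r * y) = ennreal (8 * r * y * J + 2 * B * r * y)"
        using y r J B by (intro ennreal_plus[symmetric]) auto
      also have "8 * r * y * J + 2 * B * r * y = D * r * y" by (simp add: D_def algebra_simps)
      finally show ?thesis by (simp add: add.assoc)
    qed
    finally show ?thesis by (simp add: E_def r_def)
  qed
  show thesis
    by (rule that[OF D0]) (use pointwise average in \<open>auto simp: \<mu>_def\<close>)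
qed

section \<open>Transfer of regularity\<close>

lemma nontangential_limit_vertical:
  assumes "nontangential_limit f \<tau> w"
  shows "((\<lambda>y. f (Complex \<tau> y)) \<longlongrightarrow> w) (at_right 0)"
proof -
  let ?K = "{z. Im z > 0 \<and> cmod (z - of_real \<tau>) \<le> 1 * Im z}"
  have "(f \<longlongrightarrow> w) (at (of_real \<tau>) within ?K)"
    using assms unfolding nontangential_limit_def by (metis zero_less_one)
  moreover have "filterlim (\<lambda>y. Complex \<tau> y) (at (of_real \<tau>) within ?K) (at_right 0)"
    unfolding filterlim_at
  proof (intro conjI)
    have "((\<lambda>y. Complex \<tau> y) \<longlongrightarrow> Complex \<tau> 0) (at_right 0)" by (intro tendsto_intros)
    then show "((\<lambda>y. Complex \<tau> y) \<longlongrightarrow> of_real \<tau>) (at_right 0)" by (simp add: complex_of_real_def)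
    show "\<forall>\<^sub>F y in at_right 0. Complex \<tau> y \<in> ?K \<and> Complex \<tau> y \<noteq> of_real \<tau>"
      using eventually_at_right_less[of "0::real"]
    proof eventually_elim
      case (elim y)
      have "Complex \<tau> y - of_real \<tau> = \<i> * of_real y" by (simp add: complex_eq_iff)
      then have "cmod (Complex \<tau> y - of_real \<tau>) = \<bar>y\<bar>" by (simp only: norm_mult norm_of_real) simp
      then show ?case using elim by (auto simp: complex_eq_iff)
    qed
  qed
  ultimately show ?thesis by (rule filterlim_compose)
qed

text \<open>Nontangential approach along the diagonals \<open>y = \<bar>x - \<tau>\<bar>\<close>.\<close>

lemma nontangential_limit_diagonal:
  assumes "nontangential_limit f \<tau> p" "\<rho> > 0"
  shows "\<exists>d>0. \<forall>x. 0 < \<bar>x - \<tau>\<bar> \<and> \<bar>x - \<tau>\<bar> < d \<longrightarrow> norm (f (Complex x \<bar>x - \<tau>\<bar>) - p) < \<rho>"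
proof -
  let ?V = "{z. Im z > 0 \<and> cmod (z - of_real \<tau>) \<le> 2 * Im z}"
  have "(f \<longlongrightarrow> p) (at (of_real \<tau>) within ?V)"
    using assms(1) unfolding nontangential_limit_def by (metis zero_less_numeral)
  then have "eventually (\<lambda>z. dist (f z) p < \<rho>) (at (of_real \<tau>) within ?V)"
    by (rule tendstoD) (rule assms(2))
  then obtain e where e: "e > 0" "\<And>z. z \<in> ?V \<Longrightarrow> z \<noteq> of_real \<tau> \<Longrightarrow> dist z (of_real \<tau>) < e \<Longrightarrow> dist (f z) p < \<rho>"
    unfolding eventually_at by blast
  have "norm (f (Complex x \<bar>x - \<tau>\<bar>) - p) < \<rho>" if x: "0 < \<bar>x - \<tau>\<bar>" "\<bar>x - \<tau>\<bar> < e / 2" for x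
  proof -
    have n: "cmod (Complex x \<bar>x - \<tau>\<bar> - of_real \<tau>) \<le> 2 * \<bar>x - \<tau>\<bar>"
      using cmod_le[of "Complex x \<bar>x - \<tau>\<bar> - of_real \<tau>"] by simp
    have "dist (f (Complex x \<bar>x - \<tau>\<bar>)) p < \<rho>"
      by (rule e(2)) (use x n in \<open>auto simp: dist_norm complex_eq_iff\<close>)
    then show ?thesis by (simp add: dist_norm)
  qed
  then show ?thesis using e(1) by (intro exI[of _ "e / 2"]) auto
qed

text \<open>
  An atom of mass \<open>m\<close> at \<open>\<tau>\<close> would force \<open>\<pi> Im f(\<tau> + i y) \<ge> m / y\<close>, which excludes a finite
  nontangential limit.
\<close>

lemma nevanlinna_measure_no_atom:
  assumes f: "pick f" and lim: "nontangential_limit f \<tau> w"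
  shows "emeasure (nevanlinna_measure f) {\<tau>} = 0"
proof -
  define \<mu> where "\<mu> = nevanlinna_measure f"
  have \<mu>: "locally_finite \<mu>" unfolding \<mu>_def by (rule nevanlinna_measure_poisson(1)[OF f])
  have sets_mu [measurable_cong]: "sets \<mu> = sets borel" using \<mu> by (rule locally_finite_sets)
  define R where "R = \<bar>\<tau>\<bar> + 1"
  have tau_in: "- R \<le> \<tau>" "\<tau> \<le> R" by (auto simp: R_def)
  have em: "emeasure \<mu> {\<tau>} = ennreal (measure \<mu> {\<tau>})"
    by (rule locally_finite_emeasure_eq[OF \<mu>, of _ R]) (auto simp: R_def)
  have le: "measure \<mu> {\<tau>} \<le> pi * (y * Im (f (Complex \<tau> y)))" if y: "y > 0" for y
  proof -
    have "ennreal (1 / y) * emeasure \<mu> {\<tau>} = (\<integral>\<^sup>+t. ennreal (1 / y) * indicator {\<tau>} t \<partial>\<mu>)"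
      by (rule nn_integral_cmult_indicator[symmetric]) (simp add: sets_mu)
    also have "\<dots> \<le> (\<integral>\<^sup>+t\<in>{-R..R}. ennreal (poisson (Complex \<tau> y) t) \<partial>\<mu>)"
    proof (rule nn_integral_mono)
      fix t show "ennreal (1 / y) * indicator {\<tau>} t \<le> ennreal (poisson (Complex \<tau> y) t) * indicator {-R..R} t"
        using y tau_in by (cases "t = \<tau>") (auto simp: poisson_def power2_eq_square)
    qed
    also have "\<dots> \<le> ennreal (pi * Im (f (Complex \<tau> y)))"
      unfolding \<mu>_def using y by (intro nevanlinna_measure_lower_bound[OF f]) (auto simp: R_def)
    finally have "ennreal (1 / y * measure \<mu> {\<tau>}) \<le> ennreal (pi * Im (f (Complex \<tau> y)))"
      using y by (simp add: em ennreal_mult[symmetric])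
    then have "1 / y * measure \<mu> {\<tau>} \<le> pi * Im (f (Complex \<tau> y))"
      using pick_Im_nonneg[OF f, of "Complex \<tau> y"] y by (subst (asm) ennreal_le_iff) auto
    then show ?thesis using y by (simp add: field_simps)
  qed
  have "((\<lambda>y. pi * (y * Im (f (Complex \<tau> y)))) \<longlongrightarrow> pi * (0 * Im w)) (at_right 0)"
    by (intro tendsto_intros nontangential_limit_vertical[OF lim])
  then have "measure \<mu> {\<tau>} \<le> pi * (0 * Im w)"
    by (rule tendsto_lowerbound) (use eventually_at_right_less[of "0::real"] le in \<open>auto elim: eventually_mono\<close>)
  then show ?thesis using em by (simp add: \<mu>_def measure_le_0_iff)
qed

lemma mono_on_quadratic_bound:
  fixes \<gamma> :: "real \<Rightarrow> real"
  assumes mono: "mono_on {0..} \<gamma>" and nonneg: "\<forall>t\<ge>0. 0 \<le> \<gamma> t"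
    and O: "\<gamma> \<in> O[at_right 0](\<lambda>t. t\<^sup>2)" and C: "C > 0" and S: "S > 0"
  shows "\<exists>K>0. \<forall>s. 0 < s \<and> s \<le> S \<longrightarrow> \<gamma> (C * s) \<le> K * s\<^sup>2"
proof -
  obtain c where c: "c > 0" "eventually (\<lambda>x. norm (\<gamma> x) \<le> c * norm (x\<^sup>2)) (at_right 0)"
    using landau_o.bigE[OF O] by blast
  then obtain b where b: "b > 0" "\<And>x. 0 < x \<Longrightarrow> x < b \<Longrightarrow> norm (\<gamma> x) \<le> c * norm (x\<^sup>2)"
    unfolding eventually_at_right_field by auto
  define K where "K = c * C\<^sup>2 + \<gamma> (C * S) * (C / b)\<^sup>2"
  have g0: "\<gamma> (C * S) \<ge> 0" using nonneg C S by simp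
  have K: "K > 0" unfolding K_def using c(1) C g0 by (intro add_pos_nonneg) auto
  have "\<gamma> (C * s) \<le> K * s\<^sup>2" if s: "0 < s" "s \<le> S" for s
  proof (cases "C * s < b")
    case True
    have "\<gamma> (C * s) \<le> c * (C * s)\<^sup>2" using b(2)[of "C * s"] True s C by simp
    also have "\<dots> = c * C\<^sup>2 * s\<^sup>2" by (simp add: power_mult_distrib)
    also have "\<dots> \<le> K * s\<^sup>2" unfolding K_def using g0 by (intro mult_right_mono) auto
    finally show ?thesis .
  next
    case False
    have "1 \<le> C / b * s" using False b(1) by (simp add: field_simps)
    then have "1 \<le> (C / b * s)\<^sup>2" by (rule one_le_power)
    then have "1 \<le> (C / b)\<^sup>2 * s\<^sup>2" by (simp only: power_mult_distrib)
    then have "\<gamma> (C * S) * 1 \<le> \<gamma> (C * S) * ((C / b)\<^sup>2 * s\<^sup>2)" by (intro mult_left_mono g0)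
    moreover have "\<gamma> (C * s) \<le> \<gamma> (C * S)" using mono s C S by (auto simp: mono_on_def)
    moreover have "\<gamma> (C * S) * ((C / b)\<^sup>2 * s\<^sup>2) \<le> K * s\<^sup>2"
      unfolding K_def using c(1) by (simp add: algebra_simps)
    ultimately show ?thesis by linarith
  qed
  with K show ?thesis by blast
qed

lemma measurable_mono_on_dist:
  fixes \<gamma> :: "real \<Rightarrow> real"
  assumes mono: "mono_on {0..} \<gamma>" and C: "C > 0"
  shows "(\<lambda>t. \<gamma> (C * \<bar>t - \<tau>\<bar>)) \<in> borel_measurable borel"
proof -
  have "mono (\<lambda>s. \<gamma> (max 0 s))"
    using mono by (intro monoI) (auto simp: mono_on_def)
  then have [measurable]: "(\<lambda>s. \<gamma> (max 0 s)) \<in> borel_measurable borel"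
    by (rule borel_measurable_mono)
  have "(\<lambda>t. (\<lambda>s. \<gamma> (max 0 s)) (C * \<bar>t - \<tau>\<bar>)) \<in> borel_measurable borel" by measurable
  then show ?thesis using C by simp
qed

text \<open>
  Since \<open>\<gamma>\<close> is bounded below by a positive constant away from 0, regularity does not depend on the
  neighbourhood; since \<open>\<gamma>(t) = O(t\<^sup>2)\<close>, it implies that \<open>(t - \<tau>)\<^sup>-\<^sup>2\<close> is locally integrable.
\<close>

lemma gamma_regular_integrable:
  fixes \<tau> :: real and \<gamma> :: "real \<Rightarrow> real"
  assumes mono: "mono_on {0..} \<gamma>" and nonneg: "\<forall>t\<ge>0. 0 \<le> \<gamma> t" and pos: "\<forall>t>0. 0 < \<gamma> t"
    and O: "\<gamma> \<in> O[at_right 0](\<lambda>t. t\<^sup>2)"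
    and F: "pick F" and reg: "gamma_regular \<gamma> F \<tau>"
  shows "\<exists>C>0. (\<integral>\<^sup>+t\<in>{-2*\<bar>\<tau>\<bar>-5..2*\<bar>\<tau>\<bar>+5}. 1 / ennreal (\<gamma> (C * \<bar>t - \<tau>\<bar>)) \<partial>nevanlinna_measure F) < \<infinity> \<and>
    (\<integral>\<^sup>+t\<in>{-2*\<bar>\<tau>\<bar>-5..2*\<bar>\<tau>\<bar>+5}. ennreal (1 / (t - \<tau>)\<^sup>2) \<partial>nevanlinna_measure F) < \<infinity>"
proof -
  define \<mu> where "\<mu> = nevanlinna_measure F"
  have \<mu>: "locally_finite \<mu>" unfolding \<mu>_def by (rule nevanlinna_measure_poisson(1)[OF F])
  have sets_mu [measurable_cong]: "sets \<mu> = sets borel" using \<mu> by (rule locally_finite_sets)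
  obtain C0 N where C0: "C0 > 0" and N: "open N" "\<tau> \<in> N"
    and regN: "(\<integral>\<^sup>+t\<in>N. 1 / ennreal (\<gamma> (C0 * \<bar>t - \<tau>\<bar>)) \<partial>\<mu>) < \<infinity>"
    using reg unfolding gamma_regular_def \<mu>_def by blast
  define W where "W = (\<lambda>t. 1 / ennreal (\<gamma> (C0 * \<bar>t - \<tau>\<bar>)))"
  have [measurable]: "W \<in> borel_measurable borel"
    unfolding W_def using measurable_mono_on_dist[OF mono C0, of \<tau>] by measurable
  have W_eq: "W t = ennreal (1 / \<gamma> (C0 * \<bar>t - \<tau>\<bar>))" if "t \<noteq> \<tau>" for t
    using divide_ennreal[of 1 "\<gamma> (C0 * \<bar>t - \<tau>\<bar>)"] pos C0 that by (simp add: W_def)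
  define I where "I = {-2*\<bar>\<tau>\<bar>-5..2*\<bar>\<tau>\<bar>+5}"
  have [measurable]: "I \<in> sets borel" by (simp add: I_def)
  have W_fin: "(\<integral>\<^sup>+t\<in>I. W t \<partial>\<mu>) < \<infinity>"
  proof -
    obtain e where e: "e > 0" "ball \<tau> e \<subseteq> N" using N by (meson open_contains_ball)
    have [measurable]: "N \<in> sets borel" using N(1) by simp
    have "(\<integral>\<^sup>+t\<in>I. W t \<partial>\<mu>) \<le> (\<integral>\<^sup>+t. W t * indicator N t + ennreal (1 / \<gamma> (C0 * e)) * indicator I t \<partial>\<mu>)"
    proof (rule nn_integral_mono)
      fix t
      show "W t * indicator I t \<le> W t * indicator N t + ennreal (1 / \<gamma> (C0 * e)) * indicator I t"
      proof (cases "t \<in> N")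
        case True
        have "W t * indicator I t \<le> W t * 1" by (intro mult_left_mono) (auto simp: indicator_def)
        also have "\<dots> \<le> W t * indicator N t + ennreal (1 / \<gamma> (C0 * e)) * indicator I t"
          using True by (simp add: add_increasing2)
        finally show ?thesis .
      next
        case False
        then have te: "e \<le> \<bar>t - \<tau>\<bar>" using e(2) by (force simp: dist_real_def abs_minus_commute)
        then have "\<gamma> (C0 * e) \<le> \<gamma> (C0 * \<bar>t - \<tau>\<bar>)" using mono C0 e(1) by (auto simp: mono_on_def)
        then have "1 / \<gamma> (C0 * \<bar>t - \<tau>\<bar>) \<le> 1 / \<gamma> (C0 * e)"
          using pos C0 e(1) te by (intro divide_left_mono mult_pos_pos) auto
        then have "W t \<le> ennreal (1 / \<gamma> (C0 * e))"
          using W_eq[of t] te e(1) by (auto intro!: ennreal_leI)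
        then have "W t * indicator I t \<le> ennreal (1 / \<gamma> (C0 * e)) * indicator I t" by (intro mult_right_mono) auto
        then show ?thesis by (simp add: add_increasing)
      qed
    qed
    also have "\<dots> = (\<integral>\<^sup>+t\<in>N. W t \<partial>\<mu>) + (\<integral>\<^sup>+t. ennreal (1 / \<gamma> (C0 * e)) * indicator I t \<partial>\<mu>)"
      by (rule nn_integral_add; measurable)
    also have "(\<integral>\<^sup>+t. ennreal (1 / \<gamma> (C0 * e)) * indicator I t \<partial>\<mu>) = ennreal (1 / \<gamma> (C0 * e)) * emeasure \<mu> I"
      by (rule nn_integral_cmult_indicator) (simp add: sets_mu)
    also have "(\<integral>\<^sup>+t\<in>N. W t \<partial>\<mu>) + \<dots> < \<infinity>"
      using regN locally_finite_bounded[OF \<mu>, of I "2*\<bar>\<tau>\<bar>+5"]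
      by (auto simp: W_def I_def ennreal_mult_less_top)
    finally show ?thesis .
  qed
  have quad_fin: "(\<integral>\<^sup>+t\<in>I. ennreal (1 / (t - \<tau>)\<^sup>2) \<partial>\<mu>) < \<infinity>"
  proof -
    obtain L where L: "L > 0" "\<And>s. 0 < s \<Longrightarrow> s \<le> 3 * \<bar>\<tau>\<bar> + 5 \<Longrightarrow> \<gamma> (C0 * s) \<le> L * s\<^sup>2"
    proof -
      have "0 < 3 * \<bar>\<tau>\<bar> + 5" by linarith
      from mono_on_quadratic_bound[OF mono nonneg O C0 this] show thesis using that by blast
    qed
    have "(\<integral>\<^sup>+t\<in>I. ennreal (1 / (t - \<tau>)\<^sup>2) \<partial>\<mu>) \<le> (\<integral>\<^sup>+t. ennreal L * (W t * indicator I t) \<partial>\<mu>)"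
    proof (rule nn_integral_mono)
      fix t
      show "ennreal (1 / (t - \<tau>)\<^sup>2) * indicator I t \<le> ennreal L * (W t * indicator I t)"
      proof (cases "t \<in> I \<and> t \<noteq> \<tau>")
        case True
        then have "\<bar>t - \<tau>\<bar> \<le> 3 * \<bar>\<tau>\<bar> + 5" by (auto simp: I_def abs_le_iff)
        then have "\<gamma> (C0 * \<bar>t - \<tau>\<bar>) \<le> L * (t - \<tau>)\<^sup>2"
          using L(2)[of "\<bar>t - \<tau>\<bar>"] True by simp
        moreover have "\<gamma> (C0 * \<bar>t - \<tau>\<bar>) > 0" using pos C0 True by simp
        ultimately have "1 / (t - \<tau>)\<^sup>2 \<le> L * (1 / \<gamma> (C0 * \<bar>t - \<tau>\<bar>))"
          using True L(1) by (simp add: field_simps)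
        then have "ennreal (1 / (t - \<tau>)\<^sup>2) \<le> ennreal L * W t"
          using True L(1) W_eq[of t] by (simp add: ennreal_mult'[symmetric] ennreal_leI)
        then show ?thesis using True by simp
      qed auto
    qed
    also have "\<dots> = ennreal L * (\<integral>\<^sup>+t\<in>I. W t \<partial>\<mu>)"
      by (rule nn_integral_cmult) measurable
    also have "\<dots> < \<infinity>" using W_fin by (simp add: ennreal_mult_less_top)
    finally show ?thesis .
  qed
  show ?thesis
    using C0 W_fin quad_fin unfolding W_def I_def \<mu>_def by blast
qed

text \<open>
  Since \<open>\<bar>F'\<bar> \<le> Im F / Im z\<close>, a bound \<open>m / s\<^sup>2 + D\<close> for \<open>Im F / Im z\<close> at height \<open>s\<close> integrates to a
  bound for the oscillation of \<open>F\<close> on a vertical segment.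
\<close>

lemma vertical_oscillation:
  assumes F: "pick F" and ab: "0 < a" "a \<le> b" and m: "m \<ge> 0" and D: "D \<ge> 0"
    and bd: "\<And>s. a \<le> s \<Longrightarrow> s \<le> b \<Longrightarrow> pi * Im (F (Complex x s)) \<le> m / s + D * s"
  shows "norm (F (Complex x b) - F (Complex x a)) \<le> D * b + m / a"
proof (cases "a = b")
  case True
  then show ?thesis using ab m D by simp
next
  case False
  then have ab': "a < b" using ab by simp
  have "norm (F (Complex x b) - F (Complex x a)) \<le> (D * b - m / b) - (D * a - m / a)"
  proof (rule differentiable_bound_general[OF ab', where f'="\<lambda>s. \<i> * deriv F (Complex x s)" and \<phi>'="\<lambda>s. D + m / s\<^sup>2"])
    show "continuous_on {a..b} (\<lambda>s. F (Complex x s))"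
      by (intro continuous_at_imp_continuous_on ballI has_vector_derivative_continuous[OF has_vector_derivative_vertical[OF F]])
         (use ab in auto)
    show "continuous_on {a..b} (\<lambda>s. D * s - m / s)"
      using ab by (intro continuous_intros) auto
    fix s assume s: "a < s" "s < b"
    then have s0: "s > 0" using ab by simp
    show "((\<lambda>s. F (Complex x s)) has_vector_derivative \<i> * deriv F (Complex x s)) (at s)"
      by (rule has_vector_derivative_vertical[OF F s0])
    have "((\<lambda>s. D * s - m / s) has_real_derivative (D + m / s\<^sup>2)) (at s)"
      using s0 by (auto intro!: derivative_eq_intros simp: power2_eq_square)
    then show "((\<lambda>s. D * s - m / s) has_vector_derivative (D + m / s\<^sup>2)) (at s)"
      by (simp add: has_real_derivative_iff_has_vector_derivative)
    have "norm (deriv F (Complex x s)) * s \<le> Im (F (Complex x s))"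
      using Schwarz_Pick_uhp[OF F, of "Complex x s"] s0 by simp
    also have "\<dots> \<le> pi * Im (F (Complex x s))"
      using pick_Im_nonneg[OF F, of "Complex x s"] s0 pi_ge_two
      by (simp add: mult_le_cancel_right1)
    also have "\<dots> \<le> m / s + D * s" using bd[of s] s by simp
    also have "\<dots> = (D + m / s\<^sup>2) * s" using s0 by (simp add: field_simps power2_eq_square)
    finally show "norm (\<i> * deriv F (Complex x s)) \<le> D + m / s\<^sup>2"
      using s0 by (simp add: norm_mult)
  qed
  also have "\<dots> \<le> D * b + m / a"
  proof -
    have "0 \<le> m / b" "0 \<le> D * a" using ab m D by auto
    then show ?thesis by linarith
  qed
  finally show ?thesis .
qed

text \<open>
  Regularity passes from \<open>F\<close> to \<open>H\<close> whenever \<open>Im H\<close> is dominated by \<open>Im F\<close> at every point of the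
  half plane that is joined to the diagonals through \<open>\<tau>\<close> by a vertical segment on which \<open>F\<close> stays
  close to its nontangential limit. With \<open>r\<^sub>k = 2\<^sup>-\<^sup>k\<close>, the measures are compared annulus by annulus
  through the averages of \<open>Im F\<close> and \<open>Im H\<close> at the height \<open>y\<^sub>k = \<gamma>(2 C r\<^sub>k)\<close>, where \<open>C\<close> is a
  constant for which \<open>F\<close> is regular. Then \<open>H\<close> is regular with the constant \<open>4 C\<close>.
\<close>

lemma gamma_regular_transfer:
  fixes \<tau> :: real and \<gamma> :: "real \<Rightarrow> real"
  assumes mono: "mono_on {0..} \<gamma>" and nonneg: "\<forall>t\<ge>0. 0 \<le> \<gamma> t" and pos: "\<forall>t>0. 0 < \<gamma> t"
    and O: "\<gamma> \<in> O[at_right 0](\<lambda>t. t\<^sup>2)"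
    and F: "pick F" and H: "pick H"
    and Flim: "nontangential_limit F \<tau> p" and Hlim: "nontangential_limit H \<tau> q"
    and \<rho>: "\<rho> > 0" and d: "d > 0" and K: "K > 0"
    and cmp: "\<And>x y. 0 < \<bar>x - \<tau>\<bar> \<Longrightarrow> \<bar>x - \<tau>\<bar> < d \<Longrightarrow> 0 < y \<Longrightarrow> y \<le> \<bar>x - \<tau>\<bar> \<Longrightarrow>
      (\<And>s. y \<le> s \<Longrightarrow> s \<le> \<bar>x - \<tau>\<bar> \<Longrightarrow> norm (F (Complex x s) - p) < \<rho>) \<Longrightarrow>
      Im (H (Complex x y)) \<le> K * Im (F (Complex x y))"
    and reg: "gamma_regular \<gamma> F \<tau>"
  shows "gamma_regular \<gamma> H \<tau>"
proof -
  define \<mu> where "\<mu> = nevanlinna_measure F"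
  define \<eta> where "\<eta> = nevanlinna_measure H"
  have \<mu>: "locally_finite \<mu>" and \<eta>: "locally_finite \<eta>"
    unfolding \<mu>_def \<eta>_def using nevanlinna_measure_poisson(1) F H by auto
  have sets_mu [measurable_cong]: "sets \<mu> = sets borel" using \<mu> by (rule locally_finite_sets)
  have sets_eta [measurable_cong]: "sets \<eta> = sets borel" using \<eta> by (rule locally_finite_sets)
  have atomF: "emeasure \<mu> {\<tau>} = 0" unfolding \<mu>_def by (rule nevanlinna_measure_no_atom[OF F Flim])
  have atomH: "emeasure \<eta> {\<tau>} = 0" unfolding \<eta>_def by (rule nevanlinna_measure_no_atom[OF H Hlim])
  define I where "I = {-2*\<bar>\<tau>\<bar>-5..2*\<bar>\<tau>\<bar>+5}"
  have [measurable]: "I \<in> sets borel" by (simp add: I_def)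
  obtain C0 where C0: "C0 > 0"
    and W_fin0: "(\<integral>\<^sup>+t\<in>I. 1 / ennreal (\<gamma> (C0 * \<bar>t - \<tau>\<bar>)) \<partial>\<mu>) < \<infinity>"
    and quad_fin: "(\<integral>\<^sup>+t\<in>I. ennreal (1 / (t - \<tau>)\<^sup>2) \<partial>\<mu>) < \<infinity>"
    using gamma_regular_integrable[OF mono nonneg pos O F reg] unfolding \<mu>_def I_def by blast
  define W where "W = (\<lambda>t. 1 / ennreal (\<gamma> (C0 * \<bar>t - \<tau>\<bar>)))"
  have [measurable]: "W \<in> borel_measurable borel"
    unfolding W_def using measurable_mono_on_dist[OF mono C0, of \<tau>] by measurable
  have W_eq: "W t = ennreal (1 / \<gamma> (C0 * \<bar>t - \<tau>\<bar>))" if "t \<noteq> \<tau>" for t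
    using divide_ennreal[of 1 "\<gamma> (C0 * \<bar>t - \<tau>\<bar>)"] pos C0 that by (simp add: W_def)
  have W_fin: "(\<integral>\<^sup>+t\<in>I. W t \<partial>\<mu>) < \<infinity>" using W_fin0 by (simp add: W_def)
  obtain D where D: "D \<ge> 0"
    "\<And>k x s. x \<in> annulus \<tau> k \<Longrightarrow> 0 < s \<Longrightarrow> s \<le> 1 \<Longrightarrow>
      pi * Im (F (Complex x s)) \<le> measure \<mu> {t. \<bar>t - \<tau>\<bar> \<le> 2 * (1/2)^k} / s + D * s"
    "\<And>k y. 0 < y \<Longrightarrow> y \<le> 1 \<Longrightarrow>
      (\<integral>\<^sup>+x\<in>annulus \<tau> k. ennreal (pi * Im (F (Complex x y))) \<partial>lborel) \<le>
      ennreal pi * emeasure \<mu> {t. (1/2)^k / 4 < \<bar>t - \<tau>\<bar> \<and> \<bar>t - \<tau>\<bar> \<le> 2 * (1/2)^k}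
      + ennreal (D * (1/2)^k * y)"
    unfolding \<mu>_def
    by (rule annulus_upper_bounds[OF F, of \<tau>])
       (use quad_fin atomF in \<open>auto simp: I_def \<mu>_def\<close>)
  define C where "C = 2 * C0"
  have C: "C > 0" using C0 by (simp add: C_def)
  define r where "r = (\<lambda>k. (1/2::real)^k)"
  have r: "r k > 0" "r k \<le> 1" for k using half_power_le_1[of k] by (auto simp: r_def)
  have r_lim: "r \<longlonglongrightarrow> 0" unfolding r_def by (intro LIMSEQ_realpow_zero) auto
  define Y where "Y = (\<lambda>k. \<gamma> (C * r k))"
  have Y: "Y k > 0" for k unfolding Y_def using pos C r by simp
  define \<nu> where "\<nu> = density \<mu> (\<lambda>t. W t * indicator I t)"
  have sets_nu [measurable_cong]: "sets \<nu> = sets borel" by (simp add: \<nu>_def sets_mu)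
  have em_nu: "emeasure \<nu> X = (\<integral>\<^sup>+t. (W t * indicator I t) * indicator X t \<partial>\<mu>)" if "X \<in> sets borel" for X
    unfolding \<nu>_def using that by (intro emeasure_density) (auto simp: sets_mu)
  have nu_fin: "emeasure \<nu> UNIV < \<infinity>" using W_fin by (simp add: em_nu)
  have nu_fin': "emeasure \<nu> X < \<infinity>" if "X \<in> sets borel" for X
  proof -
    have "emeasure \<nu> X \<le> emeasure \<nu> UNIV" using that by (intro emeasure_mono) (auto simp: sets_nu)
    then show ?thesis using nu_fin by (rule le_less_trans)
  qed
  define Bk where "Bk = (\<lambda>k. {t. \<bar>t - \<tau>\<bar> \<le> 2 * r k})"
  have Bk_meas [measurable]: "Bk k \<in> sets borel" for k unfolding Bk_def by measurable
  have Bk_sub: "Bk k \<subseteq> {-(\<bar>\<tau>\<bar> + 2)..\<bar>\<tau>\<bar> + 2}" "Bk k \<subseteq> I" for k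
    using r(2)[of k] by (auto simp: Bk_def I_def abs_le_iff)
  \<comment> \<open>on \<open>Bk k\<close> the weight \<open>W\<close> is at least \<open>1 / Y k\<close>\<close>
  have mass: "ennreal (1 / Y k) * emeasure \<mu> X \<le> emeasure \<nu> X" if X: "X \<in> sets borel" "X \<subseteq> Bk k" for k X
  proof -
    have "ennreal (1 / Y k) * emeasure \<mu> X = (\<integral>\<^sup>+t. ennreal (1 / Y k) * indicator X t \<partial>\<mu>)"
      using X(1) by (intro nn_integral_cmult_indicator[symmetric]) (simp add: sets_mu)
    also have "\<dots> \<le> (\<integral>\<^sup>+t. (W t * indicator I t) * indicator X t \<partial>\<mu>)"
    proof (rule nn_integral_mono_AE)
      show "AE t in \<mu>. ennreal (1 / Y k) * indicator X t \<le> (W t * indicator I t) * indicator X t"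
        using AE_not_atom[OF \<mu> atomF]
      proof eventually_elim
        case (elim t)
        show ?case
        proof (cases "t \<in> X")
          case True
          then have t: "\<bar>t - \<tau>\<bar> \<le> 2 * r k" "t \<in> I" using X(2) Bk_sub(2)[of k] by (auto simp: Bk_def)
          have "C0 * \<bar>t - \<tau>\<bar> \<le> C * r k" using t(1) C0 by (simp add: C_def)
          then have "\<gamma> (C0 * \<bar>t - \<tau>\<bar>) \<le> Y k" unfolding Y_def using mono C0 C r(1)[of k] by (auto simp: mono_on_def)
          moreover have "0 < \<gamma> (C0 * \<bar>t - \<tau>\<bar>)" using pos C0 elim by simp
          ultimately have "1 / Y k \<le> 1 / \<gamma> (C0 * \<bar>t - \<tau>\<bar>)" using Y[of k] by (intro divide_left_mono mult_pos_pos) auto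
          then have "ennreal (1 / Y k) \<le> W t" using W_eq[of t] elim by (simp add: ennreal_leI)
          then show ?thesis using True t(2) by simp
        qed simp
      qed
    qed
    also have "\<dots> = emeasure \<nu> X" using em_nu[OF X(1)] by simp
    finally show ?thesis .
  qed
  define i where "i = (\<lambda>k. measure \<nu> (Bk k))"
  have i_lim: "i \<longlonglongrightarrow> 0"
  proof -
    have "(\<lambda>k. emeasure \<nu> (Bk k)) \<longlonglongrightarrow> emeasure \<nu> (\<Inter>k. Bk k)"
    proof (rule Lim_emeasure_decseq)
      show "range Bk \<subseteq> sets \<nu>" by (auto simp: sets_nu)
      show "decseq Bk"
      proof (rule decseq_SucI)
        fix k show "Bk (Suc k) \<subseteq> Bk k" using r(1)[of k] by (auto simp: Bk_def r_def)
      qed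
      show "emeasure \<nu> (Bk k) \<noteq> \<infinity>" for k using nu_fin'[OF Bk_meas] by (simp add: less_top)
    qed
    moreover have "(\<Inter>k. Bk k) = {\<tau>}"
    proof -
      have "t = \<tau>" if t: "\<And>k. t \<in> Bk k" for t
      proof -
        have "(\<lambda>k. 2 * r k) \<longlonglongrightarrow> 2 * 0" by (intro tendsto_intros r_lim)
        then have "\<bar>t - \<tau>\<bar> \<le> 2 * 0"
          by (rule LIMSEQ_le_const) (use t in \<open>auto simp: Bk_def\<close>)
        then show ?thesis by simp
      qed
      then show ?thesis using r(1) by (auto simp: Bk_def less_imp_le)
    qed
    moreover have "emeasure \<nu> {\<tau>} = 0"
    proof -
      have "{\<tau>} \<in> null_sets \<mu>" using atomF by (auto simp: null_sets_def sets_mu)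
      then show ?thesis by (subst em_nu) (auto simp: nn_integral_null_set)
    qed
    ultimately have "(\<lambda>k. emeasure \<nu> (Bk k)) \<longlonglongrightarrow> ennreal 0" by simp
    then have "(\<lambda>k. enn2real (emeasure \<nu> (Bk k))) \<longlonglongrightarrow> 0" by (rule tendsto_enn2real) auto
    then show ?thesis by (simp add: i_def measure_def)
  qed
  have m_le: "measure \<mu> (Bk k) / Y k \<le> i k" for k
  proof -
    have "emeasure \<mu> (Bk k) = ennreal (measure \<mu> (Bk k))"
      by (rule locally_finite_emeasure_eq[OF \<mu> Bk_sub(1)])
    moreover have "emeasure \<nu> (Bk k) = ennreal (i k)"
      unfolding i_def using nu_fin'[OF Bk_meas[of k]] by (simp add: emeasure_eq_ennreal_measure)
    ultimately have "ennreal (1 / Y k * measure \<mu> (Bk k)) \<le> ennreal (i k)"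
      using mass[OF Bk_meas order_refl, of k] Y[of k] by (simp add: ennreal_mult[symmetric])
    then have "1 / Y k * measure \<mu> (Bk k) \<le> i k"
      by (subst (asm) ennreal_le_iff) (auto simp: i_def)
    then show ?thesis by simp
  qed
  obtain d' where d': "d' > 0" "\<And>x. 0 < \<bar>x - \<tau>\<bar> \<Longrightarrow> \<bar>x - \<tau>\<bar> < d' \<Longrightarrow> norm (F (Complex x \<bar>x - \<tau>\<bar>) - p) < \<rho> / 2"
    using nontangential_limit_diagonal[OF Flim, of "\<rho> / 2"] \<rho> by auto
  obtain L where L: "L > 0" "\<And>s. 0 < s \<Longrightarrow> s \<le> 1 \<Longrightarrow> \<gamma> (C * s) \<le> L * s\<^sup>2"
    using mono_on_quadratic_bound[OF mono nonneg O C, of 1] by auto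
  have "eventually (\<lambda>k. L * r k < 1 / 4 \<and> r k < d \<and> r k < d' \<and> D * r k + i k < \<rho> / 2) sequentially"
  proof (intro eventually_conj)
    have "(\<lambda>k. L * r k) \<longlonglongrightarrow> L * 0" by (intro tendsto_intros r_lim)
    then show "eventually (\<lambda>k. L * r k < 1 / 4) sequentially" by (rule order_tendstoD) simp
    show "eventually (\<lambda>k. r k < d) sequentially" "eventually (\<lambda>k. r k < d') sequentially"
      using order_tendstoD(2)[OF r_lim] d d'(1) by auto
    have "(\<lambda>k. D * r k + i k) \<longlonglongrightarrow> D * 0 + 0" by (intro tendsto_intros r_lim i_lim)
    then show "eventually (\<lambda>k. D * r k + i k < \<rho> / 2) sequentially" by (rule order_tendstoD) (use \<rho> in simp)
  qed
  then obtain j where j: "\<And>k. k \<ge> j \<Longrightarrow> L * r k < 1 / 4 \<and> r k < d \<and> r k < d' \<and> D * r k + i k < \<rho> / 2"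
    unfolding eventually_sequentially by blast
  \<comment> \<open>the points at height \<open>Y k\<close> lie below the diagonals, by the quadratic bound on \<open>\<gamma>\<close>\<close>
  have Y_le: "Y k \<le> r k / 4" if "k \<ge> j" for k
  proof -
    have "Y k \<le> (L * r k) * r k" using L(2)[of "r k"] r[of k] by (simp add: Y_def power2_eq_square mult.assoc)
    also have "\<dots> \<le> (1 / 4) * r k" using j[OF that] r(1)[of k] by (intro mult_right_mono) auto
    finally show ?thesis by simp
  qed
  have dominated: "Im (H (Complex x (Y k))) \<le> K * Im (F (Complex x (Y k)))"
    if k: "k \<ge> j" and x: "x \<in> annulus \<tau> k" for k x
  proof (rule cmp)
    have xr: "r k / 2 < \<bar>x - \<tau>\<bar>" "\<bar>x - \<tau>\<bar> \<le> r k" using x by (auto simp: annulus_def r_def)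
    then show x0: "0 < \<bar>x - \<tau>\<bar>" "\<bar>x - \<tau>\<bar> < d" using r(1)[of k] j[OF k] by auto
    show "0 < Y k" by (rule Y)
    show "Y k \<le> \<bar>x - \<tau>\<bar>" using Y_le[OF k] xr r(1)[of k] by linarith
    fix s assume s: "Y k \<le> s" "s \<le> \<bar>x - \<tau>\<bar>"
    have s0: "s > 0" using s Y[of k] by linarith
    have "norm (F (Complex x \<bar>x - \<tau>\<bar>) - F (Complex x s)) \<le> D * \<bar>x - \<tau>\<bar> + measure \<mu> (Bk k) / s"
    proof (rule vertical_oscillation[OF F s0 s(2)])
      fix s' assume s': "s \<le> s'" "s' \<le> \<bar>x - \<tau>\<bar>"
      show "pi * Im (F (Complex x s')) \<le> measure \<mu> (Bk k) / s' + D * s'"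
        unfolding Bk_def r_def by (rule D(2)[OF x]) (use s' s0 xr(2) r(2)[of k] in auto)
    qed (use D(1) in auto)
    also have "\<dots> \<le> D * r k + measure \<mu> (Bk k) / Y k"
      using D(1) xr(2) s Y[of k] s0 by (intro add_mono mult_left_mono divide_left_mono mult_pos_pos) auto
    also have "\<dots> \<le> D * r k + i k" using m_le[of k] by simp
    finally have "norm (F (Complex x \<bar>x - \<tau>\<bar>) - F (Complex x s)) < \<rho> / 2" using j[OF k] by linarith
    moreover have "norm (F (Complex x \<bar>x - \<tau>\<bar>) - p) < \<rho> / 2"
      by (rule d'(2)) (use x0 xr j[OF k] in auto)
    ultimately show "norm (F (Complex x s) - p) < \<rho>"
      using norm_triangle_ineq4[of "F (Complex x \<bar>x - \<tau>\<bar>) - p" "F (Complex x \<bar>x - \<tau>\<bar>) - F (Complex x s)"] by simp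
  qed
  define k1 where "k1 = Suc j"
  \<comment> \<open>the enlarged annulus around the annulus \<open>k\<close> is covered by the annuli \<open>k - 1\<close>, \<open>k\<close> and \<open>k + 1\<close>\<close>
  define T where "T = (\<lambda>n. emeasure \<nu> (annulus \<tau> (n + j)) + emeasure \<nu> (annulus \<tau> (n + k1)) + emeasure \<nu> (annulus \<tau> (n + Suc k1)))"
  have term_le: "ennreal (1 / Y (n + k1)) * emeasure \<eta> (annulus \<tau> (n + k1)) \<le>
      ennreal (2 * K * pi) * T n + ennreal (2 * K * D * r (n + k1))" for n
  proof -
    define k where "k = n + k1"
    have kj: "k \<ge> j" by (simp add: k_def k1_def)
    have y: "0 < Y k" "Y k \<le> (1/2)^k / 4" "Y k \<le> 1"
      using Y[of k] Y_le[OF kj] r(2)[of k] by (auto simp: r_def)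
    define E where "E = {t. r k / 4 < \<bar>t - \<tau>\<bar> \<and> \<bar>t - \<tau>\<bar> \<le> 2 * r k}"
    have E_meas [measurable]: "E \<in> sets borel" unfolding E_def by measurable
    have "emeasure \<eta> (annulus \<tau> k) \<le> 2 * (\<integral>\<^sup>+x\<in>annulus \<tau> k. ennreal (pi * Im (H (Complex x (Y k)))) \<partial>lborel)"
      unfolding \<eta>_def by (rule annulus_mass_le[OF H y(1,2)])
    also have "(\<integral>\<^sup>+x\<in>annulus \<tau> k. ennreal (pi * Im (H (Complex x (Y k)))) \<partial>lborel) \<le>
        (\<integral>\<^sup>+x. ennreal K * (ennreal (pi * Im (F (Complex x (Y k)))) * indicator (annulus \<tau> k) x) \<partial>lborel)"
    proof (rule nn_integral_mono)
      fix x
      show "ennreal (pi * Im (H (Complex x (Y k)))) * indicator (annulus \<tau> k) x \<le>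
          ennreal K * (ennreal (pi * Im (F (Complex x (Y k)))) * indicator (annulus \<tau> k) x)"
      proof (cases "x \<in> annulus \<tau> k")
        case True
        have "pi * Im (H (Complex x (Y k))) \<le> pi * (K * Im (F (Complex x (Y k))))"
          using dominated[OF kj True] by (intro mult_left_mono) auto
        then have "ennreal (pi * Im (H (Complex x (Y k)))) \<le> ennreal (K * (pi * Im (F (Complex x (Y k)))))"
          by (intro ennreal_leI) (simp add: mult_ac)
        also have "\<dots> = ennreal K * ennreal (pi * Im (F (Complex x (Y k))))"
          using K by (intro ennreal_mult') simp
        finally show ?thesis using True by simp
      qed simp
    qed
    also have "\<dots> = ennreal K * (\<integral>\<^sup>+x\<in>annulus \<tau> k. ennreal (pi * Im (F (Complex x (Y k)))) \<partial>lborel)"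
    proof -
      have [measurable]: "(\<lambda>x. Im (F (Complex x (Y k)))) \<in> borel_measurable borel"
        by (rule borel_measurable_continuous_onI[OF continuous_on_Im_horizontal[OF F y(1)]])
      show ?thesis by (rule nn_integral_cmult) measurable
    qed
    also have "(\<integral>\<^sup>+x\<in>annulus \<tau> k. ennreal (pi * Im (F (Complex x (Y k)))) \<partial>lborel) \<le>
        ennreal pi * emeasure \<mu> E + ennreal (D * r k * Y k)"
      unfolding E_def r_def by (rule D(3)[OF y(1,3)])
    finally have "emeasure \<eta> (annulus \<tau> k) \<le> 2 * (ennreal K * (ennreal pi * emeasure \<mu> E + ennreal (D * r k * Y k)))"
      by (simp add: mult_left_mono)
    then have "ennreal (1 / Y k) * emeasure \<eta> (annulus \<tau> k) \<le>
        ennreal (1 / Y k) * (2 * (ennreal K * (ennreal pi * emeasure \<mu> E + ennreal (D * r k * Y k))))"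
      by (rule mult_left_mono) simp
    also have "\<dots> = 2 * ennreal K * ennreal pi * (ennreal (1 / Y k) * emeasure \<mu> E) +
        2 * ennreal K * (ennreal (1 / Y k) * ennreal (D * r k * Y k))"
      by (simp add: distrib_left mult_ac)
    also have "ennreal (1 / Y k) * ennreal (D * r k * Y k) = ennreal (D * r k)"
      using y(1) D(1) r(1)[of k] by (simp add: ennreal_mult[symmetric])
    also have "ennreal (1 / Y k) * emeasure \<mu> E \<le> T n"
    proof -
      have "ennreal (1 / Y k) * emeasure \<mu> E \<le> emeasure \<nu> E"
        by (rule mass[OF E_meas]) (auto simp: E_def Bk_def)
      also have "E \<subseteq> annulus \<tau> (n + j) \<union> annulus \<tau> (n + k1) \<union> annulus \<tau> (n + Suc k1)"
      proof
        fix t assume t: "t \<in> E"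
        have rr: "(1/2)^(n + j) = 2 * r k" "(1/2)^(n + k1) = r k" "(1/2)^(n + Suc k1) = r k / 2"
          by (simp_all add: r_def k_def k1_def)
        show "t \<in> annulus \<tau> (n + j) \<union> annulus \<tau> (n + k1) \<union> annulus \<tau> (n + Suc k1)"
          using t unfolding annulus_def rr E_def by auto
      qed
      then have "emeasure \<nu> E \<le> emeasure \<nu> (annulus \<tau> (n + j) \<union> annulus \<tau> (n + k1) \<union> annulus \<tau> (n + Suc k1))"
        by (intro emeasure_mono) (auto simp: sets_nu)
      also have "\<dots> \<le> emeasure \<nu> (annulus \<tau> (n + j) \<union> annulus \<tau> (n + k1)) + emeasure \<nu> (annulus \<tau> (n + Suc k1))"
        by (intro emeasure_subadditive) (auto simp: sets_nu)
      also have "\<dots> \<le> T n"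
        unfolding T_def by (intro add_right_mono emeasure_subadditive) (auto simp: sets_nu)
      finally show ?thesis .
    qed
    finally have "ennreal (1 / Y k) * emeasure \<eta> (annulus \<tau> k) \<le>
        2 * ennreal K * ennreal pi * T n + 2 * ennreal K * ennreal (D * r k)"
      by (simp add: mult_left_mono add_right_mono)
    also have "2 * ennreal K * ennreal pi = ennreal (2 * K * pi)"
      using K by (simp add: ennreal_mult)
    also have "2 * ennreal K * ennreal (D * r k) = ennreal (2 * K * D * r k)"
      using K D(1) r(1)[of k] by (simp add: ennreal_mult mult.assoc)
    finally show ?thesis by (simp add: k_def)
  qed
  have T_fin: "(\<Sum>n. T n) < \<infinity>"
  proof -
    have fin: "(\<Sum>n. emeasure \<nu> (annulus \<tau> (n + l))) < \<infinity>" for l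
    proof -
      have "(\<Sum>n. emeasure \<nu> (annulus \<tau> (n + l))) = emeasure \<nu> (\<Union>n. annulus \<tau> (n + l))"
        by (rule suminf_emeasure) (auto simp: sets_nu disjoint_family_annulus_offset)
      also have "\<dots> < \<infinity>" by (rule nu_fin') measurable
      finally show ?thesis .
    qed
    have "(\<Sum>n. T n) = (\<Sum>n. emeasure \<nu> (annulus \<tau> (n + j))) + (\<Sum>n. emeasure \<nu> (annulus \<tau> (n + k1)))
        + (\<Sum>n. emeasure \<nu> (annulus \<tau> (n + Suc k1)))"
      unfolding T_def by (simp only: suminf_add[OF summableI summableI, symmetric])
    then show ?thesis using fin[of j] fin[of k1] fin[of "Suc k1"] by simp
  qed
  have sum_fin: "(\<Sum>n. ennreal (1 / Y (n + k1)) * emeasure \<eta> (annulus \<tau> (n + k1))) < \<infinity>"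
  proof -
    have "(\<Sum>n. ennreal (1 / Y (n + k1)) * emeasure \<eta> (annulus \<tau> (n + k1))) \<le>
        (\<Sum>n. ennreal (2 * K * pi) * T n + ennreal (2 * K * D * r (n + k1)))"
      by (intro suminf_le term_le summableI)
    also have "\<dots> = (\<Sum>n. ennreal (2 * K * pi) * T n) + (\<Sum>n. ennreal (2 * K * D * r (n + k1)))"
      by (simp only: suminf_add[OF summableI summableI, symmetric])
    also have "(\<Sum>n. ennreal (2 * K * pi) * T n) = ennreal (2 * K * pi) * (\<Sum>n. T n)"
      by (rule ennreal_suminf_cmult)
    also have "(\<Sum>n. ennreal (2 * K * D * r (n + k1))) = ennreal (\<Sum>n. 2 * K * D * r (n + k1))"
    proof (rule suminf_ennreal2)
      show "0 \<le> 2 * K * D * r (n + k1)" for n using K D(1) r(1)[of "n + k1"] by simp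
      have "summable r" unfolding r_def by (intro summable_geometric) auto
      then show "summable (\<lambda>n. 2 * K * D * r (n + k1))"
        by (intro summable_mult) (simp only: summable_iff_shift)
    qed
    also have "ennreal (2 * K * pi) * (\<Sum>n. T n) + \<dots> < \<infinity>"
      using T_fin by (simp add: ennreal_mult_less_top)
    finally show ?thesis .
  qed
  define C1 where "C1 = 2 * C"
  have C1: "C1 > 0" using C by (simp add: C1_def)
  have "(\<integral>\<^sup>+t\<in>ball \<tau> (r k1). 1 / ennreal (\<gamma> (C1 * \<bar>t - \<tau>\<bar>)) \<partial>\<eta>) \<le>
      (\<integral>\<^sup>+t. (\<Sum>n. ennreal (1 / Y (n + k1)) * indicator (annulus \<tau> (n + k1)) t) \<partial>\<eta>)"
  proof (rule nn_integral_mono_AE)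
    show "AE t in \<eta>. 1 / ennreal (\<gamma> (C1 * \<bar>t - \<tau>\<bar>)) * indicator (ball \<tau> (r k1)) t \<le>
        (\<Sum>n. ennreal (1 / Y (n + k1)) * indicator (annulus \<tau> (n + k1)) t)"
      using AE_not_atom[OF \<eta> atomH]
    proof eventually_elim
      case (elim t)
      show ?case
      proof (cases "t \<in> ball \<tau> (r k1)")
        case True
        then have "\<bar>t - \<tau>\<bar> \<le> (1/2)^k1" by (simp add: dist_real_def r_def abs_minus_commute)
        then obtain n where n: "t \<in> annulus \<tau> (n + k1)" using annulus_covers[of t \<tau> k1] elim by blast
        then have "r (n + k1) / 2 < \<bar>t - \<tau>\<bar>" by (simp add: annulus_def r_def)
        then have "C * r (n + k1) \<le> C1 * \<bar>t - \<tau>\<bar>" using C by (simp add: C1_def)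
        then have "Y (n + k1) \<le> \<gamma> (C1 * \<bar>t - \<tau>\<bar>)"
          unfolding Y_def using mono C C1 r(1)[of "n + k1"] by (auto simp: mono_on_def)
        then have "1 / \<gamma> (C1 * \<bar>t - \<tau>\<bar>) \<le> 1 / Y (n + k1)"
          using Y[of "n + k1"] by (intro divide_left_mono mult_pos_pos) auto
        moreover have "1 / ennreal (\<gamma> (C1 * \<bar>t - \<tau>\<bar>)) = ennreal (1 / \<gamma> (C1 * \<bar>t - \<tau>\<bar>))"
          using divide_ennreal[of 1 "\<gamma> (C1 * \<bar>t - \<tau>\<bar>)"] pos C1 elim by simp
        ultimately have "1 / ennreal (\<gamma> (C1 * \<bar>t - \<tau>\<bar>)) * indicator (ball \<tau> (r k1)) t \<le>
            ennreal (1 / Y (n + k1)) * indicator (annulus \<tau> (n + k1)) t"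
          using True n by (simp add: ennreal_leI)
        also have "\<dots> \<le> (\<Sum>n. ennreal (1 / Y (n + k1)) * indicator (annulus \<tau> (n + k1)) t)"
        proof -
          define G where "G = (\<lambda>n. ennreal (1 / Y (n + k1)) * indicator (annulus \<tau> (n + k1)) t)"
          have "sum G {n} \<le> suminf G" by (rule sum_le_suminf[OF summableI]) auto
          then have "G n \<le> suminf G" by simp
          then show ?thesis by (simp only: G_def)
        qed
        finally show ?thesis .
      qed simp
    qed
  qed
  also have "\<dots> = (\<Sum>n. \<integral>\<^sup>+t. ennreal (1 / Y (n + k1)) * indicator (annulus \<tau> (n + k1)) t \<partial>\<eta>)"
    by (rule nn_integral_suminf) measurable
  also have "\<dots> = (\<Sum>n. ennreal (1 / Y (n + k1)) * emeasure \<eta> (annulus \<tau> (n + k1)))"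
    by (intro suminf_cong nn_integral_cmult_indicator) (simp add: sets_eta)
  also have "\<dots> < \<infinity>" by (rule sum_fin)
  finally show ?thesis
    unfolding gamma_regular_def \<eta>_def using C1 r(1)[of k1]
    by (intro exI[of _ C1] conjI exI[of _ "ball \<tau> (r k1)"]) auto
qed

section \<open>Composition with a function that is real on the real axis\<close>

lemma pickI:
  assumes "f analytic_on upper_half_plane" "f ` upper_half_plane \<subseteq> closed_upper_half_plane"
  shows "pick f"
  using assms analytic_imp_holomorphic by (auto simp: pick_def)

text \<open>
  If \<open>f\<close> takes a real value in the half plane, it is constant, and the composition is constant too;
  otherwise \<open>f\<close> maps into the open half plane, where \<open>g\<close> is a Pick function.
\<close>

lemma pick_compose:
  assumes f: "pick f" and g: "pick g"
    and const: "\<And>c. Im c = 0 \<Longrightarrow> (\<And>z. Im z > 0 \<Longrightarrow> f z = c) \<Longrightarrow> 0 \<le> Im (g c)"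
  shows "pick (g \<circ> f)"
proof (cases "\<exists>z. Im z > 0 \<and> Im (f z) = 0")
  case True
  then obtain z0 where z0: "Im z0 > 0" "Im (f z0) = 0" by blast
  then obtain c where c: "\<And>z. Im z > 0 \<Longrightarrow> f z = c"
    using pick_eq_zero_imp_constant[OF f z0] by (auto simp: constant_on_def)
  have "(g \<circ> f) holomorphic_on {z. Im z > 0} \<longleftrightarrow> (\<lambda>z. g c) holomorphic_on {z. Im z > 0}"
    by (intro holomorphic_cong) (auto simp: c)
  moreover have "0 \<le> Im (g c)" by (rule const) (use z0 c in auto)
  ultimately show ?thesis by (auto simp: pick_def c)
next
  case False
  then have pos: "Im (f z) > 0" if "Im z > 0" for z
    using pick_Im_nonneg[OF f that] that by fastforce
  have "(g \<circ> f) holomorphic_on {z. Im z > 0}"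
    using pick_holo[OF f] pick_holo[OF g] pos
    by (intro holomorphic_on_compose_gen) auto
  then show ?thesis
    using pos pick_Im_nonneg[OF g] by (auto simp: pick_def)
qed

lemma nontangential_limit_compose:
  assumes "nontangential_limit f \<tau> p" "isCont g p"
  shows "nontangential_limit (g \<circ> f) \<tau> (g p)"
  using assms unfolding nontangential_limit_def o_def
  by (auto intro: isCont_tendsto_compose)

lemma isCont_holomorphic:
  assumes "g holomorphic_on S" "open S" "p \<in> S" shows "isCont g p"
  using assms holomorphic_on_imp_continuous_on continuous_on_eq_continuous_at by blast

text \<open>
  If \<open>p\<close> is real, the mean value inequality compares \<open>g(w)\<close> with the real number \<open>g(Re w)\<close>. If \<open>p\<close>
  lies in the open half plane, both sides are bounded and \<open>Im w\<close> is bounded below near \<open>p\<close>.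
\<close>

lemma Im_le_of_real_on_reals:
  assumes U: "open U" "p \<in> U" and g: "g holomorphic_on U" and real: "g ` (\<real> \<inter> U) \<subseteq> \<real>" and p: "Im p \<ge> 0"
  obtains \<rho> K where "\<rho> > 0" "K > 0"
    "\<And>w. norm (w - p) < \<rho> \<Longrightarrow> Im w \<ge> 0 \<Longrightarrow> Im (g w) \<le> K * Im w"
proof (cases "Im p = 0")
  case True
  obtain \<rho> where \<rho>: "\<rho> > 0" "cball p \<rho> \<subseteq> U" using U by (meson open_contains_cball)
  have "continuous_on U (deriv g)"
    using holomorphic_deriv[OF g U(1)] by (rule holomorphic_on_imp_continuous_on)
  then have "compact (deriv g ` cball p \<rho>)"
    using compact_continuous_image[OF continuous_on_subset[OF _ \<rho>(2)] compact_cball] by blast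
  then have "bounded (deriv g ` cball p \<rho>)" by (rule compact_imp_bounded)
  then obtain K where K: "K > 0" "\<And>w. w \<in> cball p \<rho> \<Longrightarrow> norm (deriv g w) \<le> K"
    unfolding bounded_pos by blast
  have "Im (g w) \<le> K * Im w" if w: "norm (w - p) < \<rho>" "Im w \<ge> 0" for w
  proof -
    define a where "a = complex_of_real (Re w)"
    have "a - p = of_real (Re (w - p))" using True by (simp add: a_def complex_eq_iff)
    then have "norm (a - p) = \<bar>Re (w - p)\<bar>" by (simp only: norm_of_real)
    then have a_in: "a \<in> cball p \<rho>"
      using abs_Re_le_cmod[of "w - p"] w(1) by (simp add: dist_norm norm_minus_commute)
    have w_in: "w \<in> cball p \<rho>" using w(1) by (simp add: dist_norm norm_minus_commute)
    have "norm (g w - g a) \<le> K * norm (w - a)"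
    proof (rule field_differentiable_bound[OF convex_cball[of p \<rho>]])
      fix z assume z: "z \<in> cball p \<rho>"
      show "(g has_field_derivative deriv g z) (at z within cball p \<rho>)"
        using holomorphic_derivI[OF g U(1)] z \<rho>(2) has_field_derivative_at_within by blast
      show "norm (deriv g z) \<le> K" by (rule K(2)[OF z])
    qed (rule w_in a_in)+
    moreover have "w - a = \<i> * of_real (Im w)" by (simp add: a_def complex_eq_iff)
    ultimately have "norm (g w - g a) \<le> K * Im w" using w(2) by (simp add: norm_mult)
    moreover have "a \<in> \<real> \<inter> U" using a_in \<rho>(2) by (auto simp: a_def)
    then have "g a \<in> \<real>" using real by blast
    then have "Im (g a) = 0" by (simp add: complex_is_Real_iff)
    ultimately show ?thesis using abs_Im_le_cmod[of "g w - g a"] by simp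
  qed
  with \<rho>(1) K(1) show thesis using that by blast
next
  case False
  then have p0: "Im p > 0" using p by simp
  define K where "K = (\<bar>Im (g p)\<bar> + 1) / (Im p / 2)"
  have K: "K > 0" using p0 by (simp add: K_def)
  have "((\<lambda>w. Im (g w) - K * Im w) \<longlongrightarrow> Im (g p) - K * Im p) (nhds p)"
    using isCont_holomorphic[OF g U] unfolding isCont_def tendsto_at_iff_tendsto_nhds
    by (intro tendsto_intros filterlim_ident)
  moreover have "Im (g p) - K * Im p < 0" using p0 by (simp add: K_def)
  ultimately have "eventually (\<lambda>w. Im (g w) - K * Im w < 0) (nhds p)"
    by (rule order_tendstoD(2))
  then obtain \<rho> where "\<rho> > 0" "\<And>w. dist w p < \<rho> \<Longrightarrow> Im (g w) - K * Im w < 0"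
    unfolding eventually_nhds_metric by blast
  then show thesis using that[OF _ K, of \<rho>] by (force simp: dist_norm)
qed

text \<open>
  A form of the Hopf lemma: \<open>Im g(x + i y) / y\<close> decreases in \<open>y\<close>, so for \<open>y \<le> T\<close> it is bounded below
  by its value at height \<open>T\<close>.
\<close>

lemma Im_ge_of_pick:
  assumes g: "pick g" and nc: "\<not> g constant_on {z. Im z > 0}" and T: "T > 0"
  obtains c where "c > 0" "\<And>w. \<bar>Re w - a\<bar> \<le> 1 \<Longrightarrow> 0 < Im w \<Longrightarrow> Im w \<le> T \<Longrightarrow> c * Im w \<le> Im (g w)"
proof -
  have pos: "Im (g w) > 0" if "Im w > 0" for w
    using pick_eq_zero_imp_constant[OF g that] nc pick_Im_nonneg[OF g that] by fastforce
  have "continuous_on {a - 1..a + 1} (\<lambda>x. Im (g (Complex x T)))"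
    by (rule continuous_on_subset[OF continuous_on_Im_horizontal[OF g T]]) auto
  then obtain x0 where x0: "\<And>x. x \<in> {a - 1..a + 1} \<Longrightarrow> Im (g (Complex x0 T)) \<le> Im (g (Complex x T))"
    using continuous_attains_inf[of "{a - 1..a + 1}" "\<lambda>x. Im (g (Complex x T))"] by force
  show thesis
  proof (rule that[of "Im (g (Complex x0 T)) / T"])
    show "Im (g (Complex x0 T)) / T > 0" using pos[of "Complex x0 T"] T by simp
    fix w assume w: "\<bar>Re w - a\<bar> \<le> 1" "0 < Im w" "Im w \<le> T"
    have "Im (g (Complex x0 T)) / T \<le> Im (g (Complex (Re w) T)) / T"
      using w(1) T by (intro divide_right_mono x0) (auto simp: abs_le_iff)
    also have "\<dots> \<le> Im (g w) / Im w"
      using pick_divide_height_antimono[OF g w(2,3), of "Re w"] by simp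
    finally show "Im (g (Complex x0 T)) / T * Im w \<le> Im (g w)"
      using w(2) by (simp add: pos_le_divide_eq)
  qed
qed

theorem theorem5p5:
  fixes \<tau> :: real and \<gamma> :: "real \<Rightarrow> real"
    and f g :: "complex \<Rightarrow> complex" and f\<tau> :: complex and U :: "complex set"
  assumes "mono_on {0..} \<gamma>" and "\<forall>t\<ge>0. 0 \<le> \<gamma> t" and "\<forall>t>0. 0 < \<gamma> t"
    and "\<gamma> \<in> O[at_right 0](\<lambda>t. t\<^sup>2)"
    and "augury \<gamma> \<gamma>"
    and "f analytic_on upper_half_plane" and "f ` upper_half_plane \<subseteq> closed_upper_half_plane"
    and "nontangential_limit f \<tau> f\<tau>"
    and "open U" and "f\<tau> \<in> U"
    and "g analytic_on (upper_half_plane \<union> U)"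
    and "\<not> g constant_on upper_half_plane"
    and "g ` upper_half_plane \<subseteq> closed_upper_half_plane"
    and "g ` (\<real> \<inter> U) \<subseteq> \<real>"
  shows "gamma_regular \<gamma> f \<tau> \<longleftrightarrow> gamma_regular \<gamma> (g \<circ> f) \<tau>"
proof -
  have f: "pick f" by (rule pickI) fact+
  have g: "pick g"
    by (rule pickI) (use assms(11,13) analytic_on_Un in auto)
  have gU: "g holomorphic_on U"
    using assms(11) analytic_on_Un analytic_imp_holomorphic by blast
  have real0: "Im (g w) = 0" if "Im w = 0" "w \<in> U" for w
  proof -
    have "w \<in> \<real> \<inter> U" using that by (simp add: complex_is_Real_iff)
    then have "g w \<in> \<real>" using assms(14) by blast
    then show ?thesis by (simp add: complex_is_Real_iff)
  qed
  have h: "pick (g \<circ> f)"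
  proof (rule pick_compose[OF f g])
    fix c assume c: "Im c = 0" "\<And>z. Im z > 0 \<Longrightarrow> f z = c"
    have "((\<lambda>y. f (Complex \<tau> y)) \<longlongrightarrow> c) (at_right 0)"
      by (rule tendsto_eventually, rule eventually_mono[OF eventually_at_right_less[of 0]]) (simp add: c(2))
    then have "c = f\<tau>"
      using tendsto_unique[OF _ _ nontangential_limit_vertical[OF assms(8)]] by simp
    then show "0 \<le> Im (g c)" using real0[OF c(1)] assms(10) by simp
  qed
  have hlim: "nontangential_limit (g \<circ> f) \<tau> (g f\<tau>)"
    by (rule nontangential_limit_compose[OF assms(8) isCont_holomorphic[OF gU assms(9,10)]])
  have p: "0 \<le> Im f\<tau>"
  proof (rule tendsto_lowerbound)
    show "((\<lambda>y. Im (f (Complex \<tau> y))) \<longlongrightarrow> Im f\<tau>) (at_right 0)"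
      by (intro tendsto_intros nontangential_limit_vertical[OF assms(8)])
    show "\<forall>\<^sub>F y in at_right 0. 0 \<le> Im (f (Complex \<tau> y))"
      using eventually_at_right_less[of "0::real"]
      by eventually_elim (auto intro: pick_Im_nonneg[OF f])
  qed simp
  show ?thesis
  proof
    assume reg: "gamma_regular \<gamma> f \<tau>"
    obtain \<rho> K where \<rho>: "\<rho> > 0" and K: "K > 0"
      and le: "\<And>w. norm (w - f\<tau>) < \<rho> \<Longrightarrow> Im w \<ge> 0 \<Longrightarrow> Im (g w) \<le> K * Im w"
      by (rule Im_le_of_real_on_reals[OF assms(9,10) gU assms(14) p]) blast
    show "gamma_regular \<gamma> (g \<circ> f) \<tau>"
    proof (rule gamma_regular_transfer[OF assms(1-4) f h assms(8) hlim \<rho> zero_less_one K _ reg])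
      fix x y :: real
      assume y: "0 < y" "y \<le> \<bar>x - \<tau>\<bar>" and near: "\<And>s. y \<le> s \<Longrightarrow> s \<le> \<bar>x - \<tau>\<bar> \<Longrightarrow> norm (f (Complex x s) - f\<tau>) < \<rho>"
      show "Im ((g \<circ> f) (Complex x y)) \<le> K * Im (f (Complex x y))"
        using le[OF near[OF order_refl y(2)] pick_Im_nonneg[OF f]] y(1) by simp
    qed
  next
    assume reg: "gamma_regular \<gamma> (g \<circ> f) \<tau>"
    obtain r0 where r0: "r0 > 0" "ball f\<tau> r0 \<subseteq> U" using assms(9,10) by (meson open_contains_ball)
    \<comment> \<open>the ball meets the open half plane, so its points are connected to points where \<open>g \<noteq> g f\<tau>\<close>\<close>
    have conn: "connected (ball f\<tau> r0 \<union> {z. Im z > 0})"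
    proof (rule connected_Un)
      have "f\<tau> + \<i> * of_real (r0 / 2) \<in> ball f\<tau> r0 \<inter> {z. Im z > 0}"
        using r0(1) p by (simp add: dist_norm norm_mult add_nonneg_pos)
      then show "ball f\<tau> r0 \<inter> {z. Im z > 0} \<noteq> {}" by blast
    qed (auto simp: connected_uhp)
    obtain w0 where w0: "Im w0 > 0" "g w0 \<noteq> g f\<tau>"
      using assms(12) by (auto simp: constant_on_def)
    obtain r where r: "r > 0" "ball f\<tau> r \<subseteq> ball f\<tau> r0 \<union> {z. Im z > 0}" "\<And>z. z \<in> ball f\<tau> r - {f\<tau>} \<Longrightarrow> g z - g f\<tau> \<noteq> 0"
    proof (rule isolated_zeros[OF _ _ conn, of "\<lambda>z. g z - g f\<tau>" f\<tau> w0])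
      have "g holomorphic_on (ball f\<tau> r0 \<union> {z. Im z > 0})"
        using holomorphic_on_subset[OF gU r0(2)] pick_holo[OF g] open_uhp by (intro holomorphic_on_Un) auto
      then show "(\<lambda>z. g z - g f\<tau>) holomorphic_on (ball f\<tau> r0 \<union> {z. Im z > 0})"
        by (rule holomorphic_on_diff) (rule holomorphic_on_const)
    qed (use r0(1) w0 open_uhp in auto)
    define \<delta> where "\<delta> = min (min (r / 2) (r0 / 2)) 1"
    have \<delta>: "\<delta> > 0" "\<delta> \<le> 1" "\<delta> < r" "\<delta> < r0" using r(1) r0(1) by (auto simp: \<delta>_def)
    have "sphere f\<tau> \<delta> \<subseteq> U" using \<delta>(4) r0(2) by force
    then have "continuous_on (sphere f\<tau> \<delta>) g"
      using holomorphic_on_imp_continuous_on[OF gU] continuous_on_subset by blast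
    then have "continuous_on (sphere f\<tau> \<delta>) (\<lambda>w. norm (g w - g f\<tau>))"
      by (intro continuous_intros)
    moreover have "sphere f\<tau> \<delta> \<noteq> {}" using \<delta>(1) by simp
    ultimately obtain w1 where w1: "w1 \<in> sphere f\<tau> \<delta>"
      "\<And>w. w \<in> sphere f\<tau> \<delta> \<Longrightarrow> norm (g w1 - g f\<tau>) \<le> norm (g w - g f\<tau>)"
      using continuous_attains_inf[of "sphere f\<tau> \<delta>" "\<lambda>w. norm (g w - g f\<tau>)"] by auto
    define m where "m = norm (g w1 - g f\<tau>)"
    have m: "m > 0"
      using r(3)[of w1] w1(1) \<delta> by (auto simp: m_def dist_norm norm_minus_commute)
    obtain d where d: "d > 0" "\<And>x. 0 < \<bar>x - \<tau>\<bar> \<Longrightarrow> \<bar>x - \<tau>\<bar> < d \<Longrightarrow> norm (f (Complex x \<bar>x - \<tau>\<bar>) - f\<tau>) < \<delta>"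
      using nontangential_limit_diagonal[OF assms(8) \<delta>(1)] by blast
    have T: "Im f\<tau> + 1 > 0" using p by simp
    obtain c where c: "c > 0"
      "\<And>w. \<bar>Re w - Re f\<tau>\<bar> \<le> 1 \<Longrightarrow> 0 < Im w \<Longrightarrow> Im w \<le> Im f\<tau> + 1 \<Longrightarrow> c * Im w \<le> Im (g w)"
      by (rule Im_ge_of_pick[OF g assms(12) T, of "Re f\<tau>"]) blast
    show "gamma_regular \<gamma> f \<tau>"
    proof (rule gamma_regular_transfer[OF assms(1-4) h f hlim assms(8) m d(1) _ _ reg])
      show "1 / c > 0" using c(1) by simp
      fix x y :: real
      assume x: "0 < \<bar>x - \<tau>\<bar>" "\<bar>x - \<tau>\<bar> < d" and y: "0 < y" "y \<le> \<bar>x - \<tau>\<bar>"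
        and near: "\<And>s. y \<le> s \<Longrightarrow> s \<le> \<bar>x - \<tau>\<bar> \<Longrightarrow> norm ((g \<circ> f) (Complex x s) - g f\<tau>) < m"
      define w where "w = f (Complex x y)"
      have Im_w: "Im w \<ge> 0" unfolding w_def using y by (intro pick_Im_nonneg[OF f]) simp
      \<comment> \<open>otherwise \<open>f\<close> would meet the circle of radius \<open>\<delta>\<close> on the segment, where \<open>\<bar>g - g f\<tau>\<bar> \<ge> m\<close>\<close>
      have w_near: "norm (w - f\<tau>) < \<delta>"
      proof (rule ccontr)
        assume far: "\<not> norm (w - f\<tau>) < \<delta>"
        have "continuous_on {y..\<bar>x - \<tau>\<bar>} (\<lambda>s. norm (f (Complex x s) - f\<tau>))"
          by (intro continuous_intros continuous_at_imp_continuous_on ballI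
              has_vector_derivative_continuous[OF has_vector_derivative_vertical[OF f]]) (use y in auto)
        then obtain s where s: "y \<le> s" "s \<le> \<bar>x - \<tau>\<bar>" "norm (f (Complex x s) - f\<tau>) = \<delta>"
          using IVT2'[of "\<lambda>s. norm (f (Complex x s) - f\<tau>)" "\<bar>x - \<tau>\<bar>" \<delta> y] d(2)[OF x] far y by (auto simp: w_def)
        then have "f (Complex x s) \<in> sphere f\<tau> \<delta>" by (simp add: dist_norm norm_minus_commute)
        then have "m \<le> norm (g (f (Complex x s)) - g f\<tau>)" unfolding m_def by (rule w1(2))
        then show False using near[OF s(1,2)] by simp
      qed
      have wU: "w \<in> U" using w_near \<delta>(4) r0(2) by (force simp: dist_norm norm_minus_commute)
      have bd: "\<bar>Re w - Re f\<tau>\<bar> \<le> 1" "Im w \<le> Im f\<tau> + 1"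
        using abs_Re_le_cmod[of "w - f\<tau>"] abs_Im_le_cmod[of "w - f\<tau>"] w_near \<delta>(2) by auto
      have "c * Im w \<le> Im (g w)"
        using real0[OF _ wU] c(2)[OF bd(1) _ bd(2)] Im_w by (cases "Im w = 0") auto
      then show "Im (f (Complex x y)) \<le> 1 / c * Im ((g \<circ> f) (Complex x y))"
        using c(1) by (simp add: w_def field_simps)
    qed
  qed
qed

end
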